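(* Let $s\ge 0$ and $k\ge 1$ be integers, let $F(x) = x^{2^s \cdot 3^k+1} + ax +b \in \mathbb{Z}[x]$ be irreducible over $\mathbb{Q}$, and let $K=\mathbb{Q}(\theta)$, where $\theta$ is a complex root of $F(x)$. If one of the following conditions holds: (1) $s=0$, $k \ge 3$ and $(\bar{a},\bar{b}) \in \{\overline{1},\overline{80}\}\times \{\overline{27}, \overline{54}\}\cup \{\overline{26}, \overline{28}, \overline{53}, \overline{55}\} \times \{ \overline{0} \}$ in $(\mathbb{Z}/81\mathbb{Z})^2$; (2) $s=0$, $k \ge 4$ and $(\bar{a},\bar{b}) \in \{\overline{1},\overline{242} \} \times \{\overline{81}, \overline{162}\}\cup \{\overline{80}, \overline{82}, \overline{161}, \overline{163}\} \times \{ \overline{0} \}$ in $(\mathbb{Z}/243\mathbb{Z})^2$; (3) $s=0$, $k =2$, $a \equiv \pm 1 \pmod{81}$ and $b\equiv 0 \pmod{81}$; (4) $s=0$, $k =3$, $a \equiv \pm 1 \pmod{243}$ and $b\equiv 0 \pmod{243}$; (5) $s \ge 1$, $k \ge 2$ and $(\bar{a},\bar{b}) \in \{\overline{26}\} \times \{ \overline{9}, \overline{18}\}\cup \{\overline{8}, \overline{17}\} \times \{ \overline{0} \}$ in $(\mathbb{Z}/27\mathbb{Z})^2$; (6) $s \ge 1$, $k \ge 3$ and $(\bar{a},\bar{b}) \in \{\overline{80}\}\times\{\overline{27}, \overline{54}\}\cup \{\overline{26}, \overline{53}\}\times\{\overline{0}, \overline{27}, \overline{54}\}$ in $(\mathbb{Z}/81\mathbb{Z})^2$;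 (7) $s \ge 1$, $k = 1$, $a \equiv -1 \pmod{27}$ and $b\equiv 0 \pmod{27}$; (8) $s \ge 1$, $k = 2$, $a \equiv -1 \pmod{81}$ and $b\equiv 0 \pmod{81}$; (9) $s=2$, $k=3$, $a \equiv -1 \pmod{243}$ and $b\equiv 0 \pmod{243}$; (10) $s=2$, $k\ge 4$ and $(\bar{a},\bar{b}) \in \{\overline{80}, \overline{161}, \overline{242}\} \times \{\overline{81}, \overline{162} \}\cup \{\overline{80}, \overline{161}\} \times \{\overline{0} \}$ in $(\mathbb{Z}/243\mathbb{Z})^2$; (11) $s \ge 3$, $k \ge 2$ and $(\bar{a},\bar{b}) \in\{\overline{8}, \overline{17}, \overline{26}\} \times \{\overline{9}, \overline{18} \}\cup \{\overline{8}, \overline{17} \} \times \{\overline{0} \}$ in $(\mathbb{Z}/27\mathbb{Z})^2$; (12) $s=1$, $k=3$, $a \equiv 1 \pmod{243}$ and $b\equiv 0 \pmod{243}$; (13) $s=1$, $k\ge 4$ and $(\bar{a},\bar{b}) \in \{\overline{1}, \overline{82}, \overline{163}\} \times \{ \overline{81}, \overline{162} \}\cup \{\overline{82}, \overline{163} \} \times \{ \overline{0} \}$ in $(\mathbb{Z}/243\mathbb{Z})^2$; (14) $s=2$, $k=1$, $a \equiv 1 \pmod{27}$ and $b\equiv 0 \pmod{27}$; (15) $s=2$, $k\ge 2$ and $(\bar{a},\bar{b}) \in \{\overline{1},\overline{10}, \overline{19}\}\times\{\overline{9}, \overline{18} \}\cup \{\overline{10}, \overline{19}\}\times\{ \overline{0}\}$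 in $(\mathbb{Z}/27\mathbb{Z})^2$; then $K$ is not monogenic.
   Context: $\bar t$ denotes the residue class of the integer $t$ in the indicated ring $\mathbb{Z}/N\mathbb{Z}$. $\mathbb{Z}_K$ denotes the ring of integers of $K$. $K$ is called monogenic if $\mathbb{Z}_K=\mathbb{Z}[\eta]$ for some $\eta\in\mathbb{Z}_K$ with $K=\mathbb{Q}(\eta)$; otherwise $K$ is not monogenic. *)

theory Defs
  imports "HOL-Computational_Algebra.Computational_Algebra" "HOL-Number_Theory.Cong"
begin

definition trinomial :: "nat \<Rightarrow> int \<Rightarrow> int \<Rightarrow> int poly" where
  "trinomial n a b = monom 1 n + [:b, a:]"

definition complex_subfield :: "complex set \<Rightarrow> bool" where
  "complex_subfield L \<longleftrightarrow>
     1 \<in> L \<and> (\<forall>x\<in>L. \<forall>y\<in>L. x - y \<in> L \<and> x * y \<in> L) \<and> (\<forall>x\<in>L. inverse x \<in> L)"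

text \<open>Every subfield of the complex numbers contains the rationals, so the smallest
  subfield containing \<open>\<theta>\<close> is the simple extension of the rationals by \<open>\<theta>\<close>.\<close>

definition rat_adjoin :: "complex \<Rightarrow> complex set" where
  "rat_adjoin \<theta> = \<Inter>{L. complex_subfield L \<and> \<theta> \<in> L}"

definition int_adjoin :: "complex \<Rightarrow> complex set" where
  "int_adjoin \<eta> = range (\<lambda>p :: int poly. poly (map_poly of_int p) \<eta>)"

definition ring_of_integers :: "complex set \<Rightarrow> complex set" where
  "ring_of_integers K = {x \<in> K. algebraic_int x}"

definition monogenic :: "complex set \<Rightarrow> bool" where
  "monogenic K \<longleftrightarrow>
     (\<exists>\<eta>\<in>ring_of_integers K. K = rat_adjoin \<eta> \<and> ring_of_integers K = int_adjoin \<eta>)"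

end

theory Submission
  imports Defs "Jordan_Normal_Form.Char_Poly" "HOL-Computational_Algebra.Field_as_Ring"
begin

text \<open>Suppose the ring of integers of \<open>K = \<rat>(\<theta>)\<close> is \<open>\<int>[\<eta>]\<close>. A prime of \<open>K\<close> above \<open>3\<close> with residue field
  contained in the field of \<open>q\<close> elements is then determined, up to conjugation, by the residue of \<open>\<eta>\<close>,
  a root of \<open>X\<^sup>q - X\<close>; so there are at most three such primes of degree one, and at most three of
  degree two. In each case of the theorem the Newton polygons of \<open>F(\<zeta> + T)\<close>, where \<open>\<zeta>\<close> is \<open>0\<close> or a root
  of \<open>x\<^bsup>2^s\<^esup> \<plusminus> 1\<close>, provide four. Primes of \<open>K\<close> are obtained from the embeddings of \<open>K\<close> into the complex
  numbers and one fixed valuation ring of the complex numbers in which \<open>3\<close> is not a unit.\<close>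

section \<open>Valuation rings\<close>

hide_const (open) Module.smult

text \<open>The ring \<open>V\<close> alone says nothing about residue degrees: its value group is
  not discrete and its residue field is infinite. Each branch therefore gets a small ring
  \<open>loc G\<close>, generated by expressions in \<zeta> and one root of F, with a uniformizer
  \<open>w\<close> that divides \<open>x ^ q - x\<close> for every \<open>x\<close> in the ring.
  That divisibility is the whole bound on the residue degree. Prime ideals of K are never formed.
  That two roots \<open>x\<close>, \<open>y\<close> of F give the same prime is expressed by: for
  every rational polynomial \<open>r\<close>, \<open>rpoly r x \<in> M\<close> implies
  \<open>rpoly r y \<in> M\<close>. The hard point is to deduce this from the congruence of the
  residues of the generator alone, because \<open>r\<close> need not have an integral value. In
  degree one the simple root 0 of F modulo 3 always takes one of the three residues, so three
  branches at nonzero \<zeta> suffice for a contradiction. In degree two residues are counted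
  instead of primes: nine minus the three of the prime field leaves six, while each of four primes
  is met twice, at two conjugate residues, which makes eight.\<close>

definition subring :: "'a :: field set \<Rightarrow> bool" where
  "subring R \<longleftrightarrow> 1 \<in> R \<and> (\<forall>x\<in>R. \<forall>y\<in>R. x - y \<in> R \<and> x * y \<in> R)"

lemma subringI:
  assumes "1 \<in> R" "\<And>x y. x \<in> R \<Longrightarrow> y \<in> R \<Longrightarrow> x - y \<in> R" "\<And>x y. x \<in> R \<Longrightarrow> y \<in> R \<Longrightarrow> x * y \<in> R"
  shows "subring R"
  using assms by (simp add: subring_def)

context
  fixes R :: "'a :: field set"
  assumes R: "subring R"
begin

lemma subring_1: "1 \<in> R"
  using R by (simp add: subring_def)

lemma subring_diff: "x \<in> R \<Longrightarrow> y \<in> R \<Longrightarrow> x - y \<in> R"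
  using R by (simp add: subring_def)

lemma subring_mult: "x \<in> R \<Longrightarrow> y \<in> R \<Longrightarrow> x * y \<in> R"
  using R by (simp add: subring_def)

lemma subring_0: "0 \<in> R"
  using subring_diff[OF subring_1 subring_1] by simp

lemma subring_uminus: "x \<in> R \<Longrightarrow> - x \<in> R"
  using subring_diff[OF subring_0, of x] by simp

lemma subring_add: "x \<in> R \<Longrightarrow> y \<in> R \<Longrightarrow> x + y \<in> R"
  using subring_diff[of x "- y"] subring_uminus[of y] by simp

lemma subring_power: "x \<in> R \<Longrightarrow> x ^ n \<in> R"
  by (induction n) (auto intro: subring_1 subring_mult)

lemma subring_sum: "(\<And>i. i \<in> A \<Longrightarrow> f i \<in> R) \<Longrightarrow> sum f A \<in> R"
  by (induction A rule: infinite_finite_induct) (auto intro: subring_0 subring_add)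

lemma subring_of_nat: "of_nat n \<in> R"
  by (induction n) (auto intro: subring_0 subring_1 subring_add)

lemma subring_of_int: "of_int n \<in> R"
  by (cases n) (auto intro!: subring_of_nat subring_uminus simp del: of_nat_Suc)

lemma subring_numeral: "numeral n \<in> R"
  using subring_of_nat[of "numeral n"] by simp

lemma subring_poly: "(\<And>i. coeff p i \<in> R) \<Longrightarrow> x \<in> R \<Longrightarrow> poly p x \<in> R"
  unfolding poly_altdef by (intro subring_sum subring_mult subring_power)

lemma subring_coeff_mult:
  "(\<And>i. coeff p i \<in> R) \<Longrightarrow> (\<And>i. coeff q i \<in> R) \<Longrightarrow> coeff (p * q) i \<in> R"
  unfolding coeff_mult by (intro subring_sum subring_mult)

lemmas subring_intros = subring_0 subring_1 subring_diff subring_mult subring_uminus subring_add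
  subring_power subring_sum subring_of_nat subring_of_int subring_numeral

text \<open>Either relation lets one lower the degree of the other, since the constant terms of both
  differ from \<open>1\<close> by units.\<close>

lemma no_two_sided_relation:
  fixes f g :: "'a poly" and c x :: 'a
  assumes c: "c \<in> R" "inverse c \<notin> R" "c \<noteq> 0"
    and unit: "\<And>y. y \<in> R \<Longrightarrow> inverse (1 - c * y) \<in> R"
    and x: "x \<noteq> 0"
  shows "(\<And>i. coeff f i / c \<in> R) \<Longrightarrow> (\<And>i. coeff g i / c \<in> R) \<Longrightarrow> poly f x = 1 \<Longrightarrow>
     poly g (inverse x) = 1 \<Longrightarrow> False"
  using x
proof (induction "degree f + degree g" arbitrary: f g x rule: less_induct)
  case less
  \<comment> \<open>Base case: a constant polynomial with value 1 is 1 itself, which would put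
    \<open>1 / c\<close> into \<open>R\<close>.\<close>
  have const: False if "degree h = 0" "\<And>i. coeff h i / c \<in> R" "poly h z = 1" for h :: "'a poly" and z
  proof -
    have "coeff h 0 = 1"
      using that by (metis degree_eq_zeroE poly_pCons poly_0 mult_zero_right add.right_neutral coeff_pCons_0)
    then show False
      using that(2)[of 0] c by (simp add: divide_inverse)
  qed
  \<comment> \<open>Stated for a free \<open>z\<close> because \<open>x\<close> and
    \<open>inverse x\<close> exchange roles according to which degree is larger.\<close>
  have red: False if deg: "degree h \<le> degree f'" and f': "\<And>i. coeff f' i / c \<in> R"
    and h: "\<And>i. coeff h i / c \<in> R" and pf: "poly f' z = 1" and ph: "poly h (inverse z) = 1"
    and z: "z \<noteq> 0" and sum: "degree f' + degree h = degree f + degree g"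
    and IH: "\<And>f''. degree f'' < degree f' \<Longrightarrow> (\<And>i. coeff f'' i / c \<in> R) \<Longrightarrow> poly f'' z = 1 \<Longrightarrow> False"
    for f' h z
  proof -
    define p q where "p = degree f'" and "q = degree h"
    have q: "q > 0"
      using const[OF _ h ph] q_def by auto
    have p: "p \<ge> q" using deg p_def q_def by simp
    define u where "u = 1 - coeff h 0"
    have u: "inverse u \<in> R" "u \<noteq> 0"
    proof -
      have "u = 1 - c * (coeff h 0 / c)" using c by (simp add: u_def)
      then show "inverse u \<in> R" using unit[OF h[of 0]] by simp
      show "u \<noteq> 0"
      proof
        assume "u = 0"
        then have "coeff h 0 = 1" by (simp add: u_def)
        then show False using h[of 0] c by (simp add: divide_inverse)
      qed
    qed
    \<comment> \<open>Multiplying \<open>poly h (inverse z) = 1\<close> by \<open>z ^ q\<close> and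
      dividing by the unit \<open>u\<close> rewrites \<open>z ^ q\<close> as
      \<open>poly G z\<close>, of smaller degree and with all coefficients still divisible by
      \<open>c\<close>. This eliminates the leading monomial of \<open>f'\<close>.\<close>
    define G where "G = (\<Sum>j=1..q. monom (inverse u * coeff h j) (q - j))"
    have G: "coeff G i / c \<in> R" for i
    proof -
      have "coeff G i / c = (\<Sum>j=1..q. if q - j = i then inverse u * (coeff h j / c) else 0)"
        unfolding G_def by (simp add: coeff_sum sum_divide_distrib) (intro sum.cong, auto)
      also have "\<dots> \<in> R"
        using subring_mult[OF u(1) h] by (intro subring_sum) (auto intro: subring_0 simp: mult.assoc)
      finally show ?thesis .
    qed
    have degG: "degree G < q"
      unfolding G_def using q
      by (intro degree_sum_less) (auto intro: le_less_trans[OF degree_monom_le])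
    have "1 = (\<Sum>j\<le>q. coeff h j * inverse z ^ j)"
      using ph by (simp add: poly_altdef q_def)
    also have "\<dots> = coeff h 0 + (\<Sum>j=1..q. coeff h j * inverse z ^ j)"
      by (simp add: atMost_atLeast0 sum.atLeast_Suc_atMost[of 0 q])
    finally have "u = (\<Sum>j=1..q. coeff h j * inverse z ^ j)"
      by (simp add: u_def algebra_simps)
    then have "u * z ^ q = (\<Sum>j=1..q. coeff h j * (inverse z ^ j * z ^ q))"
      by (simp add: sum_distrib_right mult.assoc)
    also have "\<dots> = (\<Sum>j=1..q. coeff h j * z ^ (q - j))"
    proof (intro sum.cong refl arg_cong2[where f = "(*)"])
      fix j assume "j \<in> {1..q}"
      then have "z ^ q = z ^ j * z ^ (q - j)" by (simp flip: power_add)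
      then show "inverse z ^ j * z ^ q = z ^ (q - j)"
        using z by (simp add: field_simps power_inverse)
    qed
    also have "\<dots> = u * poly G z"
      using u by (simp add: G_def poly_sum poly_monom sum_distrib_left field_simps)
    finally have Gz: "poly G z = z ^ q" using u by simp
    define f'' where "f'' = f' - monom (coeff f' p) p + monom (coeff f' p) (p - q) * G"
    have 1: "coeff f'' i / c \<in> R" for i
    proof -
      have "coeff f'' i / c = (if i = p then 0 else coeff f' i / c) +
          (if p - q \<le> i then (coeff f' p / c) * (c * (coeff G (i - (p - q)) / c)) else 0)"
        using c by (auto simp: f''_def coeff_monom_mult add_divide_distrib diff_divide_distrib)
      moreover have "(coeff f' p / c) * (c * (coeff G (i - (p - q)) / c)) \<in> R"
        using c(1) G f' by (intro subring_mult)
      ultimately show ?thesis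
        using f' by (auto intro: subring_0 subring_add)
    qed
    have 2: "poly f'' z = 1"
    proof -
      have "z ^ (p - q) * z ^ q = z ^ p" using p by (simp flip: power_add)
      then show ?thesis by (simp add: f''_def poly_monom Gz pf mult.assoc)
    qed
    have 3: "degree f'' < p"
    proof (rule degree_lessI)
      show "f'' \<noteq> 0 \<or> 0 < p" using p q by simp
      show "\<forall>k\<ge>p. coeff f'' k = 0"
      proof (intro allI impI)
        fix k assume k: "k \<ge> p"
        then have "coeff G (k - (p - q)) = 0"
          using degG p by (intro coeff_eq_0) linarith
        then show "coeff f'' k = 0"
          using k by (auto simp: f''_def coeff_monom_mult p_def coeff_eq_0)
      qed
    qed
    show False using IH[of f''] 1 2 3 by (simp add: p_def)
  qed
  show False
  proof (cases "degree g \<le> degree f")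
    case True
    show False
    proof (rule red[OF True less.prems refl])
      fix f'' :: "'a poly"
      assume "degree f'' < degree f" "\<And>i. coeff f'' i / c \<in> R" "poly f'' x = 1"
      with less.hyps[of f'' g x] less.prems show False by simp
    qed
  next
    case False
    show False
    proof (rule red[of f g "inverse x"])
      fix f'' :: "'a poly"
      assume "degree f'' < degree g" "\<And>i. coeff f'' i / c \<in> R" "poly f'' (inverse x) = 1"
      with less.hyps[of f f'' x] less.prems show False by simp
    qed (use less.prems False in auto)
  qed
qed

end

text \<open>Chevalley's extension theorem. Take \<open>V\<close> maximal among the subrings that
  contain \<open>R\<close> and omit \<open>1 / c\<close>. Adjoining an element outside
  \<open>V\<close> must produce \<open>1 / c\<close>; if \<open>x\<close> and
  \<open>inverse x\<close> were both outside, the two resulting relations would contradict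
  \<open>no_two_sided_relation\<close>.\<close>

theorem exists_valuation_ring:
  fixes R :: "'a :: field set"
  assumes R: "subring R" and c: "c \<in> R" "inverse c \<notin> R"
  obtains V where "subring V" "R \<subseteq> V" "inverse c \<notin> V" "\<And>x. x \<in> V \<or> inverse x \<in> V"
proof -
  define \<A> where "\<A> = {S. subring S \<and> R \<subseteq> S \<and> inverse c \<notin> S}"
  have c0: "c \<noteq> 0" using c by auto
  have "\<exists>V\<in>\<A>. \<forall>X\<in>\<A>. V \<subseteq> X \<longrightarrow> X = V"
  proof (rule subset_Zorn_nonempty)
    show "\<A> \<noteq> {}" using R c by (auto simp: \<A>_def)
    fix \<C> assume ne: "\<C> \<noteq> {}" and ch: "subset.chain \<A> \<C>"
    have sub: "\<And>S. S \<in> \<C> \<Longrightarrow> subring S \<and> R \<subseteq> S \<and> inverse c \<notin> S"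
      using ch by (auto simp: \<A>_def subset.chain_def)
    have common: "\<exists>S\<in>\<C>. x \<in> S \<and> y \<in> S" if xy: "x \<in> \<Union>\<C>" "y \<in> \<Union>\<C>" for x y
    proof -
      obtain S T where "S \<in> \<C>" "T \<in> \<C>" "x \<in> S" "y \<in> T" using xy by auto
      moreover from this have "S \<subseteq> T \<or> T \<subseteq> S"
        using ch by (auto simp: subset_chain_def)
      ultimately show ?thesis by auto
    qed
    have "subring (\<Union>\<C>)"
    proof (rule subringI)
      show "1 \<in> \<Union>\<C>" using ne sub subring_1 by blast
      show "x - y \<in> \<Union>\<C>" "x * y \<in> \<Union>\<C>" if "x \<in> \<Union>\<C>" "y \<in> \<Union>\<C>" for x y
        using common[OF that] sub subring_diff subring_mult by blast+
    qed
    then show "\<Union>\<C> \<in> \<A>" using ne sub by (auto simp: \<A>_def)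
  qed
  then obtain V where "V \<in> \<A>" and max: "\<And>X. X \<in> \<A> \<Longrightarrow> V \<subseteq> X \<Longrightarrow> X = V" by auto
  then have V: "subring V" "R \<subseteq> V" "inverse c \<notin> V" by (auto simp: \<A>_def)
  have cV: "c \<in> V" using V c by auto
  have relation: "\<exists>p. (\<forall>i. coeff p i \<in> V) \<and> poly p x = inverse c" if x: "x \<notin> V" for x
  proof -
    define S where "S = {poly p x | p. \<forall>i. coeff p i \<in> V}"
    have "V \<subseteq> S"
    proof
      fix y assume "y \<in> V"
      then have "\<forall>i. coeff [:y:] i \<in> V"
        by (auto simp: coeff_pCons subring_0[OF V(1)] split: nat.split)
      then show "y \<in> S" by (force simp: S_def intro: exI[of _ "[:y:]"])
    qed
    have "\<forall>i. coeff [:0, 1:] i \<in> V"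
      by (auto simp: coeff_pCons subring_0[OF V(1)] subring_1[OF V(1)] split: nat.split)
    then have xS: "x \<in> S" by (force simp: S_def intro: exI[of _ "[:0, 1:]"])
    have "subring S"
    proof (rule subringI)
      show "1 \<in> S" using \<open>V \<subseteq> S\<close> subring_1[OF V(1)] by auto
      fix y z assume "y \<in> S" "z \<in> S"
      then obtain p q where p: "\<And>i. coeff p i \<in> V" "y = poly p x"
        and q: "\<And>i. coeff q i \<in> V" "z = poly q x" by (auto simp: S_def)
      have "\<forall>i. coeff (p - q) i \<in> V" using p q subring_diff[OF V(1)] by simp
      then show "y - z \<in> S" using p q by (force simp: S_def intro: exI[of _ "p - q"])
      have "\<forall>i. coeff (p * q) i \<in> V" using p q subring_coeff_mult[OF V(1)] by simp
      then show "y * z \<in> S" using p q by (force simp: S_def intro: exI[of _ "p * q"])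
    qed
    have "inverse c \<in> S"
    proof (rule ccontr)
      assume "inverse c \<notin> S"
      then have "S \<in> \<A>" using \<open>V \<subseteq> S\<close> \<open>subring S\<close> V by (auto simp: \<A>_def)
      with max \<open>V \<subseteq> S\<close> xS x show False by auto
    qed
    then show ?thesis by (auto simp: S_def)
  qed
  \<comment> \<open>Otherwise \<open>1 / c\<close> is a polynomial in \<open>1 / u\<close> with
    \<open>u = 1 - c * y\<close>, so \<open>u ^ N / c\<close> lies in \<open>V\<close>. Since
    \<open>u\<close> is 1 modulo \<open>c\<close>, also \<open>(1 - u ^ N) / c\<close> lies in
    \<open>V\<close>, and the sum of the two is \<open>1 / c\<close>.\<close>
  have unit: "inverse (1 - c * y) \<in> V" if y: "y \<in> V" for y
  proof (rule ccontr)
    assume "inverse (1 - c * y) \<notin> V"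
    then obtain p where p: "\<And>i. coeff p i \<in> V" "poly p (inverse (1 - c * y)) = inverse c"
      using relation by blast
    define u where "u = 1 - c * y"
    have u0: "u \<noteq> 0"
      using p subring_0[OF V(1)] \<open>inverse (1 - c * y) \<notin> V\<close> by (auto simp: u_def)
    define N where "N = degree p"
    have "u ^ N * inverse c = (\<Sum>i\<le>N. coeff p i * (u ^ N * inverse u ^ i))"
      unfolding p(2)[symmetric] u_def[symmetric]
      by (simp add: poly_altdef N_def sum_distrib_left mult_ac)
    also have "\<dots> = (\<Sum>i\<le>N. coeff p i * u ^ (N - i))"
    proof (intro sum.cong refl arg_cong2[where f = "(*)"])
      fix i assume "i \<in> {..N}"
      then have "u ^ N = u ^ i * u ^ (N - i)" by (simp flip: power_add)
      then show "u ^ N * inverse u ^ i = u ^ (N - i)"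
        using u0 by (simp add: field_simps power_inverse)
    qed
    also have "\<dots> \<in> V"
      using p y cV unfolding u_def by (intro subring_intros[OF V(1)]) auto
    finally have 1: "u ^ N * inverse c \<in> V" .
    have 2: "(1 - u ^ n) * inverse c \<in> V" for n
    proof (induction n)
      case (Suc n)
      have "(1 - u ^ Suc n) * inverse c = (1 - u ^ n) * inverse c + u ^ n * y"
        using c0 by (simp add: u_def field_simps)
      with Suc show ?case using y cV
        by (auto simp: u_def intro!: subring_intros[OF V(1)])
    qed (auto intro: subring_0[OF V(1)])
    have "inverse c = u ^ N * inverse c + (1 - u ^ N) * inverse c" by (simp add: algebra_simps)
    with 1 2 V subring_add[OF V(1)] show False by metis
  qed
  have "x \<in> V \<or> inverse x \<in> V" for x
  proof (rule ccontr)
    assume *: "\<not> (x \<in> V \<or> inverse x \<in> V)"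
    then obtain p q where p: "\<And>i. coeff p i \<in> V" "poly p x = inverse c"
      and q: "\<And>i. coeff q i \<in> V" "poly q (inverse x) = inverse c" using relation by meson
    have "x \<noteq> 0" using * subring_0[OF V(1)] by auto
    from no_two_sided_relation[OF V(1) cV V(3) c0 unit this, of "smult c p" "smult c q"]
    show False using p q c0 by simp
  qed
  with V that show ?thesis by blast
qed

section \<open>A valuation ring of the complex numbers above 3\<close>

locale valuation_ring =
  fixes V :: "complex set"
  assumes subring: "subring V"
    and inverse_3: "inverse 3 \<notin> V"
    and total: "x \<in> V \<or> inverse x \<in> V"
begin

text \<open>The maximal ideal of \<open>V\<close>. Zero is listed separately because
  \<open>inverse 0 = 0\<close> lies in \<open>V\<close> and would make 0 look like a unit.\<close>

definition M :: "complex set" where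
  "M = {x \<in> V. x = 0 \<or> inverse x \<notin> V}"

lemmas V_intros = subring_intros[OF subring]

lemma M_V: "x \<in> M \<Longrightarrow> x \<in> V"
  by (simp add: M_def)

lemma M_0: "0 \<in> M"
  by (simp add: M_def V_intros)

lemma unit_nonzero: "x \<notin> M \<Longrightarrow> x \<noteq> 0"
  using M_0 by auto

lemma unit_inverse: "x \<notin> M \<Longrightarrow> inverse x \<in> V"
  using total[of x] by (auto simp: M_def)

lemma M_1: "1 \<notin> M"
  by (simp add: M_def V_intros)

lemma M_3: "3 \<in> M"
  using inverse_3 by (simp add: M_def V_intros del: inverse_eq_divide)

lemma inverse_M: "x \<notin> V \<Longrightarrow> inverse x \<in> M"
  using total[of x] by (auto simp: M_def)

lemma M_mult: "x \<in> M \<Longrightarrow> y \<in> V \<Longrightarrow> x * y \<in> M"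
proof -
  assume x: "x \<in> M" and y: "y \<in> V"
  have "inverse x \<in> V" if "inverse (x * y) \<in> V" "x * y \<noteq> 0"
  proof -
    have "inverse x = inverse (x * y) * y" using that by (simp add: field_simps)
    then show ?thesis using that y by (metis V_intros(4))
  qed
  with x y show ?thesis by (auto simp: M_def V_intros)
qed

lemma M_mult': "x \<in> V \<Longrightarrow> y \<in> M \<Longrightarrow> x * y \<in> M"
  using M_mult[of y x] by (simp add: mult.commute)

lemma M_add: "x \<in> M \<Longrightarrow> y \<in> M \<Longrightarrow> x + y \<in> M"
proof -
  have *: "x + y \<in> M" if "x \<in> M" "y / x \<in> V" "x \<noteq> 0" for x y
  proof -
    have "x + y = x * (1 + y / x)" using that by (simp add: field_simps)
    then show ?thesis using that M_mult[of x "1 + y / x"] by (metis V_intros(2,6))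
  qed
  assume "x \<in> M" "y \<in> M"
  moreover have "y / x \<in> V \<or> x / y \<in> V" using total[of "y / x"] by simp
  ultimately show ?thesis
    using *[of x y] *[of y x] by (cases "x = 0 \<or> y = 0") (auto simp: add.commute)
qed

lemma M_uminus: "x \<in> M \<Longrightarrow> - x \<in> M"
  using M_mult[of x "-1"] by (simp add: V_intros)

lemma M_uminus_iff: "- x \<in> M \<longleftrightarrow> x \<in> M"
  using M_uminus[of x] M_uminus[of "- x"] by auto

lemma M_diff: "x \<in> M \<Longrightarrow> y \<in> M \<Longrightarrow> x - y \<in> M"
  using M_add[of x "- y"] M_uminus[of y] by simp

lemma M_sum: "(\<And>i. i \<in> A \<Longrightarrow> f i \<in> M) \<Longrightarrow> sum f A \<in> M"
  by (induction A rule: infinite_finite_induct) (auto intro: M_0 M_add)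

lemma M_mult_cancel: "x \<notin> M \<Longrightarrow> x * y \<in> M \<Longrightarrow> y \<in> M"
  using unit_inverse[of x] unit_nonzero[of x] M_mult'[of "inverse x" "x * y"]
  by (simp add: mult.assoc[symmetric])

lemma M_prime: "x * y \<in> M \<Longrightarrow> x \<in> M \<or> y \<in> M"
  using M_mult_cancel by blast

lemma unit_mult: "x \<notin> M \<Longrightarrow> y \<notin> M \<Longrightarrow> x * y \<notin> M"
  using M_mult_cancel by blast

lemma M_power: "x \<in> V \<Longrightarrow> n > 0 \<Longrightarrow> x ^ n \<in> M \<longleftrightarrow> x \<in> M"
proof -
  assume x: "x \<in> V" "n > 0"
  have "x \<in> M" if "x ^ n \<in> M"
    using that x(1)
  proof (induction n)
    case (Suc n)
    then show ?case using M_prime[of x "x ^ n"] by (auto intro: V_intros)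
  qed (use M_1 in auto)
  moreover have "x ^ n \<in> M" if "x \<in> M"
    using that x M_mult[of x "x ^ (n - 1)"] by (cases n) (auto intro: V_intros)
  ultimately show ?thesis by blast
qed

text \<open>Membership in \<open>V\<close> comes for free: if \<open>x\<close> were outside,
  \<open>inverse x\<close> would be in \<open>M\<close>, and 1 would be a product of two elements of
  \<open>M\<close>.\<close>

lemma M_root: "x ^ n \<in> M \<Longrightarrow> n > 0 \<Longrightarrow> x \<in> M"
proof -
  assume x: "x ^ n \<in> M" "n > 0"
  have "x \<in> V"
  proof (rule ccontr)
    assume "x \<notin> V"
    then have "inverse x ^ n \<in> M" "x \<noteq> 0"
      using inverse_M[of x] M_power[of "inverse x" n] x M_V V_intros(1) by auto
    with x M_mult[of "x ^ n" "inverse x ^ n"] M_V M_1 show False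
      by (auto simp flip: power_mult_distrib)
  qed
  with x M_power show ?thesis by auto
qed

lemma of_int_M: "of_int d \<in> M \<longleftrightarrow> 3 dvd d"
proof
  assume d: "of_int d \<in> M"
  show "3 dvd d"
  proof (rule ccontr)
    assume "\<not> 3 dvd d"
    then have "coprime 3 d" by (intro prime_imp_coprime) auto
    then obtain u v where "u * 3 + v * d = 1"
      using bezout_int[of 3 d] by (auto simp: coprime_iff_gcd_eq_1)
    then have "of_int u * 3 + of_int v * of_int d = (1 :: complex)"
      by (metis of_int_1 of_int_add of_int_mult of_int_numeral)
    moreover have "of_int u * 3 + of_int v * of_int d \<in> M"
      using d M_3 by (intro M_add M_mult') (auto intro: V_intros)
    ultimately show False using M_1 by simp
  qed
next
  assume "3 dvd d"
  then obtain e where "d = 3 * e" by auto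
  then show "of_int d \<in> M" using M_mult[OF M_3, of "of_int e"] by (simp add: V_intros)
qed

text \<open>Valuation rings are integrally closed: for \<open>x\<close> outside \<open>V\<close>,
  dividing a monic equation by \<open>x ^ n\<close> writes 1 as a combination of positive powers of
  \<open>inverse x\<close>, all in \<open>M\<close>.\<close>

lemma algebraic_int_V: "algebraic_int x \<Longrightarrow> x \<in> V"
proof (rule ccontr)
  assume "algebraic_int x" and x: "x \<notin> V"
  then obtain p where p: "poly (map_poly of_int p) x = 0" "lead_coeff p = 1"
    by (auto simp: algebraic_int_altdef_ipoly)
  have y: "inverse x \<in> M" "x \<noteq> 0" using x inverse_M V_intros(1) by auto
  define n where "n = degree p"
  have "0 = (\<Sum>i\<le>n. of_int (coeff p i) * x ^ i) * inverse x ^ n"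
    using p by (simp add: poly_altdef n_def degree_map_poly coeff_map_poly)
  also have "\<dots> = (\<Sum>i\<le>n. of_int (coeff p i) * inverse x ^ (n - i))"
    unfolding sum_distrib_right
  proof (intro sum.cong refl)
    fix i assume "i \<in> {..n}"
    then have "inverse x ^ n = inverse x ^ (n - i) * inverse x ^ i" by (simp flip: power_add)
    then show "of_int (coeff p i) * x ^ i * inverse x ^ n = of_int (coeff p i) * inverse x ^ (n - i)"
      using y by (simp add: field_simps)
  qed
  also have "\<dots> = (\<Sum>i<n. of_int (coeff p i) * inverse x ^ (n - i)) + 1"
    using p by (simp add: n_def lessThan_Suc_atMost[symmetric])
  finally have "1 = - (\<Sum>i<n. of_int (coeff p i) * inverse x ^ (n - i))"
    by (simp add: algebra_simps eq_neg_iff_add_eq_0)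
  also have "\<dots> \<in> M"
    using y by (intro M_uminus M_sum M_mult') (auto intro: V_intros simp: M_power M_V)
  finally show False using M_1 by simp
qed

lemma root_of_unity_V: "x ^ n = 1 \<Longrightarrow> n > 0 \<Longrightarrow> x \<in> V"
proof -
  assume x: "x ^ n = 1" "n > 0"
  have "lead_coeff (monom 1 n - 1 :: int poly) = 1"
  proof -
    have "degree (monom 1 n - 1 :: int poly) = n"
      using x by (simp add: degree_monom_eq degree_add_eq_left flip: add_uminus_conv_diff)
    then show ?thesis using x by simp
  qed
  then show ?thesis
    using x by (intro algebraic_int_V) (auto simp: algebraic_int_altdef_ipoly poly_monom
        of_int_poly_hom.hom_minus intro!: exI[of _ "monom 1 n - 1"])
qed

section \<open>Polynomials over \<open>V\<close> and their roots modulo \<open>M\<close>\<close>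

lemma poly_cong_M:
  assumes "\<And>i. coeff p i \<in> V" "x \<in> V" "y \<in> V" "x - y \<in> M"
  shows "poly p x - poly p y \<in> M"
  using assms(1)
proof (induction p)
  case (pCons a p)
  have p: "coeff p i \<in> V" for i using pCons.prems[of "Suc i"] by simp
  have "poly (pCons a p) x - poly (pCons a p) y = (x - y) * poly p x + y * (poly p x - poly p y)"
    by (simp add: algebra_simps)
  also have "\<dots> \<in> M"
    using assms pCons.IH[OF p] by (intro M_add M_mult M_mult') (auto intro: subring_poly[OF subring] p)
  finally show ?case .
qed (auto intro: M_0)

lemma int_poly_cong_M:
  "x \<in> V \<Longrightarrow> y \<in> V \<Longrightarrow> x - y \<in> M \<Longrightarrow> poly (map_poly of_int p) x - poly (map_poly of_int p) y \<in> M"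
  by (rule poly_cong_M) (auto simp: coeff_map_poly intro: V_intros)

lemma int_poly_V: "x \<in> V \<Longrightarrow> poly (map_poly of_int p) x \<in> V"
  by (rule subring_poly[OF subring]) (auto simp: coeff_map_poly intro: V_intros)

lemma coeff_synthetic_div_V:
  "(\<And>i. coeff p i \<in> V) \<Longrightarrow> x \<in> V \<Longrightarrow> coeff (synthetic_div p x) i \<in> V"
proof (induction p arbitrary: i)
  case (pCons a p)
  have p: "coeff p i \<in> V" for i using pCons.prems(1)[of "Suc i"] by simp
  show ?case
    using pCons.IH[OF p pCons.prems(2)] subring_poly[OF subring p pCons.prems(2)]
    by (simp add: coeff_pCons split: nat.split)
qed (auto intro: V_intros)

text \<open>Over the residue field this is the bound of the number of roots by the degree. It is
  proved on representatives: after splitting off \<open>X - x\<close> by synthetic division, the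
  other points remain roots because their differences with \<open>x\<close> are units.\<close>

lemma roots_mod_M:
  assumes "finite S" "S \<subseteq> V" "\<And>x y. x \<in> S \<Longrightarrow> y \<in> S \<Longrightarrow> x - y \<in> M \<Longrightarrow> x = y"
    and "\<And>x. x \<in> S \<Longrightarrow> poly p x \<in> M" "\<And>i. coeff p i \<in> V" "degree p < card S"
  shows "coeff p i \<in> M"
  using assms
proof (induction "card S" arbitrary: S p i)
  case (Suc n)
  then obtain x where x: "x \<in> S" by fastforce
  define q where "q = synthetic_div p x"
  have xV: "x \<in> V" using x Suc by auto
  have q: "coeff q i \<in> V" for i
    unfolding q_def using Suc xV by (intro coeff_synthetic_div_V) auto
  have p: "p + smult x q = pCons (poly p x) q"
    unfolding q_def by (rule synthetic_div_correct)
  have qM: "coeff q i \<in> M" for i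
  proof (cases "degree p = 0")
    case True
    then show ?thesis using M_0 by (simp add: q_def synthetic_div_eq_0_iff[THEN iffD2])
  next
    case False
    show ?thesis
    proof (rule Suc.hyps(1)[of "S - {x}"])
      show "n = card (S - {x})" using Suc x by simp
      show "degree q < card (S - {x})"
        using Suc x False by (simp add: q_def degree_synthetic_div)
      fix y assume y: "y \<in> S - {x}"
      have "poly p y + x * poly q y = poly p x + y * poly q y"
        using arg_cong[OF p, of "\<lambda>f. poly f y"] by simp
      then have "(y - x) * poly q y = poly p y - poly p x" by (simp add: algebra_simps)
      also have "\<dots> \<in> M" using Suc.prems x y by (intro M_diff) auto
      finally have "(y - x) * poly q y \<in> M" .
      moreover have "y - x \<notin> M" using Suc.prems(3)[of y x] x y by auto
      ultimately show "poly q y \<in> M" using M_mult_cancel by blast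
    qed (use Suc q in auto)
  qed
  have "coeff p i = coeff (pCons (poly p x) q) i - x * coeff q i"
    using arg_cong[OF p, of "\<lambda>f. coeff f i"] by (simp add: algebra_simps)
  also have "\<dots> \<in> M"
    using qM Suc.prems(4) x xV by (intro M_diff M_mult') (auto simp: coeff_pCons split: nat.split)
  finally show ?case .
qed auto

text \<open>The leading coefficient of \<open>X ^ q - X\<close> is 1, outside \<open>M\<close>, so
  the polynomial cannot vanish modulo \<open>M\<close> at more than \<open>q\<close> incongruent
  points.\<close>

lemma card_roots_of_frobenius:
  assumes "finite S" "S \<subseteq> V" "\<And>x y. x \<in> S \<Longrightarrow> y \<in> S \<Longrightarrow> x - y \<in> M \<Longrightarrow> x = y"
    and "\<And>x. x \<in> S \<Longrightarrow> x ^ q - x \<in> M" "q > 1"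
  shows "card S \<le> q"
proof (rule ccontr)
  assume card: "\<not> card S \<le> q"
  define p :: "complex poly" where "p = monom 1 q - [:0, 1:]"
  have "degree p \<le> q"
    unfolding p_def using assms(5) by (intro degree_diff_le) (auto simp: degree_monom_eq)
  moreover have "coeff p i \<in> V" for i
    by (auto simp: p_def coeff_pCons intro!: V_intros split: nat.split)
  ultimately have "coeff p q \<in> M"
    using assms card by (intro roots_mod_M[of S p]) (auto simp: p_def poly_monom)
  moreover have "coeff p q = 1" using assms(5) by (auto simp: p_def coeff_pCons split: nat.split)
  ultimately show False using M_1 by simp
qed

text \<open>A factor \<open>X - x\<close> with \<open>x\<close> outside \<open>V\<close> becomes a nonzero constant modulo \<open>M\<close> after scaling,
  so without unit roots a split polynomial reduces to a monomial.\<close>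

lemma split_without_unit_roots:
  assumes "\<And>x. x \<in># A \<Longrightarrow> x \<in> V \<Longrightarrow> x \<in> M"
  obtains u P j where "(\<Prod>x\<in>#A. [:- x, 1:]) = smult u P" "\<And>i. coeff P i \<in> V"
    "coeff P j \<notin> M" "\<And>i. i \<noteq> j \<Longrightarrow> coeff P i \<in> M" "j > 0 \<Longrightarrow> \<exists>x\<in>#A. x \<in> V"
proof -
  have "\<exists>u P j. (\<Prod>x\<in>#A. [:- x, 1:]) = smult u P \<and> (\<forall>i. coeff P i \<in> V) \<and>
    coeff P j \<notin> M \<and> (\<forall>i. i \<noteq> j \<longrightarrow> coeff P i \<in> M) \<and> (j > 0 \<longrightarrow> (\<exists>x\<in>#A. x \<in> V))"
    using assms
  proof (induction A)
    case empty
    show ?case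
      by (rule exI[of _ 1], rule exI[of _ 1], rule exI[of _ 0])
        (auto simp: M_0 M_1 intro: V_intros)
  next
    case (add x A)
    then obtain u P j where P: "(\<Prod>x\<in>#A. [:- x, 1:]) = smult u P" "\<And>i. coeff P i \<in> V"
      "coeff P j \<notin> M" "\<And>i. i \<noteq> j \<Longrightarrow> coeff P i \<in> M" "j > 0 \<Longrightarrow> \<exists>x\<in>#A. x \<in> V"
      by (metis add_mset_add_single union_iff)
    show ?case
    proof (cases "x \<in> V")
      case True
      then have x: "x \<in> M" using add.prems by auto
      \<comment> \<open>A root in \<open>M\<close> contributes the factor X modulo \<open>M\<close>
        and moves the surviving monomial up by one.\<close>
      define P' where "P' = [:- x, 1:] * P"
      have c: "coeff P' i = (case i of 0 \<Rightarrow> 0 | Suc k \<Rightarrow> coeff P k) - x * coeff P i" for i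
        by (simp add: P'_def coeff_pCons split: nat.split)
      have "coeff P' (Suc j) \<notin> M"
      proof
        assume "coeff P' (Suc j) \<in> M"
        then have "coeff P' (Suc j) + x * coeff P (Suc j) \<in> M"
          using x P by (intro M_add M_mult) auto
        then show False using P by (simp add: c)
      qed
      moreover have "coeff P' i \<in> M" if "i \<noteq> Suc j" for i
        unfolding c using x P that by (intro M_diff M_mult) (auto simp: M_0 split: nat.split)
      moreover have "coeff P' i \<in> V" for i
        unfolding c using True P by (intro V_intros) (auto intro: V_intros split: nat.split)
      ultimately show ?thesis
        using P True by (intro exI[of _ u] exI[of _ P'] exI[of _ "Suc j"]) (auto simp: P'_def)
    next
      case False
      define y where "y = inverse x"
      have y: "y \<in> M" "x \<noteq> 0" using False inverse_M[of x] V_intros(1) by (auto simp: y_def)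
      \<comment> \<open>Here \<open>X - x\<close> is \<open>x\<close> times \<open>y X - 1\<close>,
        and the latter is -1 modulo \<open>M\<close>: the index \<open>j\<close> stays.\<close>
      define P' where "P' = [:-1, y:] * P"
      have c: "coeff P' i = y * (case i of 0 \<Rightarrow> 0 | Suc k \<Rightarrow> coeff P k) - coeff P i" for i
        by (simp add: P'_def coeff_pCons split: nat.split)
      have m: "y * (case i of 0 \<Rightarrow> 0 | Suc k \<Rightarrow> coeff P k) \<in> M" for i
        using y P by (intro M_mult) (auto intro: V_intros split: nat.split)
      have "coeff P' j \<notin> M"
      proof
        assume "coeff P' j \<in> M"
        then have "y * (case j of 0 \<Rightarrow> 0 | Suc k \<Rightarrow> coeff P k) - coeff P' j \<in> M"
          using m by (intro M_diff) auto
        then show False using P by (simp add: c)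
      qed
      moreover have "coeff P' i \<in> M" if "i \<noteq> j" for i
        unfolding c using m P that by (intro M_diff) auto
      moreover have "coeff P' i \<in> V" for i
        unfolding c using m P M_V by (intro V_intros(3)) auto
      moreover have "[:- x, 1:] * smult u P = smult (u * x) P'"
      proof -
        have "smult (u * x) P' = smult u ((smult x [:-1, y:]) * P)"
          by (simp only: P'_def mult_smult_left smult_smult)
        also have "smult x [:-1, y:] = [:- x, 1:]" using y(2) by (simp add: y_def)
        finally show ?thesis by (simp only: mult_smult_right)
      qed
      ultimately show ?thesis
        using P by (intro exI[of _ "u * x"] exI[of _ P'] exI[of _ j]) auto
    qed
  qed
  then show ?thesis using that by blast
qed

text \<open>Takes the place of Hensel's lemma. All roots exist in the complex numbers, so it only
  remains to find a good one. A unit root satisfies every demand; without unit roots the reduction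
  is a monomial, \<open>j\<close> is the only index with a unit coefficient, and
  \<open>j > 0\<close> forces a root into \<open>M\<close>.\<close>

lemma poly_root_in_valuation_ring:
  assumes p: "\<And>i. coeff p i \<in> V" and j: "coeff p j \<notin> M" "j > 0"
  obtains y where "poly p y = 0" "y \<in> V" "\<forall>i. i \<noteq> j \<longrightarrow> coeff p i \<notin> M \<longrightarrow> y \<notin> M"
proof -
  have p0: "p \<noteq> 0" using j M_0 by auto
  obtain A where A: "p = smult (lead_coeff p) (\<Prod>x\<in>#A. [:- x, 1:])"
    using alg_closed_imp_factorization[OF p0] by auto
  have root: "poly p x = 0" if "x \<in># A" for x
  proof -
    from that obtain B where "A = add_mset x B" by (metis multi_member_split)
    then show ?thesis by (subst A) simp
  qed
  show ?thesis
  proof (cases "\<exists>x\<in>#A. x \<in> V \<and> x \<notin> M")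
    case True
    then show ?thesis using root that by blast
  next
    case False
    then obtain u P l where P: "(\<Prod>x\<in>#A. [:- x, 1:]) = smult u P" "\<And>i. coeff P i \<in> V"
      "coeff P l \<notin> M" "\<And>i. i \<noteq> l \<Longrightarrow> coeff P i \<in> M" "l > 0 \<Longrightarrow> \<exists>x\<in>#A. x \<in> V"
      using split_without_unit_roots[of A] by (metis (no_types, lifting))
    define c where "c = lead_coeff p * u"
    have pc: "coeff p i = c * coeff P i" for i
      by (subst A) (simp add: P c_def)
    have "c = coeff p l * inverse (coeff P l)"
      using unit_nonzero[OF P(3)] by (simp add: pc)
    then have "c \<in> V" using p unit_inverse[OF P(3)] by (auto intro: V_intros)
    then have *: "coeff p i \<in> M" if "i \<noteq> l" for i
      using P(4)[OF that] by (simp add: pc M_mult')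
    then have "j = l" using j by auto
    with P(5) j obtain x where "x \<in># A" "x \<in> V" by auto
    with root that * \<open>j = l\<close> show ?thesis by blast
  qed
qed

end

section \<open>Residue fields of localized rings\<close>

context valuation_ring
begin

text \<open>The ring generated by \<open>G\<close>, localized at its intersection with the maximal ideal.\<close>

inductive_set loc :: "complex set \<Rightarrow> complex set" for G where
  gen: "x \<in> G \<Longrightarrow> x \<in> loc G"
| one: "1 \<in> loc G"
| diff: "x \<in> loc G \<Longrightarrow> y \<in> loc G \<Longrightarrow> x - y \<in> loc G"
| mult: "x \<in> loc G \<Longrightarrow> y \<in> loc G \<Longrightarrow> x * y \<in> loc G"
| inv: "x \<in> loc G \<Longrightarrow> x \<notin> M \<Longrightarrow> inverse x \<in> loc G"

lemma subring_loc: "subring (loc G)"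
  by (intro subringI loc.one loc.diff loc.mult)

lemmas loc_intros = subring_intros[OF subring_loc]

lemma loc_V: "x \<in> loc G \<Longrightarrow> G \<subseteq> V \<Longrightarrow> x \<in> V"
  by (induction rule: loc.induct) (auto intro: V_intros unit_inverse)

lemma loc_mono: "x \<in> loc G \<Longrightarrow> G \<subseteq> loc G' \<Longrightarrow> x \<in> loc G'"
  by (induction rule: loc.induct) (auto intro: loc.intros)

end

text \<open>A localized ring \<open>loc G\<close> with maximal ideal generated by \<open>w\<close> and with residue field
  contained in that of \<open>q\<close> elements.\<close>

locale uniformized = valuation_ring +
  fixes G :: "complex set" and w :: complex and q :: nat
  assumes G_V: "G \<subseteq> V"
    and w_loc: "w \<in> loc G" and w_M: "w \<in> M" and w0: "w \<noteq> 0"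
    and three: "3 / w \<in> loc G"
    and q: "q \<in> {3, 9}"
    and frob_gen: "x \<in> G \<Longrightarrow> (x ^ q - x) / w \<in> loc G"
begin

text \<open>The mixed terms of a cube carry a factor 3, which \<open>w\<close> divides. Allowing
  congruent replacements \<open>a\<close>, \<open>b\<close> lets the rule be iterated, as ninth
  powers require.\<close>

lemma cube_diff_cong:
  fixes x y :: complex
  assumes "x \<in> loc G" "y \<in> loc G" "a \<in> loc G" "b \<in> loc G" "(x - a) / w \<in> loc G" "(y - b) / w \<in> loc G"
  shows "((x - y) ^ 3 - (a ^ 3 - b ^ 3)) / w \<in> loc G"
proof -
  have "((x - y) ^ 3 - (a ^ 3 - b ^ 3)) / w =
    (x - a) / w * (x\<^sup>2 + x * a + a\<^sup>2) - (y - b) / w * (y\<^sup>2 + y * b + b\<^sup>2) - 3 / w * (x * y * (x - y))"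
  proof -
    have "(x - y) ^ 3 - (a ^ 3 - b ^ 3) =
      (x - a) * (x\<^sup>2 + x * a + a\<^sup>2) - (y - b) * (y\<^sup>2 + y * b + b\<^sup>2) - 3 * (x * y * (x - y))"
      by (simp add: power2_eq_square power3_eq_cube algebra_simps)
    moreover have "(r * A - s * B - 3 * C) / w = r / w * A - s / w * B - 3 / w * C"
      for r s A B C :: complex
      by (simp add: diff_divide_distrib)
    ultimately show ?thesis by metis
  qed
  also have "\<dots> \<in> loc G"
    using assms three by (intro loc_intros)
  finally show ?thesis .
qed

lemma frob_diff:
  assumes "x \<in> loc G" "y \<in> loc G"
  shows "((x - y) ^ q - (x ^ q - y ^ q)) / w \<in> loc G"
proof -
  have 3: "((x - y) ^ 3 - (x ^ 3 - y ^ 3)) / w \<in> loc G" if "x \<in> loc G" "y \<in> loc G" for x y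
    using cube_diff_cong[of x y x y] that by (simp add: loc_intros)
  have "((x - y) ^ 9 - (x ^ 9 - y ^ 9)) / w \<in> loc G"
  proof -
    have "((x - y) ^ 3 - 0) ^ 3 - ((x ^ 3 - y ^ 3) ^ 3 - 0 ^ 3) = (x - y) ^ 9 - (x ^ 3 - y ^ 3) ^ 3"
      by (simp flip: power_mult)
    then have "((x - y) ^ 9 - (x ^ 3 - y ^ 3) ^ 3) / w \<in> loc G"
      using cube_diff_cong[of "(x - y) ^ 3" 0 "x ^ 3 - y ^ 3" 0] 3[of x y] assms
      by (simp add: loc_intros)
    moreover have "((x ^ 3 - y ^ 3) ^ 3 - (x ^ 9 - y ^ 9)) / w \<in> loc G"
      using 3[of "x ^ 3" "y ^ 3"] assms by (simp add: loc_intros flip: power_mult)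
    ultimately have "((x - y) ^ 9 - (x ^ 3 - y ^ 3) ^ 3) / w +
        ((x ^ 3 - y ^ 3) ^ 3 - (x ^ 9 - y ^ 9)) / w \<in> loc G"
      by (intro loc_intros)
    moreover have "((x - y) ^ 9 - (x ^ 3 - y ^ 3) ^ 3) / w + ((x ^ 3 - y ^ 3) ^ 3 - (x ^ 9 - y ^ 9)) / w =
        ((x - y) ^ 9 - (x ^ 9 - y ^ 9)) / w" by (simp flip: add_divide_distrib)
    ultimately show ?thesis by simp
  qed
  with 3[of x y] assms q show ?thesis by auto
qed

text \<open>The \<open>q\<close>-th power is multiplicative, and additive modulo \<open>w\<close>,
  so the congruence passes from the generators to differences, products and inverses of units. Every
  residue of \<open>loc G\<close> is thus a root of \<open>X ^ q - X\<close>.\<close>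

lemma frob_loc: "x \<in> loc G \<Longrightarrow> (x ^ q - x) / w \<in> loc G"
proof (induction rule: loc.induct)
  case (diff x y)
  have "((x - y) ^ q - (x - y)) / w =
    ((x - y) ^ q - (x ^ q - y ^ q)) / w + (x ^ q - x) / w - (y ^ q - y) / w"
    by (simp add: diff_divide_distrib add_divide_distrib)
  then show ?case using diff frob_diff[of x y] by (auto intro: loc_intros)
next
  case (mult x y)
  have "((x * y) ^ q - x * y) / w = (x ^ q - x) / w * y ^ q + x * ((y ^ q - y) / w)"
    by (simp add: diff_divide_distrib algebra_simps power_mult_distrib)
  also have "\<dots> \<in> loc G" using mult by (intro loc_intros)
  finally show ?case .
next
  case (inv x)
  have "x \<noteq> 0" using inv unit_nonzero by auto
  then have "(inverse x ^ q - inverse x) / w = - ((x ^ q - x) / w) * (inverse x ^ q * inverse x)"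
    using w0 by (simp add: field_simps power_inverse)
  also have "\<dots> \<in> loc G" using inv by (intro loc_intros loc.inv)
  finally show ?case .
qed (use frob_gen q loc_intros(1) in auto)

text \<open>Principality follows from the Frobenius congruence: \<open>w\<close> divides
  \<open>x ^ q - x\<close>, which is \<open>x\<close> times \<open>x ^ (q - 1) - 1\<close>, and for
  \<open>x\<close> in \<open>M\<close> the second factor is a unit of \<open>loc G\<close>.\<close>

lemma div_w: "x \<in> loc G \<Longrightarrow> x \<in> M \<Longrightarrow> x / w \<in> loc G"
proof -
  assume x: "x \<in> loc G" "x \<in> M"
  define u where "u = x ^ (q - 1) - 1"
  have "x ^ (q - 1) \<in> M" using x q M_V[OF x(2)] by (subst M_power) auto
  then have u: "u \<notin> M" using M_diff[of "x ^ (q - 1)" u] M_1 by (auto simp: u_def)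
  have "inverse u \<in> loc G" using x u by (intro loc.inv) (auto simp: u_def intro!: loc_intros)
  moreover have "x ^ q - x = x * u" using q by (auto simp: u_def algebra_simps power_numeral_reduce)
  then have "x / w = (x ^ q - x) / w * inverse u" using unit_nonzero[OF u] by simp
  ultimately show ?thesis using loc_intros(4)[OF frob_loc[OF x(1)]] by metis
qed

text \<open>Factors \<open>w\<close> are cancelled one at a time: the product lies in
  \<open>M\<close> as long as one is left, so \<open>div_w\<close> applies.\<close>

lemma div_w_power: "z \<in> V \<Longrightarrow> w ^ n * z \<in> loc G \<Longrightarrow> z \<in> loc G"
proof (induction n)
  case (Suc n)
  have "w ^ Suc n * z = w * (w ^ n * z)" by simp
  moreover have "w ^ Suc n * z \<in> M"
    using Suc w_M M_V[OF w_M] by (intro M_mult) (auto simp: M_power simp del: power_Suc)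
  ultimately show ?case using Suc div_w[of "w ^ Suc n * z"] w0 by simp
qed auto

text \<open>Clearing denominators costs a power of \<open>3\<close>, hence of \<open>w\<close>, and a unit.\<close>

lemma residue_degree:
  assumes \<theta>: "\<theta> \<in> loc G" and e: "w ^ e / 3 \<in> loc G"
    and z: "poly (map_poly of_rat r) \<theta> \<in> V"
  shows "poly (map_poly of_rat r) \<theta> ^ q - poly (map_poly of_rat r) \<theta> \<in> M"
proof -
  define z where "z = poly (map_poly of_rat r) \<theta>"
  have clear: "\<exists>N::int. N \<noteq> 0 \<and> of_int N * z \<in> loc G"
    unfolding z_def
  proof (induction r)
    case 0
    then show ?case by (auto intro: loc_intros exI[of _ 1])
  next
    case (pCons a r)
    then obtain N :: int where N: "N \<noteq> 0" "of_int N * poly (map_poly of_rat r) \<theta> \<in> loc G" by auto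
    obtain b d :: int where ab: "a = of_int b / of_int d" "d > 0"
      by (metis quotient_of_div quotient_of_denom_pos surj_pair)
    have "of_int (N * d) * poly (map_poly of_rat (pCons a r)) \<theta> =
      of_int (N * b) + of_int d * \<theta> * (of_int N * poly (map_poly of_rat r) \<theta>)"
      using ab(2) unfolding ab(1) of_rat_hom.map_poly_pCons_hom
      by (simp add: of_rat_divide field_simps)
    also have "\<dots> \<in> loc G" using loc_intros(4)[OF loc_intros(4)[OF loc_intros(10) \<theta>] N(2)]
      by (intro loc_intros(6) loc_intros(10))
    finally show ?case using N ab by (intro exI[of _ "N * d"]) auto
  qed
  then obtain N :: int where N: "N \<noteq> 0" "of_int N * z \<in> loc G" by auto
  define m where "m = multiplicity 3 N"
  obtain d where d: "N = 3 ^ m * d" "\<not> 3 dvd d"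
    unfolding m_def by (rule multiplicity_decompose'[of N 3]) (use N in auto)
  have "of_int d \<notin> M" using d of_int_M by auto
  then have "inverse (of_int d) * (of_int N * z) \<in> loc G"
    by (intro loc_intros(4) loc.inv N(2) loc_intros(10))
  moreover have "d \<noteq> 0" using d by auto
  ultimately have "3 ^ m * z \<in> loc G" by (simp add: d field_simps)
  then have "(w ^ e / 3) ^ m * (3 ^ m * z) \<in> loc G"
    using loc_intros(4)[OF loc_intros(7)[OF e]] by blast
  then have "w ^ (e * m) * z \<in> loc G" by (simp add: power_divide power_mult)
  then have "z \<in> loc G" using z by (auto simp: z_def intro: div_w_power)
  from frob_loc[OF this] have "w * ((z ^ q - z) / w) \<in> M"
    using w_M loc_V[OF _ G_V] by (intro M_mult) auto
  then show ?thesis using w0 by (simp add: z_def)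
qed

end

section \<open>Algebraic integers\<close>

text \<open>The relations make \<open>v\<close> an eigenvector of an integer matrix with eigenvalue
  \<open>x\<close>, and the characteristic polynomial of that matrix is monic with integer
  coefficients.\<close>

lemma algebraic_int_eigenvalue:
  fixes x :: complex and v :: "nat \<Rightarrow> complex" and A :: "nat \<Rightarrow> nat \<Rightarrow> int"
  assumes eq: "\<And>i. i < n \<Longrightarrow> x * v i = (\<Sum>j<n. of_int (A i j) * v j)"
    and v: "i < n" "v i \<noteq> 0"
  shows "algebraic_int x"
proof -
  define B where "B = mat n n (\<lambda>(i, j). A i j)"
  define C where "C = (map_mat of_int B :: complex mat)"
  have B: "B \<in> carrier_mat n n" and C: "C \<in> carrier_mat n n" by (auto simp: B_def C_def)
  have "eigenvector C (vec n v) x"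
    unfolding eigenvector_def
  proof (intro conjI)
    show "vec n v \<noteq> 0\<^sub>v (dim_row C)"
    proof
      assume "vec n v = 0\<^sub>v (dim_row C)"
      then have "vec n v $ i = 0\<^sub>v n $ i" using C by auto
      then show False using v by simp
    qed
    show "C *\<^sub>v vec n v = x \<cdot>\<^sub>v vec n v"
      by (rule eq_vecI) (auto simp: B_def C_def scalar_prod_def eq lessThan_atLeast0)
  qed (use C in auto)
  then have "poly (char_poly C) x = 0"
    using eigenvalue_root_char_poly[OF C] by (auto simp: eigenvalue_def)
  moreover have "char_poly C = map_poly of_int (char_poly B)"
    unfolding C_def by (rule of_int_hom.char_poly_hom[OF B])
  moreover have "lead_coeff (char_poly B) = 1"
    using degree_monic_char_poly[OF B] by simp
  ultimately show ?thesis
    by (auto simp: algebraic_int_altdef_ipoly)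
qed

lemma algebraic_int_multiplier:
  fixes x y :: complex
  assumes n: "n > 0"
    and ex: "\<And>i. i < n \<Longrightarrow> \<exists>R :: int poly. degree R < n \<and> y * x ^ i = poly (map_poly of_int R) x"
  shows "algebraic_int y"
proof -
  obtain R :: "nat \<Rightarrow> int poly"
    where R: "\<And>i. i < n \<Longrightarrow> degree (R i) < n \<and> y * x ^ i = poly (map_poly of_int (R i)) x"
    using ex by metis
  show ?thesis
  proof (rule algebraic_int_eigenvalue[where v = "\<lambda>i. x ^ i" and n = n and i = 0
        and A = "\<lambda>i j. coeff (R i) j"])
    fix i assume i: "i < n"
    have "poly (map_poly of_int (R i)) x = (\<Sum>j\<le>degree (R i). of_int (coeff (R i) j) * x ^ j)"
      by (simp add: poly_altdef degree_map_poly coeff_map_poly)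
    also have "\<dots> = (\<Sum>j<n. of_int (coeff (R i) j) * x ^ j)"
      using R[OF i] by (intro sum.mono_neutral_left) (auto simp: coeff_eq_0)
    finally show "y * x ^ i = (\<Sum>j<n. of_int (coeff (R i) j) * x ^ j)"
      using R[OF i] by simp
  qed (use n in auto)
qed

lemma degree_pos_of_root:
  fixes p :: "int poly" and x :: complex
  assumes "poly (map_poly of_int p) x = 0" "p \<noteq> 0"
  shows "degree p > 0"
proof (rule ccontr)
  assume "\<not> degree p > 0"
  then obtain c where "p = [:c:]" by (auto elim: degree_eq_zeroE)
  then show False using assms by (simp add: of_int_hom.map_poly_pCons_hom)
qed

text \<open>The tails of \<open>D\<close> at a root are integral even if \<open>D\<close> is not
  monic, because they preserve the lattice spanned by the powers of \<open>x\<close> below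
  \<open>degree D\<close>. For \<open>i < r\<close> the product with \<open>x ^ i\<close> has small
  degree by itself; from \<open>r\<close> on, \<open>D = 0\<close> replaces \<open>x ^ r\<close>
  times the tail by minus the lower part of \<open>D\<close>.\<close>

lemma algebraic_int_poly_shift:
  fixes D :: "int poly" and x :: complex
  assumes root: "poly (map_poly of_int D) x = 0" and D: "D \<noteq> 0"
  shows "algebraic_int (poly (map_poly of_int (poly_shift r D)) x)"
proof (rule algebraic_int_multiplier)
  let ?t = "poly (map_poly of_int (poly_shift r D)) x :: complex"
  show n: "degree D > 0" using degree_pos_of_root[OF root D] .
  fix i assume i: "i < degree D"
  show "\<exists>R :: int poly. degree R < degree D \<and> ?t * x ^ i = poly (map_poly of_int R) x"
  proof (cases "i < r")
    case True
    have "degree (monom 1 i * poly_shift r D) \<le> degree D - 1"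
    proof (rule degree_le, intro allI impI)
      fix k assume "degree D - 1 < k"
      then show "coeff (monom 1 i * poly_shift r D) k = 0"
        using True by (auto simp: coeff_monom_mult coeff_poly_shift coeff_eq_0)
    qed
    then show ?thesis
      using n by (intro exI[of _ "monom 1 i * poly_shift r D"])
        (auto simp: of_int_poly_hom.hom_mult map_poly_monom poly_monom)
  next
    case False
    have "D = poly_cutoff r D + monom 1 r * poly_shift r D"
      by (rule poly_eqI) (auto simp: coeff_poly_cutoff coeff_monom_mult coeff_poly_shift)
    then have "poly (map_poly of_int D) x =
        poly (map_poly of_int (poly_cutoff r D + monom 1 r * poly_shift r D)) x" by simp
    then have *: "x ^ r * ?t = - poly (map_poly of_int (poly_cutoff r D)) x"
      using root by (simp add: of_int_poly_hom.hom_mult of_int_poly_hom.hom_add map_poly_monom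
          poly_monom eq_neg_iff_add_eq_0 add.commute)
    have "?t * x ^ i = (x ^ r * ?t) * x ^ (i - r)"
      using False by (simp add: mult_ac flip: power_add)
    then have "?t * x ^ i = poly (map_poly of_int (- (monom 1 (i - r) * poly_cutoff r D))) x"
      unfolding * by (simp add: of_int_poly_hom.hom_mult of_int_poly_hom.hom_uminus map_poly_monom
          poly_monom mult.commute)
    moreover have "degree (- (monom 1 (i - r) * poly_cutoff r D)) \<le> i"
    proof (rule degree_le, intro allI impI)
      fix k assume "i < k"
      then show "coeff (- (monom 1 (i - r) * poly_cutoff r D)) k = 0"
        using False by (auto simp: coeff_monom_mult coeff_poly_cutoff)
    qed
    ultimately show ?thesis using i le_less_trans by blast
  qed
qed

lemma algebraic_int_poly:
  fixes g :: "int poly" and \<theta> :: complex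
  assumes "algebraic_int \<theta>"
  shows "algebraic_int (poly (map_poly of_int g) \<theta>)"
proof -
  obtain F where F: "poly (map_poly of_int F) \<theta> = 0" "lead_coeff F = 1"
    using assms by (auto simp: algebraic_int_altdef_ipoly)
  have F0: "F \<noteq> 0" using F by auto
  have n: "degree F > 0" using degree_pos_of_root[OF F(1) F0] .
  show ?thesis
  proof (rule algebraic_int_multiplier[OF n])
    fix i
    obtain q R where qR: "pseudo_divmod (g * monom 1 i) F = (q, R)"
      by (meson surj_pair)
    from pseudo_divmod(1)[OF F0 this] have "g * monom 1 i = F * q + R"
      using F(2) by simp
    then have "poly (map_poly of_int (g * monom 1 i)) \<theta> =
        poly (map_poly of_int (F * q + R) :: complex poly) \<theta>" by simp
    then have "poly (map_poly of_int g) \<theta> * \<theta> ^ i = poly (map_poly of_int R) \<theta>"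
      using F by (simp add: of_int_poly_hom.hom_mult of_int_poly_hom.hom_add map_poly_monom poly_monom)
    moreover have "degree R < degree F"
      using pseudo_divmod(2)[OF F0 qR] n by auto
    ultimately show "\<exists>R :: int poly. degree R < degree F \<and>
        poly (map_poly of_int g) \<theta> * \<theta> ^ i = poly (map_poly of_int R) \<theta>" by blast
  qed
qed

section \<open>Embeddings of the field given by the roots of an irreducible polynomial\<close>

abbreviation ipoly :: "int poly \<Rightarrow> complex \<Rightarrow> complex" where
  "ipoly p \<equiv> poly (map_poly of_int p)"

abbreviation rpoly :: "rat poly \<Rightarrow> complex \<Rightarrow> complex" where
  "rpoly p \<equiv> poly (map_poly of_rat p)"

interpretation of_rat_poly: map_poly_comm_ring_hom "of_rat :: rat \<Rightarrow> complex" ..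

lemma rpoly_of_int: "rpoly (map_poly of_int p) x = ipoly p x"
  by (simp add: map_poly_map_poly o_def)

lemma rpoly_pcompose: "rpoly (pcompose p q) x = rpoly p (rpoly q x)"
  by (simp add: of_rat_hom.map_poly_pcompose poly_pcompose)

text \<open>Makes evaluation at another root \<open>x\<close> a well-defined embedding of the field
  of \<open>\<theta>\<close>: \<open>F\<close> divides every rational polynomial vanishing at
  \<open>\<theta>\<close>, since otherwise a Bezout identity would read 0 = 1 there.\<close>

lemma irreducible_root_transfer:
  assumes F: "irreducible F" and \<theta>: "rpoly F \<theta> = 0" and x: "rpoly F x = 0" and r: "rpoly r \<theta> = 0"
  shows "rpoly r x = 0"
proof (cases "F dvd r")
  case True
  then show ?thesis using x by (auto simp: of_rat_poly.hom_mult)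
next
  case False
  then have "coprime F r"
    using F by (intro prime_elem_imp_coprime) (auto simp: prime_elem_iff_irreducible)
  then have "fst (bezout_coefficients F r) * F + snd (bezout_coefficients F r) * r = 1"
    by (simp add: bezout_coefficients_fst_snd)
  then have "rpoly (fst (bezout_coefficients F r) * F + snd (bezout_coefficients F r) * r) \<theta> = 1"
    by simp
  then show ?thesis using \<theta> r by (simp add: of_rat_poly.hom_mult of_rat_poly.hom_add)
qed

lemma rpoly_in_subfield:
  assumes L: "complex_subfield L" "x \<in> L"
  shows "rpoly r x \<in> L"
proof -
  have L': "1 \<in> L" "\<And>x y. x \<in> L \<Longrightarrow> y \<in> L \<Longrightarrow> x - y \<in> L" "\<And>x y. x \<in> L \<Longrightarrow> y \<in> L \<Longrightarrow> x * y \<in> L"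
    "\<And>x. x \<in> L \<Longrightarrow> inverse x \<in> L"
    using L by (auto simp: complex_subfield_def)
  then have R: "subring L" by (intro subringI)
  have "of_rat c \<in> L" for c
  proof (cases c)
    case (Fract a b)
    then show ?thesis
      using L'(3,4) subring_of_int[OF R] by (simp add: of_rat_rat divide_inverse)
  qed
  then show ?thesis
    using L(2) by (intro subring_poly[OF R]) (auto simp: coeff_map_poly)
qed

lemma rat_adjoin_eq:
  assumes F: "irreducible F" and \<theta>: "rpoly F \<theta> = 0"
  shows "rat_adjoin \<theta> = range (\<lambda>r. rpoly r \<theta>)"
proof
  show "range (\<lambda>r. rpoly r \<theta>) \<subseteq> rat_adjoin \<theta>"
    using rpoly_in_subfield by (auto simp: rat_adjoin_def)
  have "complex_subfield (range (\<lambda>r. rpoly r \<theta>))"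
    unfolding complex_subfield_def
  proof (intro conjI ballI)
    show "1 \<in> range (\<lambda>r. rpoly r \<theta>)" by (rule range_eqI[of _ _ 1]) simp
    fix x assume "x \<in> range (\<lambda>r. rpoly r \<theta>)"
    then obtain p where p: "x = rpoly p \<theta>" by auto
    show "inverse x \<in> range (\<lambda>r. rpoly r \<theta>)"
    proof (cases "x = 0")
      case True
      then show ?thesis by (auto intro: range_eqI[of _ _ 0])
    next
      case False
      then have "\<not> F dvd p" using \<theta> p by (auto simp: of_rat_poly.hom_mult)
      then have "coprime F p"
        using F by (intro prime_elem_imp_coprime) (auto simp: prime_elem_iff_irreducible)
      then have "fst (bezout_coefficients F p) * F + snd (bezout_coefficients F p) * p = 1"
        by (simp add: bezout_coefficients_fst_snd)
      then have "rpoly (fst (bezout_coefficients F p) * F + snd (bezout_coefficients F p) * p) \<theta> = 1"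
        by simp
      then have "rpoly (snd (bezout_coefficients F p)) \<theta> * x = 1"
        using \<theta> p by (simp add: of_rat_poly.hom_mult of_rat_poly.hom_add)
      then have "inverse x = rpoly (snd (bezout_coefficients F p)) \<theta>"
        using False by (simp add: field_simps)
      then show ?thesis by blast
    qed
    fix y assume "y \<in> range (\<lambda>r. rpoly r \<theta>)"
    then obtain q where q: "y = rpoly q \<theta>" by auto
    show "x - y \<in> range (\<lambda>r. rpoly r \<theta>)"
      by (rule range_eqI[of _ _ "p - q"]) (simp add: p q of_rat_poly.hom_minus)
    show "x * y \<in> range (\<lambda>r. rpoly r \<theta>)"
      by (rule range_eqI[of _ _ "p * q"]) (simp add: p q of_rat_poly.hom_mult)
  qed
  moreover have "\<theta> \<in> range (\<lambda>r. rpoly r \<theta>)"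
    by (rule range_eqI[of _ _ "[:0, 1:]"]) (simp add: map_poly_pCons)
  ultimately show "rat_adjoin \<theta> \<subseteq> range (\<lambda>r. rpoly r \<theta>)"
    by (auto simp: rat_adjoin_def)
qed

lemma rat_poly_clear_denominators:
  obtains N :: int and R :: "int poly" where "N \<noteq> 0" "smult (of_int N) r = map_poly rat_of_int R"
proof -
  have "\<exists>(N::int) R. N \<noteq> 0 \<and> smult (of_int N) r = map_poly rat_of_int R"
  proof (induction r)
    case 0
    show ?case by (auto intro: exI[of _ 1] exI[of _ 0])
  next
    case (pCons a r)
    then obtain N :: int and R where N: "N \<noteq> 0" "smult (of_int N) r = map_poly rat_of_int R" by auto
    obtain b d :: int where ab: "a = of_int b / of_int d" "d > 0"
      by (metis quotient_of_div quotient_of_denom_pos surj_pair)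
    have "smult (of_int (N * d)) (pCons a r) = pCons (of_int (N * b)) (smult (of_int d) (smult (of_int N) r))"
      using ab(2) unfolding ab(1) by (simp add: mult.commute)
    also have "\<dots> = map_poly rat_of_int (pCons (N * b) (smult d R))"
      unfolding N(2) by (simp add: of_int_hom.map_poly_pCons_hom of_int_hom.map_poly_hom_smult)
    finally show ?case using N ab by (intro exI[of _ "N * d"] exI[of _ "pCons (N * b) (smult d R)"]) auto
  qed
  then show ?thesis using that by blast
qed

text \<open>The field element need not be integral, but its multiple by some \<open>N\<close> is.
  Substituting \<open>N X\<close> into a monic equation of that multiple and dividing by the content
  leaves a primitive polynomial, whose coefficients are not all divisible by 3.\<close>

lemma primitive_integer_polynomial:
  assumes "algebraic_int \<theta>"
  obtains D :: "int poly" and l where "D \<noteq> 0" "ipoly D (rpoly r \<theta>) = 0" "\<not> 3 dvd coeff D l"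
proof -
  obtain N :: int and R where N: "N \<noteq> 0" "smult (of_int N) r = map_poly rat_of_int R"
    by (rule rat_poly_clear_denominators)
  have "of_int N * rpoly r \<theta> = rpoly (smult (of_int N) r) \<theta>"
    by (simp add: of_rat_hom.map_poly_hom_smult)
  also have "\<dots> = ipoly R \<theta>" by (simp only: N(2) rpoly_of_int)
  finally have NR: "of_int N * rpoly r \<theta> = ipoly R \<theta>" .
  obtain p where p: "ipoly p (ipoly R \<theta>) = 0" "lead_coeff p = 1"
    using algebraic_int_poly[OF assms, of R] by (auto simp: algebraic_int_altdef_ipoly)
  define D0 where "D0 = pcompose p [:0, N:]"
  define D where "D = primitive_part D0"
  have "lead_coeff D0 \<noteq> 0"
    unfolding D0_def using N p by (subst lead_coeff_comp) auto
  then have D0: "D0 \<noteq> 0" by auto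
  have "ipoly D0 (rpoly r \<theta>) = ipoly p (of_int N * rpoly r \<theta>)"
    by (simp add: D0_def of_int_hom.map_poly_pcompose poly_pcompose of_int_hom.map_poly_pCons_hom mult.commute)
  then have root: "ipoly D0 (rpoly r \<theta>) = 0" using p NR by simp
  have "D0 = smult (content D0) D" by (simp add: D_def)
  then have "ipoly D0 (rpoly r \<theta>) = of_int (content D0) * ipoly D (rpoly r \<theta>)"
    by (metis of_int_hom.map_poly_hom_smult poly_smult)
  with root D0 have 1: "ipoly D (rpoly r \<theta>) = 0" by simp
  have "content D = 1" using D0 by (simp add: D_def)
  have "\<exists>l. \<not> 3 dvd coeff D l"
  proof (rule ccontr)
    assume "\<nexists>l. \<not> 3 dvd coeff D l"
    then have "[:3:] dvd D" by (simp add: const_poly_dvd_iff)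
    then have "3 dvd content D" by (simp add: const_poly_dvd_iff_dvd_content)
    then show False using \<open>content D = 1\<close> by simp
  qed
  moreover have "D \<noteq> 0" using D0 by (simp add: D_def)
  ultimately show ?thesis using 1 that by blast
qed

lemma poly_shift_Suc: "poly_shift n p = pCons (coeff p n) (poly_shift (Suc n) p)"
  by (rule poly_eqI) (simp add: coeff_poly_shift coeff_pCons split: nat.split)

context valuation_ring
begin

text \<open>A generator \<open>\<eta> = g(\<theta>)\<close> of the integers separates the embeddings of the field into the
  complex numbers modulo \<open>M\<close> as finely as any field element does: the tails of the primitive
  polynomial of that element are polynomials in \<open>\<eta>\<close>, hence congruent at \<open>x\<close> and \<open>y\<close>.\<close>

lemma power_basis_embeddings:
  fixes F :: "int poly"
  assumes irr: "irreducible (map_poly rat_of_int F)" and monic: "lead_coeff F = 1"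
    and \<theta>: "ipoly F \<theta> = 0" and mono: "monogenic (rat_adjoin \<theta>)"
  obtains g where "\<And>x. ipoly F x = 0 \<Longrightarrow> rpoly g x \<in> V"
    and "\<And>x y. ipoly F x = 0 \<Longrightarrow> ipoly F y = 0 \<Longrightarrow> rpoly g x - rpoly g y \<in> M \<Longrightarrow> x - y \<in> M"
    and "\<And>x c. ipoly F x = 0 \<Longrightarrow> rpoly g x - of_int c \<in> M \<Longrightarrow> \<exists>d. x - of_int d \<in> M"
    and "\<And>x y r. ipoly F x = 0 \<Longrightarrow> ipoly F y = 0 \<Longrightarrow> rpoly g x - rpoly g y \<in> M \<Longrightarrow>
           rpoly r x \<in> M \<Longrightarrow> rpoly r y \<in> M"
proof -
  have K: "rat_adjoin \<theta> = range (\<lambda>r. rpoly r \<theta>)"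
    using rat_adjoin_eq[OF irr] \<theta> by (simp add: rpoly_of_int)
  have \<theta>_int: "algebraic_int \<theta>"
    using \<theta> monic by (auto simp: algebraic_int_altdef_ipoly)
  have transfer: "rpoly r x = 0" if "rpoly r \<theta> = 0" "ipoly F x = 0" for r x
    using irreducible_root_transfer[OF irr, of \<theta> x r] that \<theta> by (simp add: rpoly_of_int)
  obtain \<eta> where \<eta>: "\<eta> \<in> rat_adjoin \<theta>" "algebraic_int \<eta>"
    "ring_of_integers (rat_adjoin \<theta>) = int_adjoin \<eta>"
    using mono by (auto simp: monogenic_def ring_of_integers_def)
  then obtain g where g: "\<eta> = rpoly g \<theta>" using K by auto
  \<comment> \<open>Here monogenicity enters: an integral element is an integer polynomial
    \<open>P\<close> in \<open>\<eta>\<close>, and the identity transfers to all roots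
    \<open>x\<close> with the same \<open>P\<close>.\<close>
  have expand: "\<exists>P. \<forall>x. ipoly F x = 0 \<longrightarrow> rpoly r x = ipoly P (rpoly g x)"
    if "algebraic_int (rpoly r \<theta>)" for r
  proof -
    have "rpoly r \<theta> \<in> int_adjoin \<eta>"
      using that K \<eta> by (auto simp: ring_of_integers_def)
    then obtain P where P: "rpoly r \<theta> = ipoly P \<eta>" by (auto simp: int_adjoin_def)
    define r' where "r' = r - pcompose (map_poly of_int P) g"
    have r': "rpoly r' x = rpoly r x - ipoly P (rpoly g x)" for x
      by (simp add: r'_def of_rat_poly.hom_minus rpoly_pcompose rpoly_of_int)
    then have "rpoly r' \<theta> = 0" using P g by simp
    then have "\<forall>x. ipoly F x = 0 \<longrightarrow> rpoly r x = ipoly P (rpoly g x)"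
      using transfer[of r'] unfolding r' by simp
    then show ?thesis ..
  qed
  have X: "rpoly [:0, 1:] x = x" for x by (simp add: map_poly_pCons)
  obtain h where h: "\<And>x. ipoly F x = 0 \<Longrightarrow> x = ipoly h (rpoly g x)"
    using expand[of "[:0, 1:]"] \<theta>_int unfolding X by blast
  have gV: "rpoly g x \<in> V" if x: "ipoly F x = 0" for x
  proof -
    obtain p where p: "ipoly p \<eta> = 0" "lead_coeff p = 1"
      using \<eta> by (auto simp: algebraic_int_altdef_ipoly)
    have "rpoly (pcompose (map_poly of_int p) g) \<theta> = 0"
      using p g by (simp add: rpoly_pcompose rpoly_of_int)
    from transfer[OF this x] have "ipoly p (rpoly g x) = 0"
      by (simp add: rpoly_pcompose rpoly_of_int)
    then show ?thesis using p by (intro algebraic_int_V) (auto simp: algebraic_int_altdef_ipoly)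
  qed
  show ?thesis
  proof (rule that[of g])
    fix x y assume xy: "ipoly F x = 0" "ipoly F y = 0" "rpoly g x - rpoly g y \<in> M"
    then have "ipoly h (rpoly g x) - ipoly h (rpoly g y) \<in> M"
      using gV by (intro int_poly_cong_M) auto
    then show "x - y \<in> M" by (simp only: h[OF xy(1), symmetric] h[OF xy(2), symmetric])
    fix r assume a: "rpoly r x \<in> M"
    show "rpoly r y \<in> M"
    proof (rule ccontr)
      assume b: "rpoly r y \<notin> M"
      define a' b' where "a' = rpoly r x" and "b' = rpoly r y"
      obtain D :: "int poly" and l where D: "D \<noteq> 0" "ipoly D (rpoly r \<theta>) = 0" "\<not> 3 dvd coeff D l"
        using primitive_integer_polynomial[OF \<theta>_int] by blast
      \<comment> \<open>The tails of \<open>D\<close> are integral, so their values at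
        \<open>a'\<close> and \<open>b'\<close> agree modulo \<open>M\<close>. Since
        \<open>a'\<close> is in \<open>M\<close>, \<open>T n a'\<close> reduces to the coefficient
        \<open>coeff D n\<close>, and so does \<open>T n b'\<close>. As \<open>b'\<close> is not in
        \<open>M\<close> (it may even lie outside \<open>V\<close>), the recursion forces
        \<open>T (Suc n) b'\<close> into \<open>M\<close>, and with it every coefficient of
        \<open>D\<close>.\<close>
      define T where "T = (\<lambda>n. ipoly (poly_shift n D))"
      have T_rec: "T n z = of_int (coeff D n) + z * T (Suc n) z" for n z
        unfolding T_def by (subst poly_shift_Suc) (simp add: of_int_hom.map_poly_pCons_hom)
      have Tr: "T n (rpoly r z) = rpoly (pcompose (map_poly of_int (poly_shift n D)) r) z" for n z
        by (simp add: T_def rpoly_pcompose rpoly_of_int)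
      have cong: "T n a' - T n b' \<in> M" for n
      proof -
        have "algebraic_int (T n (rpoly r \<theta>))"
          unfolding T_def using D by (intro algebraic_int_poly_shift)
        then obtain P where "\<And>z. ipoly F z = 0 \<Longrightarrow> T n (rpoly r z) = ipoly P (rpoly g z)"
          using expand[of "pcompose (map_poly of_int (poly_shift n D)) r"] unfolding Tr by blast
        then show ?thesis
          using xy gV int_poly_cong_M[of "rpoly g x" "rpoly g y" P] by (simp add: a'_def b'_def)
      qed
      have Ta: "T n a' - of_int (coeff D n) \<in> M" for n
        using a M_V[OF a] M_mult[OF a int_poly_V] by (subst T_rec) (simp add: a'_def T_def)
      have Tb: "T n b' - of_int (coeff D n) \<in> M" for n
        using M_diff[OF Ta[of n] cong[of n]] by simp
      have "of_int (coeff D n) \<in> M" for n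
      proof (cases n)
        case 0
        have "rpoly (pcompose (map_poly of_int D) r) \<theta> = 0"
          using D by (simp add: rpoly_pcompose rpoly_of_int)
        from transfer[OF this xy(2)] have "T 0 b' = 0"
          by (simp add: rpoly_pcompose rpoly_of_int T_def b'_def)
        then show ?thesis using Tb[of 0] 0 by (simp add: M_uminus_iff)
      next
        case (Suc m)
        have "b' * T n b' \<in> M" using Tb[of m] T_rec[of m b'] Suc by simp
        then have "T n b' \<in> M" using b M_mult_cancel[of b' "T n b'"] by (simp add: b'_def)
        from M_diff[OF this Tb[of n]] show ?thesis by simp
      qed
      from this[of l] show False using D(3) by (simp add: of_int_M)
    qed
  next
    fix x c assume x: "ipoly F x = 0" "rpoly g x - of_int c \<in> M"
    then have "ipoly h (rpoly g x) - ipoly h (of_int c) \<in> M"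
      by (intro int_poly_cong_M gV V_intros(10))
    then show "\<exists>d. x - of_int d \<in> M"
      by (intro exI[of _ "poly h c"]) (simp add: h[OF x(1), symmetric])
  qed (use gV in auto)
qed

end

section \<open>Sides of Newton polygons\<close>

text \<open>Modulo \<open>w\<close>, \<open>y\<close> is \<open>- u\<close>, which the
  \<open>q\<close>-th power fixes together with \<open>u\<close> because \<open>q\<close> is odd.
  This carries the Frobenius condition from the coefficients of a linear relation to its
  solution.\<close>

lemma frob_of_cong:
  assumes R: "subring R" and yu: "y \<in> R" "u \<in> R" "(y + u) / w \<in> R" "(u ^ q - u) / w \<in> R"
    and q: "odd q"
  shows "(y ^ q - y) / w \<in> R"
proof -
  have "(y ^ n - (- u) ^ n) / w \<in> R" for n
  proof (induction n)
    case (Suc n)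
    have "(y ^ Suc n - (- u) ^ Suc n) / w = (y + u) / w * y ^ n - u * ((y ^ n - (- u) ^ n) / w)"
      by (simp add: diff_divide_distrib add_divide_distrib algebra_simps)
    also have "\<dots> \<in> R" using Suc yu by (intro subring_intros[OF R])
    finally show ?case .
  qed (simp add: subring_0[OF R])
  from this[of q] have "(y ^ q - (- u) ^ q) / w - (u ^ q - u) / w - (y + u) / w \<in> R"
    using yu by (intro subring_diff[OF R])
  moreover have "(y ^ q - (- u) ^ q) / w - (u ^ q - u) / w - (y + u) / w = (y ^ q - y) / w"
    using q by (simp add: diff_divide_distrib add_divide_distrib)
  ultimately show ?thesis by simp
qed

text \<open>Substituting \<open>a X\<close> and dividing by \<open>a ^ N\<close> turns the weight
  \<open>N + E\<close> of a coefficient into its excess \<open>E\<close> over a side of weight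
  \<open>N\<close>.\<close>

lemma coeff_rescale:
  fixes a :: "'a :: field"
  assumes "a \<noteq> 0" "coeff p l = d * c" "d * a ^ l = a ^ (N + E)"
  shows "coeff (smult (inverse (a ^ N)) (pcompose p [:0, a:])) l = c * a ^ E"
proof -
  have "coeff (smult (inverse (a ^ N)) (pcompose p [:0, a:])) l = inverse (a ^ N) * (d * a ^ l) * c"
    using assms(2) by (simp add: coeff_pcompose_linear mult_ac)
  also have "\<dots> = c * a ^ E" unfolding assms(3) using assms(1) by (simp add: power_add)
  finally show ?thesis .
qed

context valuation_ring
begin

lemma frob_loc_root:
  assumes "\<zeta> \<in> V" "\<zeta> ^ q = \<zeta>" "q \<in> {3, 9}" "x \<in> loc {\<zeta>}"
  shows "(x ^ q - x) / 3 \<in> loc {\<zeta>}"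
proof -
  interpret uniformized V "{\<zeta>}" 3 q
    by unfold_locales (use assms M_3 in \<open>auto intro: loc_intros\<close>)
  show ?thesis using frob_loc assms by simp
qed

text \<open>A side of the Newton polygon from \<open>(J - e, H + 1)\<close> to \<open>(J, H)\<close>.\<close>

lemma ramified_branch:
  assumes \<zeta>: "\<zeta> \<in> V" "\<zeta> ^ q = \<zeta>" and q: "q \<in> {3, 9}"
    and p: "\<And>l. coeff p l = 3 ^ h l * c l" and c: "\<And>l. c l \<in> loc {\<zeta>}"
    and e: "e > 0" "e \<le> J"
    and J: "h J = H" "c J \<notin> M" "h (J - e) = Suc H" "c (J - e) \<notin> M"
    and above: "\<And>l. l \<noteq> J \<Longrightarrow> l \<noteq> J - e \<Longrightarrow> c l \<noteq> 0 \<Longrightarrow> e * H + J < e * h l + l"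
  obtains t where "poly p t = 0" "t ^ e / 3 \<in> V" "t ^ e / 3 \<notin> M"
    "\<And>r. rpoly r (\<zeta> + t) \<in> V \<Longrightarrow> rpoly r (\<zeta> + t) ^ q - rpoly r (\<zeta> + t) \<in> M"
proof -
  have cV: "c l \<in> V" for l using loc_V[OF c] \<zeta> by auto
  \<comment> \<open>Height of \<open>(l, h l)\<close> above the line through the side, scaled by
    \<open>e\<close>: zero at both ends, positive at every other nonzero coefficient.\<close>
  define E where "E = (\<lambda>l. e * h l + l - (e * H + J))"
  have E: "e * h l + l = e * H + J + E l" if "c l \<noteq> 0" for l
  proof (cases "l = J \<or> l = J - e")
    case True
    then show ?thesis using J e by (auto simp: E_def)
  next
    case False
    then show ?thesis using above[of l] that by (simp add: E_def)
  qed
  have E0: "E J = 0" "E (J - e) = 0" using J e by (auto simp: E_def)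
  have Epos: "E l > 0" if "l \<noteq> J" "l \<noteq> J - e" "c l \<noteq> 0" for l
    using above[OF that] by (simp add: E_def)
  have c0: "c J \<noteq> 0" "c (J - e) \<noteq> 0" using J unit_nonzero by auto

  \<comment> \<open>\<open>\<pi>\<close> has the valuation that the slope prescribes for the root.
    After substituting \<open>\<pi> Y\<close> only the two end coefficients survive modulo
    \<open>M\<close>, so a root \<open>y\<close> can be chosen that is a unit.\<close>
  obtain \<pi> :: complex where \<pi>: "\<pi> ^ e = 3" using nth_root_exists[OF e(1)] by blast
  have \<pi>M: "\<pi> \<in> M" using M_root[of \<pi> e] \<pi> e M_3 by simp
  have \<pi>0: "\<pi> \<noteq> 0" using \<pi> e by (auto simp: power_0_left)
  define g where "g = smult (inverse (\<pi> ^ (e * H + J))) (pcompose p [:0, \<pi>:])"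
  have g: "coeff g l = c l * \<pi> ^ E l" for l
  proof (cases "c l = 0")
    case False
    show ?thesis unfolding g_def
      by (rule coeff_rescale[OF \<pi>0 p])
        (simp only: \<pi>[symmetric] E[OF False, symmetric] power_add power_mult)
  qed (simp add: g_def coeff_pcompose_linear p)
  have gV: "coeff g l \<in> V" for l
    unfolding g using cV M_V[OF \<pi>M] by (intro V_intros)
  obtain y where y: "poly g y = 0" "y \<in> V" "y \<notin> M"
    using poly_root_in_valuation_ring[of g J] gV J e
    by (metis g E0 power_0 mult_1_right diff_less less_le_trans less_irrefl)
  define t where "t = \<pi> * y"
  have pt: "poly p t = 0"
    using y(1) \<pi>0 by (simp add: g_def poly_pcompose t_def mult.commute)
  have te: "t ^ e / 3 = y ^ e" using \<pi> by (simp add: t_def power_mult_distrib)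
  have teV: "t ^ e / 3 \<in> V" and teM: "t ^ e / 3 \<notin> M"
    unfolding te using y e by (auto simp: M_power intro: V_intros)
  have tM: "t \<in> M" unfolding t_def using \<pi>M y by (intro M_mult)
  have t0: "t \<noteq> 0" using \<pi>0 unit_nonzero[OF y(3)] by (simp add: t_def)

  define z where "z = t ^ e / 3"
  \<comment> \<open>\<open>\<pi>\<close> and \<open>y\<close> are left out, as they may lie in a
    larger field; \<open>t\<close> and \<open>z\<close> are rational expressions in
    \<open>\<zeta>\<close> and the root. The uniformizer will be \<open>t\<close>, by
    \<open>3 = t ^ e * inverse z\<close>.\<close>
  define G where "G = {\<zeta>, t, z}"
  have GV: "G \<subseteq> V" using \<zeta> M_V[OF tM] teV by (auto simp: G_def z_def)
  have tL: "t \<in> loc G" and zL: "z \<in> loc G" and \<zeta>L: "\<zeta> \<in> loc G"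
    by (auto simp: G_def intro: loc.gen)
  have izL: "inverse z \<in> loc G" using zL teM by (intro loc.inv) (auto simp: z_def)
  have cL: "x \<in> loc G" if "x \<in> loc {\<zeta>}" for x
    using loc_mono[OF that] \<zeta>L by auto
  have z0: "z \<noteq> 0" using unit_nonzero[OF teM] by (simp add: z_def)
  have three: "3 = t ^ e * inverse z" using t0 by (simp add: z_def)
  have three_t: "3 / t \<in> loc G"
  proof -
    have "t ^ e = t * t ^ (e - 1)" using e by (simp flip: power_Suc)
    then have "3 = t * (t ^ (e - 1) * inverse z)" using three by (simp only: mult.assoc)
    then have "3 / t = t ^ (e - 1) * inverse z" using t0 by (metis nonzero_mult_div_cancel_left)
    then show ?thesis using tL izL by (simp add: loc_intros del: inverse_eq_divide)
  qed
  \<comment> \<open>The terms of \<open>poly p t\<close> divided by \<open>t ^ (e * H + J)\<close>,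
    with 3 replaced by \<open>t ^ e * inverse z\<close>. Terms off the side keep a factor
    \<open>t\<close>.\<close>
  define T where "T = (\<lambda>l. c l * inverse z ^ h l * t ^ E l)"
  have sumT: "(\<Sum>l\<le>degree p. T l) = 0"
  proof -
    have "coeff p l * t ^ l = t ^ (e * H + J) * T l" for l
    proof (cases "c l = 0")
      case False
      have "coeff p l * t ^ l = c l * inverse z ^ h l * t ^ (e * h l + l)"
      proof -
        have "(3 :: complex) ^ h l = t ^ (e * h l) * inverse z ^ h l"
          by (subst three) (simp only: power_mult_distrib power_mult)
        then show ?thesis by (simp only: p power_add mult_ac)
      qed
      also have "\<dots> = t ^ (e * H + J) * T l"
        unfolding E[OF False] T_def by (simp add: power_add mult_ac)
      finally show ?thesis .
    qed (simp add: p T_def)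
    then have "poly p t = t ^ (e * H + J) * (\<Sum>l\<le>degree p. T l)"
      unfolding poly_altdef sum_distrib_left by simp
    then show ?thesis using pt t0 by simp
  qed
  have le: "J \<le> degree p" "J - e \<le> degree p"
    using c0 by (auto intro!: le_degree simp: p)
  define A where "A = {..degree p} - {J, J - e}"
  have "(\<Sum>l\<le>degree p. T l) = (\<Sum>l\<in>A. T l) + (\<Sum>l\<in>{J, J - e}. T l)"
    unfolding A_def by (rule sum.subset_diff) (use le in auto)
  also have "(\<Sum>l\<in>{J, J - e}. T l) = T J + T (J - e)"
    using e by (subst sum.insert) auto
  finally have rel: "T J + T (J - e) = - (\<Sum>l\<in>A. T l)"
    unfolding sumT by (metis add.commute eq_neg_iff_add_eq_0)
  have AL: "(\<Sum>l\<in>A. T l) / t \<in> loc G"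
    unfolding sum_divide_distrib
  proof (intro loc_intros(8))
    fix l assume l: "l \<in> A"
    show "T l / t \<in> loc G"
    proof (cases "c l = 0")
      case False
      then have "t ^ E l = t * t ^ (E l - 1)"
        using Epos[of l] l by (simp add: A_def flip: power_Suc)
      then have "T l / t = c l * inverse z ^ h l * t ^ (E l - 1)"
        using t0 by (simp add: T_def)
      also have "\<dots> \<in> loc G" using cL[OF c] izL tL by (intro loc_intros)
      finally show ?thesis .
    qed (simp add: T_def loc_intros)
  qed
  \<comment> \<open>The side has height one, so its residual polynomial is linear: modulo
    \<open>t\<close>, \<open>z\<close> is \<open>- u\<close>, whose residue already occurs in
    \<open>loc {\<zeta>}\<close>. Hence the residue field does not grow.\<close>
  define u where "u = c (J - e) * inverse (c J)"
  have u: "u \<in> loc {\<zeta>}" unfolding u_def using c J by (intro loc.mult loc.inv)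
  have zu: "(z + u) / t \<in> loc G"
  proof -
    have z1: "z ^ n * inverse z ^ n = 1" for n
      using z0 by (simp flip: power_mult_distrib)
    have z2: "z ^ Suc H * inverse z ^ H = z"
      by (simp add: mult.assoc z1)
    have "(c J * inverse z ^ H + c (J - e) * inverse z ^ Suc H) * (z ^ Suc H * inverse (c J)) =
        c J * inverse (c J) * (z ^ Suc H * inverse z ^ H) +
        c (J - e) * inverse (c J) * (z ^ Suc H * inverse z ^ Suc H)"
      by (simp only: algebra_simps)
    then have "z + u = (c J * inverse z ^ H + c (J - e) * inverse z ^ Suc H) * (z ^ Suc H * inverse (c J))"
      unfolding z1 z2 using c0 by (simp add: u_def)
    also have "\<dots> = (T J + T (J - e)) * (z ^ Suc H * inverse (c J))"
      using J E0 by (simp add: T_def)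
    finally have "(z + u) / t = - ((\<Sum>l\<in>A. T l) / t) * (z ^ Suc H * inverse (c J))"
      unfolding rel by simp
    also have "\<dots> \<in> loc G"
      using AL zL cL[OF c] J by (intro loc_intros loc.inv)
    finally show ?thesis .
  qed
  have uq: "(x ^ q - x) / t \<in> loc G" if "x \<in> loc {\<zeta>}" for x
  proof -
    have "(x ^ q - x) / 3 * (3 / t) \<in> loc G"
      using cL[OF frob_loc_root[OF \<zeta> q that]] three_t by (intro loc_intros)
    then show ?thesis by simp
  qed
  interpret uniformized V G t q
  proof unfold_locales
    fix x assume "x \<in> G"
    then consider "x = \<zeta>" | "x = t" | "x = z" by (auto simp: G_def)
    then show "(x ^ q - x) / t \<in> loc G"
    proof cases
      case 2
      have "t ^ q = t * t ^ (q - 1)" using q by (auto simp flip: power_Suc)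
      then have "(x ^ q - x) / t = t ^ (q - 1) - 1" using 2 t0 by (simp add: diff_divide_distrib)
      then show ?thesis using tL by (simp add: loc_intros)
    next
      case 3
      show ?thesis unfolding 3
        using q by (intro frob_of_cong[OF subring_loc zL cL[OF u] zu uq[OF u]]) auto
    qed (use \<zeta> in \<open>simp add: loc_intros\<close>)
  qed (use GV tL tM t0 three_t q in auto)
  show ?thesis
  proof (rule that[OF pt teV teM])
    show "rpoly r (\<zeta> + t) ^ q - rpoly r (\<zeta> + t) \<in> M" if "rpoly r (\<zeta> + t) \<in> V" for r
      by (rule residue_degree[OF _ _ that, of e]) (use \<zeta>L tL zL in \<open>auto simp: z_def intro: loc_intros\<close>)
  qed
qed

text \<open>The side of slope -1 ending at \<open>(1, H)\<close>, where 3 itself remains a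
  uniformizer. As \<open>c 0\<close> may lie in \<open>M\<close>, the root can be closer to
  \<open>\<zeta>\<close> than the slope predicts, and only \<open>t / 3 \<in> V\<close> is claimed;
  modulo 3, \<open>t / 3\<close> is \<open>- c 0 / c 1\<close>.\<close>

lemma unramified_branch:
  assumes \<zeta>: "\<zeta> \<in> V" "\<zeta> ^ q = \<zeta>" and q: "q \<in> {3, 9}"
    and p: "\<And>l. coeff p l = 3 ^ h l * c l" and c: "\<And>l. c l \<in> loc {\<zeta>}"
    and J: "h 1 = H" "c 1 \<notin> M" "h 0 = Suc H"
    and above: "\<And>l. l \<ge> 2 \<Longrightarrow> c l \<noteq> 0 \<Longrightarrow> Suc H < h l + l"
  obtains t where "poly p t = 0" "t / 3 \<in> V"
    "\<And>r. rpoly r (\<zeta> + t) \<in> V \<Longrightarrow> rpoly r (\<zeta> + t) ^ q - rpoly r (\<zeta> + t) \<in> M"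
proof -
  have cV: "c l \<in> V" for l using loc_V[OF c] \<zeta> by auto
  define E where "E = (\<lambda>l. h l + l - Suc H)"
  have E: "h l + l = Suc H + E l" if "c l \<noteq> 0" for l
    using J above[OF _ that] by (cases "l = 0 \<or> l = 1") (auto simp: E_def)
  have E0: "E 0 = 0" "E 1 = 0" using J by (auto simp: E_def)
  have Epos: "E l > 0" if "l \<ge> 2" "c l \<noteq> 0" for l
    using above[OF that] by (simp add: E_def)
  define g where "g = smult (inverse (3 ^ Suc H)) (pcompose p [:0, 3:])"
  have g: "coeff g l = c l * 3 ^ E l" for l
  proof (cases "c l = 0")
    case False
    show ?thesis unfolding g_def
      by (rule coeff_rescale[OF _ p]) (simp_all only: E[OF False, symmetric] power_add, simp)
  qed (simp add: g_def coeff_pcompose_linear p)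
  have gV: "coeff g l \<in> V" for l
    unfolding g using cV by (intro V_intros)
  have g1: "coeff g 1 \<notin> M" using J E0 by (simp add: g)
  obtain z where z: "poly g z = 0" "z \<in> V"
  proof (rule poly_root_in_valuation_ring[of g 1])
    show "coeff g i \<in> V" for i by (rule gV)
    show "coeff g 1 \<notin> M" by (rule g1)
  qed simp_all
  define t where "t = 3 * z"
  have pt: "poly p t = 0"
    using z(1) by (simp add: g_def poly_pcompose t_def mult.commute)
  define G where "G = {\<zeta>, z}"
  have GV: "G \<subseteq> V" using \<zeta> z by (auto simp: G_def)
  have zL: "z \<in> loc G" and \<zeta>L: "\<zeta> \<in> loc G"
    by (auto simp: G_def intro: loc.gen)
  have cL: "x \<in> loc G" if "x \<in> loc {\<zeta>}" for x
    using loc_mono[OF that] \<zeta>L by auto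
  define A where "A = {..degree g} - {1, 0}"
  have c1: "c 1 \<noteq> 0" using J unit_nonzero by auto
  have "1 \<le> degree g"
    using c1 by (intro le_degree) (simp add: g)
  then have "poly g z = (\<Sum>l\<in>A. coeff g l * z ^ l) + (\<Sum>l\<in>{1, 0}. coeff g l * z ^ l)"
    unfolding A_def poly_altdef by (intro sum.subset_diff) auto
  also have "(\<Sum>l\<in>{1, 0}. coeff g l * z ^ l) = c 1 * z + c 0"
    using E0 by (simp add: g)
  finally have rel: "c 1 * z + c 0 = - (\<Sum>l\<in>A. coeff g l * z ^ l)"
    unfolding z(1) by (metis add.commute eq_neg_iff_add_eq_0)
  have AL: "(\<Sum>l\<in>A. coeff g l * z ^ l) / 3 \<in> loc G"
    unfolding sum_divide_distrib
  proof (intro loc_intros(8))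
    fix l assume l: "l \<in> A"
    show "coeff g l * z ^ l / 3 \<in> loc G"
    proof (cases "c l = 0")
      case False
      have "l \<ge> 2" using l by (auto simp: A_def)
      from power_minus_mult[OF Epos[OF this False], of "3 :: complex"]
      have "(3 :: complex) ^ E l = 3 * 3 ^ (E l - 1)" by (simp only: mult.commute)
      then have "coeff g l * z ^ l / 3 = c l * 3 ^ (E l - 1) * z ^ l"
        by (simp add: g)
      also have "\<dots> \<in> loc G" using cL[OF c] zL by (intro loc_intros)
      finally show ?thesis .
    qed (simp add: g loc_intros)
  qed
  define u where "u = c 0 * inverse (c 1)"
  have u: "u \<in> loc {\<zeta>}" unfolding u_def using c J by (intro loc.mult loc.inv)
  have zu: "(z + u) / 3 \<in> loc G"
  proof -
    have "(c 1 * z + c 0) * inverse (c 1) = c 1 * inverse (c 1) * z + c 0 * inverse (c 1)"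
      by (simp only: algebra_simps)
    also have "\<dots> = z + u" by (simp only: u_def right_inverse[OF c1] mult_1_left)
    finally have "z + u = (c 1 * z + c 0) * inverse (c 1)" ..
    then have "(z + u) / 3 = - ((\<Sum>l\<in>A. coeff g l * z ^ l) / 3) * inverse (c 1)"
      unfolding rel by simp
    also have "\<dots> \<in> loc G"
      using AL cL[OF c] J by (intro loc_intros loc.inv)
    finally show ?thesis .
  qed
  have uq: "(x ^ q - x) / 3 \<in> loc G" if "x \<in> loc {\<zeta>}" for x
    using cL[OF frob_loc_root[OF \<zeta> q that]] .
  interpret uniformized V G 3 q
  proof unfold_locales
    fix x assume "x \<in> G"
    then consider "x = \<zeta>" | "x = z" by (auto simp: G_def)
    then show "(x ^ q - x) / 3 \<in> loc G"
    proof cases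
      case 2
      show ?thesis unfolding 2
        using q by (intro frob_of_cong[OF subring_loc zL cL[OF u] zu uq[OF u]]) auto
    qed (use \<zeta> in \<open>simp add: loc_intros\<close>)
  qed (use GV M_3 q in \<open>simp_all add: loc_intros\<close>)
  have tL: "t \<in> loc G" unfolding t_def using zL by (intro loc_intros)
  show ?thesis
  proof (rule that[OF pt])
    show "t / 3 \<in> V" using z by (simp add: t_def)
    show "rpoly r (\<zeta> + t) ^ q - rpoly r (\<zeta> + t) \<in> M" if "rpoly r (\<zeta> + t) \<in> V" for r
      by (rule residue_degree[OF _ _ that, of 1]) (use \<zeta>L tL in \<open>simp_all add: loc_intros\<close>)
  qed
qed

end

section \<open>Binomial coefficients\<close>

text \<open>By \<open>l (N choose l) = N ((N - 1) choose (l - 1))\<close> the power of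
  \<open>p\<close> in \<open>N\<close> survives up to the part contained in \<open>l\<close>, whose
  exponent is at most \<open>m\<close>.\<close>

lemma prime_power_dvd_binomial:
  fixes p :: nat
  assumes p: "prime p" "p ^ k dvd N" and l: "0 < l" "l < p ^ Suc m"
  shows "p ^ (k - m) dvd (N choose l)"
proof -
  define v where "v = multiplicity p l"
  obtain l' where l': "l = p ^ v * l'" "\<not> p dvd l'"
    unfolding v_def by (rule multiplicity_decompose'[of l p]) (use l prime_gt_1_nat[OF p(1)] in auto)
  have "v \<le> m"
  proof (rule ccontr)
    assume "\<not> v \<le> m"
    then have "p ^ Suc m dvd l" unfolding l'(1) by (intro dvd_mult2 le_imp_power_dvd) simp
    then show False using l dvd_imp_le by fastforce
  qed
  show ?thesis
  proof (cases "v \<le> k")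
    case True
    have "p ^ v * p ^ (k - v) dvd p ^ v * (l' * (N choose l))"
    proof -
      have "p ^ v * p ^ (k - v) = p ^ k" using True by (simp flip: power_add)
      moreover have "p ^ v * (l' * (N choose l)) = N * ((N - 1) choose (l - 1))"
        using times_binomial_minus1_eq[OF l(1), of N] by (simp add: l'(1)[symmetric] mult.assoc[symmetric])
      ultimately show ?thesis using p(2) by simp
    qed
    then have "p ^ (k - v) dvd l' * (N choose l)" using p(1) by (simp add: prime_gt_0_nat)
    moreover have "coprime (p ^ (k - v)) l'"
      using p(1) l'(2) prime_imp_coprime by auto
    ultimately have "p ^ (k - v) dvd (N choose l)" by (simp add: coprime_dvd_mult_right_iff)
    moreover have "p ^ (k - m) dvd p ^ (k - v)" using \<open>v \<le> m\<close> by (intro le_imp_power_dvd) simp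
    ultimately show ?thesis using dvd_trans by blast
  qed (use \<open>v \<le> m\<close> in simp)
qed

text \<open>Passing from \<open>j\<close> to \<open>j + 1\<close> multiplies the coefficient by
  \<open>(N - 1 - j) / (j + 1)\<close>. Since \<open>j + 1 < p ^ k\<close> and \<open>p ^ k\<close>
  divides \<open>N\<close>, numerator and denominator contain the same power of
  \<open>p\<close>.\<close>

lemma not_prime_dvd_binomial:
  fixes p :: nat
  assumes p: "prime p" "p ^ k dvd N" and N: "N > 0"
  shows "j < p ^ k \<Longrightarrow> \<not> p dvd ((N - 1) choose j)"
proof (induction j)
  case 0
  then show ?case using prime_gt_1_nat[OF p(1)] by simp
next
  case (Suc j)
  define v where "v = multiplicity p (Suc j)"
  obtain i where i: "Suc j = p ^ v * i" "\<not> p dvd i"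
    unfolding v_def by (rule multiplicity_decompose'[of "Suc j" p]) (use prime_gt_1_nat[OF p(1)] in auto)
  have "v < k"
  proof (rule ccontr)
    assume "\<not> v < k"
    then have "p ^ k dvd Suc j" unfolding i(1) by (intro dvd_mult2 le_imp_power_dvd) simp
    then show False using Suc.prems dvd_imp_le by fastforce
  qed
  obtain N0 where "N = p ^ k * N0" using p by auto
  moreover have "p ^ k = p ^ v * (p * p ^ (k - Suc v))"
    using \<open>v < k\<close> by (simp flip: power_Suc power_add)
  ultimately have N': "N = p ^ v * (p * (p ^ (k - Suc v) * N0))" by simp
  define N' where "N' = p * (p ^ (k - Suc v) * N0)"
  have "p ^ k \<le> N" using p N by (intro dvd_imp_le)
  then have "Suc j \<le> N" using Suc.prems by simp
  then have "p ^ v * i \<le> p ^ v * N'" using i(1) N' by (simp add: N'_def)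
  then have le: "i \<le> N'" using p(1) by (simp add: prime_gt_0_nat)
  have "p ^ v * (i * ((N - 1) choose Suc j)) = p ^ v * ((N' - i) * ((N - 1) choose j))"
  proof -
    have "Suc j * ((N - 1) choose Suc j) = (N - 1 - j) * ((N - 1) choose j)"
      using binomial_absorption[of j "N - 1"] binomial_absorb_comp[of "N - 1" j] by simp
    moreover have "N - 1 - j = p ^ v * (N' - i)"
      using i(1) N' by (simp add: N'_def diff_mult_distrib2)
    ultimately show ?thesis using i(1) by (simp add: mult.assoc)
  qed
  then have eq: "i * ((N - 1) choose Suc j) = (N' - i) * ((N - 1) choose j)"
    using p(1) by (simp add: prime_gt_0_nat)
  have "\<not> p dvd (N' - i)"
  proof
    assume "p dvd N' - i"
    moreover have "p dvd N'" by (simp add: N'_def)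
    ultimately have "p dvd i" using le by (meson dvd_diffD1)
    with i(2) show False by simp
  qed
  moreover have "\<not> p dvd ((N - 1) choose j)" using Suc by simp
  ultimately show ?case using eq p(1) by (metis dvd_mult prime_dvd_mult_iff)
qed

text \<open>Gives the exact exponents at the vertices of the Newton polygon. In Pascal's rule
  \<open>N choose p ^ m\<close> has exponent \<open>k - m\<close>, and the other term at least one
  more; for \<open>m = 0\<close> that other term would be \<open>N choose 0 = 1\<close>.\<close>

lemma binomial_Suc_prime_power:
  fixes p :: nat
  assumes p: "prime p" "\<not> p dvd N0" and m: "0 < m" "m \<le> k"
  obtains w where "(p ^ k * N0 + 1) choose (p ^ m) = p ^ (k - m) * w" "\<not> p dvd w"
proof -
  define N where "N = p ^ k * N0"
  have N: "N > 0" using p by (auto simp: N_def prime_gt_0_nat intro!: Nat.gr0I)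
  have p1: "p > 1" by (rule prime_gt_1_nat[OF p(1)])
  have pm: "p ^ m > 1" by (rule one_less_power[OF p1 m(1)])
  have N': "N = p ^ m * (p ^ (k - m) * N0)"
    using m by (simp add: N_def mult.assoc[symmetric] flip: power_add)
  have "p ^ m * (N choose p ^ m) = N * ((N - 1) choose (p ^ m - 1))"
    using p1 by (intro times_binomial_minus1_eq) simp
  then have "p ^ m * (N choose p ^ m) = p ^ m * (p ^ (k - m) * (N0 * ((N - 1) choose (p ^ m - 1))))"
    using N' by (metis mult.assoc)
  then have 1: "N choose p ^ m = p ^ (k - m) * (N0 * ((N - 1) choose (p ^ m - 1)))"
    using p1 by simp
  have "p ^ (k - (m - 1)) dvd (N choose (p ^ m - 1))"
    using p pm m by (intro prime_power_dvd_binomial) (auto simp: N_def)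
  moreover have "p ^ (k - (m - 1)) = p ^ (k - m) * p"
    using m by (simp add: Suc_diff_le flip: power_Suc2)
  ultimately have "p ^ (k - m) * p dvd (N choose (p ^ m - 1))" by simp
  then obtain x where "N choose (p ^ m - 1) = p ^ (k - m) * p * x" by (rule dvdE)
  then have 2: "N choose (p ^ m - 1) = p ^ (k - m) * (p * x)" by (simp only: mult.assoc)
  have "p ^ m \<le> p ^ k" using m p1 by (intro power_increasing) auto
  then have "\<not> p dvd ((N - 1) choose (p ^ m - 1))"
    using p N pm by (intro not_prime_dvd_binomial[of p k]) (auto simp: N_def)
  then have 3: "\<not> p dvd N0 * ((N - 1) choose (p ^ m - 1))"
    using p by (simp add: prime_dvd_mult_iff)
  have "(N + 1) choose (p ^ m) = (N choose (p ^ m - 1)) + (N choose p ^ m)"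
    using p1 choose_reduce_nat[of "N + 1" "p ^ m"] by simp
  also have "\<dots> = p ^ (k - m) * (p * x + N0 * ((N - 1) choose (p ^ m - 1)))"
    unfolding 1 2 by (simp only: distrib_left)
  finally show ?thesis using that[of "p * x + N0 * ((N - 1) choose (p ^ m - 1))"] 3
    by (simp add: N_def dvd_add_right_iff)
qed

lemma prime_power_dvd_binomial_Suc:
  fixes p :: nat
  assumes p: "prime p" "p ^ k dvd N" and l: "2 \<le> l" "l < p ^ Suc m"
  shows "p ^ (k - m) dvd ((N + 1) choose l)"
proof -
  have "(N + 1) choose l = (N choose (l - 1)) + (N choose l)"
    using l choose_reduce_nat[of "N + 1" l] by simp
  then show ?thesis
    using prime_power_dvd_binomial[OF p, of l m] prime_power_dvd_binomial[OF p, of "l - 1" m] l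
    by simp
qed

lemma power_3_gt_double: "2 \<le> d \<Longrightarrow> 2 * d + 1 < 3 ^ d" for d :: nat
  by (induction d rule: dec_induct) auto

lemma power_3_gt_Suc: "1 \<le> d \<Longrightarrow> d + 1 < 3 ^ d" for d :: nat
  by (induction d rule: dec_induct) auto

text \<open>Between consecutive powers of \<open>3\<close> the binomial coefficients stay above the lines through the
  vertices \<open>(3\<^sup>i, k - i)\<close> and \<open>(3\<^sup>i\<^sup>+\<^sup>1, k - i - 1)\<close>, respectively \<open>(0, k - j + 1)\<close> and
  \<open>(3\<^sup>j, k - j)\<close>.\<close>

lemma above_side:
  fixes i k l m :: nat
  assumes i: "i < k" and l: "3 ^ m \<le> l" "l \<noteq> 3 ^ i" "l \<noteq> 3 ^ Suc i"
  shows "2 * 3 ^ i * (k - Suc i) + 3 ^ Suc i < 2 * 3 ^ i * (k - m) + l"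
proof -
  have base: "2 * 3 ^ i * (k - Suc i) + 3 ^ Suc i = 2 * 3 ^ i * (k - i) + 3 ^ i"
  proof -
    have "k - i = Suc (k - Suc i)" using i by simp
    then show ?thesis by (simp add: algebra_simps)
  qed
  have pos: "(3::nat) ^ i > 0" by simp
  consider "m < i" | "m = i" | "m = Suc i" | "m \<ge> i + 2" by linarith
  then show ?thesis
  proof cases
    case 1
    then have "2 * 3 ^ i * (k - i + 1) \<le> 2 * 3 ^ i * (k - m)"
      using i by (intro mult_le_mono2) simp
    moreover have "2 * 3 ^ i * (k - i + 1) = 2 * 3 ^ i * (k - i) + 2 * (3::nat) ^ i" by simp
    ultimately show ?thesis unfolding base using pos by linarith
  next
    case 2
    then show ?thesis unfolding base using l by simp
  next
    case 3
    then show ?thesis using l by simp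
  next
    case 4
    define d where "d = m - i"
    \<comment> \<open>Only an inequality, since \<open>k - m\<close> is truncated to 0 for
      \<open>m > k\<close>.\<close>
    have "k - i \<le> (k - m) + d" using 4 by (simp add: d_def)
    then have "2 * 3 ^ i * (k - i) \<le> 2 * 3 ^ i * ((k - m) + d)" by (intro mult_le_mono2)
    also have "\<dots> = 2 * 3 ^ i * (k - m) + 3 ^ i * (2 * d)" by (simp add: algebra_simps)
    finally have "2 * 3 ^ i * (k - i) + 3 ^ i \<le> 2 * 3 ^ i * (k - m) + 3 ^ i * (2 * d + 1)"
      by (simp add: algebra_simps)
    also have "3 ^ i * (2 * d + 1) < 3 ^ i * 3 ^ d"
      using power_3_gt_double[of d] 4 by (intro mult_strict_left_mono) (auto simp: d_def)
    also have "3 ^ i * 3 ^ d = (3::nat) ^ m" using 4 by (simp add: d_def flip: power_add)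
    finally show ?thesis unfolding base using l by simp
  qed
qed

lemma above_first_side:
  fixes j k l m :: nat
  assumes j: "j \<le> k" and l: "3 ^ m \<le> l" "l \<noteq> 3 ^ j"
  shows "3 ^ j * (k - j) + 3 ^ j < 3 ^ j * (k - m) + l"
proof -
  have pos: "(3::nat) ^ m > 0" by simp
  consider "m < j" | "m = j" | "m > j" by linarith
  then show ?thesis
  proof cases
    case 1
    then have "3 ^ j * (k - j + 1) \<le> 3 ^ j * (k - m)"
      using j by (intro mult_le_mono2) simp
    moreover have "3 ^ j * (k - j + 1) = 3 ^ j * (k - j) + (3::nat) ^ j" by simp
    ultimately show ?thesis using pos l by linarith
  next
    case 2
    then show ?thesis using l by simp
  next
    case 3
    define d where "d = m - j"
    have "k - j \<le> (k - m) + d" using 3 by (simp add: d_def)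
    then have "3 ^ j * (k - j) \<le> 3 ^ j * ((k - m) + d)" by (intro mult_le_mono2)
    then have "3 ^ j * (k - j) + 3 ^ j \<le> 3 ^ j * (k - m) + 3 ^ j * (d + 1)"
      by (simp add: algebra_simps)
    also have "3 ^ j * (d + 1) < 3 ^ j * 3 ^ d"
      using power_3_gt_Suc[of d] 3 by (intro mult_strict_left_mono) (auto simp: d_def)
    also have "3 ^ j * 3 ^ d = (3::nat) ^ m" using 3 by (simp add: d_def flip: power_add)
    finally show ?thesis using l by simp
  qed
qed

section \<open>Branches of the trinomial\<close>

lemma not_3_dvd_power_2: "\<not> (3::nat) dvd 2 ^ s"
proof
  assume "(3::nat) dvd 2 ^ s"
  moreover have "prime (3::nat)" by simp
  ultimately have "(3::nat) dvd 2" using prime_dvd_power by blast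
  then show False by simp
qed

lemma trinomial_eq_0_iff: "ipoly (trinomial n a b) x = 0 \<longleftrightarrow> x ^ n + of_int a * x + of_int b = 0"
proof -
  have "ipoly (trinomial n a b) x = x ^ n + of_int a * x + of_int b"
    by (simp add: trinomial_def of_int_poly_hom.hom_add map_poly_monom poly_monom
        of_int_hom.map_poly_pCons_hom algebra_simps)
  then show ?thesis by simp
qed

context valuation_ring
begin

text \<open>A root \<open>x\<close> near \<open>\<zeta>\<close> together with data of the prime it
  defines: \<open>e\<close> is the denominator of the slope, and the last clause places the residue
  field inside that of \<open>q\<close> elements. For \<open>e = 1\<close> the exact distance from
  \<open>\<zeta>\<close> is left open, as \<open>unramified_branch\<close> does not determine
  it.\<close>

definition branch :: "int poly \<Rightarrow> nat \<Rightarrow> complex \<Rightarrow> nat \<Rightarrow> complex \<Rightarrow> bool" where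
  "branch F q \<zeta> e x \<longleftrightarrow> ipoly F x = 0 \<and> e > 0 \<and> (x - \<zeta>) ^ e / 3 \<in> V \<and>
     (e > 1 \<longrightarrow> (x - \<zeta>) ^ e / 3 \<notin> M) \<and> (\<forall>r. rpoly r x \<in> V \<longrightarrow> rpoly r x ^ q - rpoly r x \<in> M)"

lemma of_nat_M: "of_nat d \<in> M \<longleftrightarrow> 3 dvd d"
  using of_int_M[of "int d"] by (simp add: int_dvd_int_iff[of 3 d, simplified, symmetric])

text \<open>Modulo 3 the trinomial has 0 as a simple root, so \<open>unramified_branch\<close>
  applies to it directly with \<open>H = 0\<close>.\<close>

lemma branch_at_zero:
  assumes a: "\<not> 3 dvd a" and b: "3 dvd b" and n: "n \<ge> 2"
  obtains x where "branch (trinomial n a b) 3 0 1 x"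
proof -
  define p :: "complex poly" where "p = monom 1 n + [:of_int b, of_int a:]"
  obtain b' where b': "b = 3 * b'" using b by auto
  define c :: "nat \<Rightarrow> complex" where
    "c l = (if l = 0 then of_int b' else if l = 1 then of_int a else if l = n then 1 else 0)" for l
  obtain t where t: "poly p t = 0" "t / 3 \<in> V"
    "\<And>r. rpoly r (0 + t) \<in> V \<Longrightarrow> rpoly r (0 + t) ^ 3 - rpoly r (0 + t) \<in> M"
  proof (rule unramified_branch[of 0 3 p "\<lambda>l. if l = 0 then 1 else 0" c 0])
    show "coeff p l = 3 ^ (if l = 0 then 1 else 0) * c l" for l
      using n by (auto simp: p_def c_def b' coeff_pCons split: nat.split)
    show "c l \<in> loc {0}" for l by (auto simp: c_def loc_intros)
    show "c 1 \<notin> M" using a by (simp add: c_def of_int_M)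
  qed (auto intro: V_intros)
  have "ipoly (trinomial n a b) t = 0"
    using t(1) by (simp add: trinomial_eq_0_iff p_def poly_monom algebra_simps)
  then show ?thesis using t(2,3) that[of t] by (simp add: branch_def)
qed

end

text \<open>The Newton polygon of \<open>F(\<zeta> + T)\<close> for the trinomial \<open>F\<close> of degree \<open>2\<^sup>s 3\<^sup>k + 1\<close> and a root \<open>\<zeta>\<close>
  of \<open>x\<^bsup>2^s\<^esup> + \<epsilon>\<close>, \<open>\<epsilon> = \<plusminus>1\<close>; modulo \<open>3\<close>, \<open>F\<close> is a product of \<open>x\<close> and a power of \<open>x\<^bsup>2^s\<^esup> + \<epsilon>\<close>.\<close>

locale trinomial_near_root = valuation_ring +
  fixes s k :: nat and a b \<epsilon> :: int and \<zeta> :: complex and q :: nat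
  assumes \<epsilon>: "\<epsilon> = 1 \<or> \<epsilon> = -1" and root: "\<zeta> ^ (2 ^ s) = - of_int \<epsilon>"
    and q: "q \<in> {3, 9}" and frob: "\<zeta> ^ q = \<zeta>"
begin

definition N :: nat where "N = 2 ^ s * 3 ^ k"

abbreviation F :: "int poly" where "F \<equiv> trinomial (N + 1) a b"

lemma \<zeta>_V: "\<zeta> \<in> V"
proof -
  have "\<zeta> ^ (2 ^ s * 2) = 1" using \<epsilon> unfolding power_mult root by auto
  then show ?thesis by (rule root_of_unity_V) simp
qed

lemma \<zeta>_M: "\<zeta> \<notin> M"
proof
  assume "\<zeta> \<in> M"
  then have "\<zeta> ^ (2 ^ s) \<in> M" using M_power[OF \<zeta>_V, of "2 ^ s"] by simp
  then show False unfolding root using M_1 \<epsilon> M_uminus_iff[of 1] by auto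
qed

lemma \<zeta>_N: "\<zeta> ^ N = - of_int \<epsilon>"
proof -
  have "odd ((3::nat) ^ k)" by simp
  then show ?thesis using \<epsilon> unfolding N_def power_mult root by auto
qed

lemma \<zeta>_loc: "\<zeta> \<in> loc {\<zeta>}"
  by (simp add: loc.gen)

lemma dvd_N: "3 ^ k dvd N"
  by (simp add: N_def)

text \<open>If \<open>3 ^ (k + 1)\<close> divides \<open>a - \<epsilon>\<close>, the linear Taylor
  coefficient is \<open>3 ^ k\<close> times a number of this shape, hence has exponent exactly
  \<open>k\<close>.\<close>

lemma linear_coefficient_unit: "\<not> 3 dvd 3 * x - \<epsilon> * 2 ^ s"
proof
  assume "3 dvd 3 * x - \<epsilon> * 2 ^ s"
  then have "3 dvd \<epsilon> * 2 ^ s" by (simp add: dvd_diff_right_iff)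
  then have "3 dvd (2 ^ s :: int)" using \<epsilon> by auto
  then have "int 3 dvd int (2 ^ s)" by simp
  then show False using not_3_dvd_power_2 by (simp only: int_dvd_int_iff)
qed

text \<open>Values at \<open>0\<close> and \<open>1\<close> of the exponents and cofactors of the Taylor coefficients are parameters,
  because their valuations depend on \<open>a\<close> and \<open>b\<close>.\<close>

lemma taylor:
  assumes d0: "of_int (a - \<epsilon>) * \<zeta> + of_int b = 3 ^ h0 * d0" "d0 \<in> loc {\<zeta>}"
    and d1: "a - \<epsilon> - \<epsilon> * int N = 3 ^ h1 * d1"
  obtains p :: "complex poly" and h :: "nat \<Rightarrow> nat" and c :: "nat \<Rightarrow> complex" and m :: "nat \<Rightarrow> nat"
  where "\<And>l. coeff p l = 3 ^ h l * c l" "\<And>l. c l \<in> loc {\<zeta>}"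
    "h 0 = h0" "c 0 = d0" "h 1 = h1" "c 1 = of_int d1"
    "\<And>l. l \<ge> 2 \<Longrightarrow> h l = k - m l" "\<And>l. l \<ge> 2 \<Longrightarrow> 3 ^ m l \<le> l"
    "\<And>j. 1 \<le> j \<Longrightarrow> j \<le> k \<Longrightarrow> h (3 ^ j) = k - j" "\<And>j. 1 \<le> j \<Longrightarrow> j \<le> k \<Longrightarrow> c (3 ^ j) \<notin> M"
    "\<And>t. poly p t = 0 \<Longrightarrow> ipoly F (\<zeta> + t) = 0"
proof -
  define p :: "complex poly" where "p = [:\<zeta>, 1:] ^ (N + 1) + [:of_int a * \<zeta> + of_int b, of_int a:]"
  have "\<exists>m. 3 ^ m \<le> l \<and> l < 3 ^ Suc m" if "l \<ge> 2" for l :: nat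
    using ex_power_ivl1[of 3 l] that by simp
  \<comment> \<open>\<open>m l\<close> is the integer part of the base 3 logarithm of
    \<open>l\<close>; \<open>k - m l\<close> bounds the exponent of 3 from below and is attained at
    powers of 3.\<close>
  then obtain m where m: "\<And>l::nat. l \<ge> 2 \<Longrightarrow> 3 ^ m l \<le> l \<and> l < 3 ^ Suc (m l)"
    by metis
  define h where "h l = (if l = 0 then h0 else if l = 1 then h1 else k - m l)" for l
  define c where "c l = (if l = 0 then d0 else if l = 1 then of_int d1
    else of_nat (((N + 1) choose l) div 3 ^ h l) * \<zeta> ^ (N + 1 - l))" for l
  have ndvd: "3 ^ h l * (((N + 1) choose l) div 3 ^ h l) = (N + 1) choose l" if "l \<ge> 2" for l
  proof -
    have "3 ^ (k - m l) dvd ((N + 1) choose l)"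
      using m[OF that] that by (intro prime_power_dvd_binomial_Suc dvd_N) auto
    then show ?thesis using that by (simp add: h_def)
  qed
  have lin: "coeff ([:\<zeta>, 1:] ^ n) l = of_nat (n choose l) * \<zeta> ^ (n - l)" for n l
    by (cases "l \<le> n") (simp_all add: coeff_linear_poly_power coeff_eq_0 degree_linear_power binomial_eq_0)
  have p: "coeff p l = of_nat ((N + 1) choose l) * \<zeta> ^ (N + 1 - l) +
      coeff [:of_int a * \<zeta> + of_int b, of_int a:] l" for l
    by (simp only: p_def coeff_add lin)
  have 1: "coeff p l = 3 ^ h l * c l" for l
  proof -
    consider "l = 0" | "l = 1" | "l \<ge> 2" by linarith
    then show ?thesis
    proof cases
      case 1
      have "coeff p l = of_int (a - \<epsilon>) * \<zeta> + of_int b"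
        unfolding p 1 by (simp add: \<zeta>_N algebra_simps)
      then show ?thesis using d0 1 by (simp add: h_def c_def)
    next
      case 2
      have "coeff p l = of_int (a - \<epsilon> - \<epsilon> * int N)"
        unfolding p 2 by (simp add: \<zeta>_N algebra_simps)
      then show ?thesis unfolding d1 using 2 by (simp add: h_def c_def)
    next
      case 3
      have "coeff p l = of_nat (3 ^ h l * (((N + 1) choose l) div 3 ^ h l)) * \<zeta> ^ (N + 1 - l)"
        unfolding p ndvd[OF 3] using 3 by (simp add: coeff_pCons split: nat.split)
      then show ?thesis using 3 by (simp add: c_def)
    qed
  qed
  have 2: "c l \<in> loc {\<zeta>}" for l
    using d0(2) \<zeta>_loc by (simp add: c_def loc_intros)
  have 3: "h (3 ^ j) = k - j \<and> c (3 ^ j) \<notin> M" if j: "1 \<le> j" "j \<le> k" for j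
  proof -
    have ge: "(3::nat) ^ j \<ge> 2" using power_increasing[OF j(1), of "3::nat"] by simp
    have "m (3 ^ j) \<le> j"
      by (rule power_le_imp_le_exp[OF _ conjunct1[OF m[OF ge]]]) simp
    moreover have "j < Suc (m (3 ^ j))"
      by (rule power_less_imp_less_exp[OF _ conjunct2[OF m[OF ge]]]) simp
    ultimately have "m (3 ^ j) = j" by simp
    then have hj: "h (3 ^ j) = k - j" using ge by (auto simp: h_def)
    obtain w where w: "(3 ^ k * 2 ^ s + 1) choose (3 ^ j) = 3 ^ (k - j) * w" "\<not> 3 dvd w"
      using binomial_Suc_prime_power[of 3 "2 ^ s" j k] not_3_dvd_power_2 j by auto
    have "((N + 1) choose 3 ^ j) div 3 ^ h (3 ^ j) = w"
      using w(1) by (simp add: hj N_def mult.commute)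
    then have "c (3 ^ j) = of_nat w * \<zeta> ^ (N + 1 - 3 ^ j)"
      using ge by (auto simp: c_def)
    moreover have "\<zeta> ^ i \<notin> M" for i
      using M_power[OF \<zeta>_V, of i] \<zeta>_M M_1 by (cases i) auto
    moreover have "of_nat w \<notin> M" using w(2) by (simp add: of_nat_M)
    ultimately have "c (3 ^ j) \<notin> M" using unit_mult by simp
    with hj show ?thesis by simp
  qed
  have 4: "ipoly F (\<zeta> + t) = 0" if "poly p t = 0" for t
    using that by (simp add: trinomial_eq_0_iff p_def poly_power algebra_simps)
  show ?thesis
  proof (rule that[OF 1 2])
    show "h 0 = h0" "c 0 = d0" "h 1 = h1" "c 1 = of_int d1" by (simp_all add: h_def c_def)
    show "h l = k - m l" "3 ^ m l \<le> l" if "l \<ge> 2" for l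
      using that m by (simp_all add: h_def)
    show "h (3 ^ j) = k - j" "c (3 ^ j) \<notin> M" if "1 \<le> j" "j \<le> k" for j
      using 3 that by blast+
  qed (rule 4)
qed

text \<open>The side from \<open>(3 ^ i, k - i)\<close> to \<open>(3 ^ Suc i, k - Suc i)\<close>.
  The divisibility keeps the points over 0 and 1 above its line, except that for
  \<open>i = 0\<close> the point over 1 is the left end, whose exponent must then be exact.\<close>

lemma side_branch:
  assumes i: "i < k" and a: "3 ^ (k - i + 1) dvd a - \<epsilon>" and b: "3 ^ (k - i + 1) dvd b"
  shows "\<exists>x. branch F q \<zeta> (2 * 3 ^ i) x"
proof -
  obtain a' b' where ab: "a - \<epsilon> = 3 ^ (k - i + 1) * a'" "b = 3 ^ (k - i + 1) * b'"
    using a b unfolding dvd_def by blast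
  define h1 where "h1 = (if i = 0 then k else k - i + 1)"
  have "\<exists>d1. a - \<epsilon> - \<epsilon> * int N = 3 ^ h1 * d1 \<and> (i = 0 \<longrightarrow> \<not> 3 dvd d1)"
  proof (cases "i = 0")
    case True
    have "a - \<epsilon> - \<epsilon> * int N = 3 ^ h1 * (3 * a' - \<epsilon> * 2 ^ s)"
      using True unfolding ab by (simp add: h1_def N_def algebra_simps)
    then show ?thesis using linear_coefficient_unit by blast
  next
    case False
    then have "k = (k - i + 1) + (i - 1)" using i by simp
    then have "(3::int) ^ k = 3 ^ (k - i + 1) * 3 ^ (i - 1)" by (metis power_add)
    then have "a - \<epsilon> - \<epsilon> * int N = 3 ^ h1 * (a' - \<epsilon> * (2 ^ s * 3 ^ (i - 1)))"
      unfolding ab using False by (simp add: h1_def N_def algebra_simps)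
    then show ?thesis using False by blast
  qed
  then obtain d1 where d1: "a - \<epsilon> - \<epsilon> * int N = 3 ^ h1 * d1" "i = 0 \<Longrightarrow> \<not> 3 dvd d1" by auto
  define d0 where "d0 = of_int a' * \<zeta> + of_int b'"
  have d0: "of_int (a - \<epsilon>) * \<zeta> + of_int b = 3 ^ (k - i + 1) * d0" "d0 \<in> loc {\<zeta>}"
    unfolding ab d0_def using \<zeta>_loc by (simp_all add: algebra_simps loc_intros)
  from d0 d1(1) obtain p h c m where T:
    "\<And>l. coeff p l = 3 ^ h l * c l" "\<And>l. c l \<in> loc {\<zeta>}"
    "h 0 = k - i + 1" "c 0 = d0" "h 1 = h1" "c 1 = of_int d1"
    "\<And>l. l \<ge> 2 \<Longrightarrow> h l = k - m l" "\<And>l. l \<ge> 2 \<Longrightarrow> 3 ^ m l \<le> l"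
    "\<And>j. 1 \<le> j \<Longrightarrow> j \<le> k \<Longrightarrow> h (3 ^ j) = k - j" "\<And>j. 1 \<le> j \<Longrightarrow> j \<le> k \<Longrightarrow> c (3 ^ j) \<notin> M"
    "\<And>t. poly p t = 0 \<Longrightarrow> ipoly F (\<zeta> + t) = 0"
    by (rule taylor) blast
  have vertex: "3 ^ Suc i - 2 * 3 ^ i = (3::nat) ^ i" by simp
  have start: "h (3 ^ i) = Suc (k - Suc i) \<and> c (3 ^ i) \<notin> M"
  proof (cases "i = 0")
    case True
    then show ?thesis using T(5,6) d1(2) i of_int_M by (auto simp: h1_def)
  next
    case False
    then show ?thesis using T(9,10)[of i] i by simp
  qed
  obtain t where t: "poly p t = 0" "t ^ (2 * 3 ^ i) / 3 \<in> V" "t ^ (2 * 3 ^ i) / 3 \<notin> M"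
    "\<And>r. rpoly r (\<zeta> + t) \<in> V \<Longrightarrow> rpoly r (\<zeta> + t) ^ q - rpoly r (\<zeta> + t) \<in> M"
  proof (rule ramified_branch[OF \<zeta>_V frob q T(1,2), of "2 * 3 ^ i" "3 ^ Suc i" "k - Suc i"])
    show "h (3 ^ Suc i) = k - Suc i" "c (3 ^ Suc i) \<notin> M"
      using T(9,10)[of "Suc i"] i by auto
    show "h (3 ^ Suc i - 2 * 3 ^ i) = Suc (k - Suc i)" "c (3 ^ Suc i - 2 * 3 ^ i) \<notin> M"
      unfolding vertex using start by auto
    fix l :: nat assume l: "l \<noteq> 3 ^ Suc i" "l \<noteq> 3 ^ Suc i - 2 * 3 ^ i" "c l \<noteq> 0"
    have base: "2 * 3 ^ i * (k - Suc i) + 3 ^ Suc i = 2 * 3 ^ i * (k - i) + (3::nat) ^ i"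
    proof -
      have "k - i = Suc (k - Suc i)" using i by simp
      then show ?thesis by (simp add: algebra_simps)
    qed
    have top: "2 * 3 ^ i * (k - i + 1) = 2 * 3 ^ i * (k - i) + 2 * (3::nat) ^ i" by simp
    have pos: "(3::nat) ^ i > 0" by simp
    consider "l = 0" | "l = 1" | "l \<ge> 2" by linarith
    then show "2 * 3 ^ i * (k - Suc i) + 3 ^ Suc i < 2 * 3 ^ i * h l + l"
    proof cases
      case 1
      then show ?thesis unfolding base using T(3) top pos by simp
    next
      case 2
      then have "i \<noteq> 0" using l(2) vertex by (cases i) auto
      then show ?thesis unfolding base 2 T(5) h1_def using top pos by simp
    next
      case 3
      show ?thesis unfolding T(7)[OF 3]
        by (rule above_side[OF i T(8)[OF 3]]) (use l vertex in auto)
    qed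
  qed auto
  then have "branch F q \<zeta> (2 * 3 ^ i) (\<zeta> + t)"
    using T(11) by (simp add: branch_def)
  then show ?thesis by blast
qed

text \<open>The leftmost side, from \<open>(0, k - j + 1)\<close> to \<open>(3 ^ j, k - j)\<close>.
  The unit condition makes the exponent of the constant coefficient, which is
  \<open>(a - \<epsilon>) \<zeta> + b\<close>, exact.\<close>

lemma first_branch:
  assumes j: "1 \<le> j" "j \<le> k"
    and a: "a - \<epsilon> = 3 ^ (k - j + 1) * a'" and b: "b = 3 ^ (k - j + 1) * b'"
    and unit: "of_int a' * \<zeta> + of_int b' \<notin> M"
  shows "\<exists>x. branch F q \<zeta> (3 ^ j) x"
proof -
  have "k = (k - j + 1) + (j - 1)" using j by simp
  then have "(3::int) ^ k = 3 ^ (k - j + 1) * 3 ^ (j - 1)" by (metis power_add)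
  then have d1: "a - \<epsilon> - \<epsilon> * int N = 3 ^ (k - j + 1) * (a' - \<epsilon> * (2 ^ s * 3 ^ (j - 1)))"
    unfolding a by (simp add: N_def algebra_simps)
  define d0 where "d0 = of_int a' * \<zeta> + of_int b'"
  have d0: "of_int (a - \<epsilon>) * \<zeta> + of_int b = 3 ^ (k - j + 1) * d0" "d0 \<in> loc {\<zeta>}"
    unfolding a b d0_def using \<zeta>_loc by (simp_all add: algebra_simps loc_intros)
  from d0 d1 obtain p h c m where T:
    "\<And>l. coeff p l = 3 ^ h l * c l" "\<And>l. c l \<in> loc {\<zeta>}"
    "h 0 = k - j + 1" "c 0 = d0" "h 1 = k - j + 1"
    "\<And>l. l \<ge> 2 \<Longrightarrow> h l = k - m l" "\<And>l. l \<ge> 2 \<Longrightarrow> 3 ^ m l \<le> l"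
    "\<And>j. 1 \<le> j \<Longrightarrow> j \<le> k \<Longrightarrow> h (3 ^ j) = k - j" "\<And>j. 1 \<le> j \<Longrightarrow> j \<le> k \<Longrightarrow> c (3 ^ j) \<notin> M"
    "\<And>t. poly p t = 0 \<Longrightarrow> ipoly F (\<zeta> + t) = 0"
    by (rule taylor) blast
  have top: "3 ^ j * (k - j + 1) = 3 ^ j * (k - j) + (3::nat) ^ j" by simp
  obtain t where t: "poly p t = 0" "t ^ (3 ^ j) / 3 \<in> V" "t ^ (3 ^ j) / 3 \<notin> M"
    "\<And>r. rpoly r (\<zeta> + t) \<in> V \<Longrightarrow> rpoly r (\<zeta> + t) ^ q - rpoly r (\<zeta> + t) \<in> M"
  proof (rule ramified_branch[OF \<zeta>_V frob q T(1,2), of "3 ^ j" "3 ^ j" "k - j"])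
    show "h (3 ^ j) = k - j" "c (3 ^ j) \<notin> M" using T(8,9) j by auto
    show "h (3 ^ j - 3 ^ j) = Suc (k - j)" "c (3 ^ j - 3 ^ j) \<notin> M"
      using T(3,4) unit by (auto simp: d0_def)
    fix l :: nat assume l: "l \<noteq> 3 ^ j" "l \<noteq> 3 ^ j - 3 ^ j" "c l \<noteq> 0"
    consider "l = 1" | "l \<ge> 2" using l by linarith
    then show "3 ^ j * (k - j) + 3 ^ j < 3 ^ j * h l + l"
    proof cases
      case 1
      show ?thesis unfolding 1 T(5) top by simp
    next
      case 2
      show ?thesis unfolding T(6)[OF 2]
        by (rule above_first_side[OF j(2) T(7)[OF 2] l(1)])
    qed
  qed auto
  then have "branch F q \<zeta> (3 ^ j) (\<zeta> + t)"
    using T(10) by (simp add: branch_def)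
  then show ?thesis by blast
qed

text \<open>The linear coefficient has exponent exactly \<open>k\<close> and the constant one at
  least \<open>k + 1\<close>: the situation of \<open>unramified_branch\<close> with
  \<open>H = k\<close>.\<close>

lemma simple_branch:
  assumes a: "3 ^ (k + 1) dvd a - \<epsilon>" and b: "3 ^ (k + 1) dvd b"
  shows "\<exists>x. branch F q \<zeta> 1 x"
proof -
  obtain a' b' where ab: "a - \<epsilon> = 3 ^ (k + 1) * a'" "b = 3 ^ (k + 1) * b'"
    using a b unfolding dvd_def by blast
  have d1: "a - \<epsilon> - \<epsilon> * int N = 3 ^ k * (3 * a' - \<epsilon> * 2 ^ s)"
    unfolding ab by (simp add: N_def algebra_simps)
  define d0 where "d0 = of_int a' * \<zeta> + of_int b'"
  have d0: "of_int (a - \<epsilon>) * \<zeta> + of_int b = 3 ^ (k + 1) * d0" "d0 \<in> loc {\<zeta>}"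
    unfolding ab d0_def using \<zeta>_loc by (simp_all add: algebra_simps loc_intros)
  from d0 d1 obtain p h c m where T:
    "\<And>l. coeff p l = 3 ^ h l * c l" "\<And>l. c l \<in> loc {\<zeta>}"
    "h 0 = k + 1" "c 0 = d0" "h 1 = k" "c 1 = of_int (3 * a' - \<epsilon> * 2 ^ s)"
    "\<And>l. l \<ge> 2 \<Longrightarrow> h l = k - m l" "\<And>l. l \<ge> 2 \<Longrightarrow> 3 ^ m l \<le> l"
    "\<And>t. poly p t = 0 \<Longrightarrow> ipoly F (\<zeta> + t) = 0"
    by (rule taylor) blast
  obtain t where t: "poly p t = 0" "t / 3 \<in> V"
    "\<And>r. rpoly r (\<zeta> + t) \<in> V \<Longrightarrow> rpoly r (\<zeta> + t) ^ q - rpoly r (\<zeta> + t) \<in> M"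
  proof (rule unramified_branch[OF \<zeta>_V frob q T(1,2), of k])
    show "c 1 \<notin> M" unfolding T(6) of_int_M by (rule linear_coefficient_unit)
    fix l :: nat assume l: "l \<ge> 2"
    have "m l + 1 < l"
    proof (cases "m l = 0")
      case False
      then show ?thesis using power_3_gt_Suc[of "m l"] T(8)[OF l] by linarith
    qed (use l in simp)
    then show "Suc k < h l + l" using T(7)[OF l] by simp
  qed (use T in auto)
  then have "branch F q \<zeta> 1 (\<zeta> + t)"
    using T(9) by (simp add: branch_def)
  then show ?thesis by blast
qed

end

section \<open>Counting residues\<close>

lemma monic_trinomial:
  assumes "n \<ge> 2"
  shows "lead_coeff (trinomial n a b) = 1"
proof -
  have "degree (trinomial n a b) = n"
    unfolding trinomial_def using assms by (subst degree_add_eq_left) (auto simp: degree_monom_eq)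
  then show ?thesis using assms by (auto simp: trinomial_def coeff_pCons split: nat.split)
qed

context valuation_ring
begin

text \<open>The cofactor is \<open>m y ^ (m - 1)\<close> modulo \<open>M\<close>, a unit because 3
  does not divide \<open>m\<close>. With \<open>m = 2 ^ s\<close> the distance of a root from
  \<open>\<zeta>\<close> is measured by \<open>\<theta> ^ (2 ^ s) - c\<close>, which lies in K
  although \<open>\<zeta>\<close> need not.\<close>

lemma power_diff_factor:
  assumes xy: "x \<in> V" "y \<in> V" "x - y \<in> M" "y \<notin> M" and m: "\<not> 3 dvd m"
  obtains w where "x ^ m - y ^ m = (x - y) * w" "w \<in> V" "w \<notin> M"
proof -
  define w where "w = (\<Sum>i<m. x ^ i * y ^ (m - Suc i))"
  have "m > 0" using m by (cases m) auto
  then obtain m' where m': "m = Suc m'" by (cases m) auto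
  have 1: "x ^ m - y ^ m = (x - y) * w"
    unfolding w_def by (simp add: power_diff_sumr2 mult.commute)
  have 2: "w \<in> V" unfolding w_def using xy by (intro V_intros)
  have 3: "x ^ i - y ^ i \<in> M" for i
    using poly_cong_M[of "monom 1 i" x y] xy by (simp add: poly_monom V_intros)
  have "w - of_nat m * y ^ m' = (\<Sum>i<m. (x ^ i - y ^ i) * y ^ (m - Suc i))"
  proof -
    have "(\<Sum>i<m. y ^ i * y ^ (m - Suc i)) = (\<Sum>i<m. y ^ m')"
      by (intro sum.cong) (auto simp: m' simp flip: power_add)
    then show ?thesis by (simp add: w_def left_diff_distrib sum_subtractf)
  qed
  also have "\<dots> \<in> M" using 3 xy by (intro M_sum M_mult) (auto intro: V_intros)
  finally have 4: "w - of_nat m * y ^ m' \<in> M" .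
  have "y ^ m' \<notin> M" using M_power[OF xy(2), of m'] xy(4) M_1 by (cases m') auto
  then have "of_nat m * y ^ m' \<notin> M" using m by (intro unit_mult) (simp_all add: of_nat_M)
  then have "w \<notin> M" using M_diff[OF _ 4, of w] by auto
  with 1 2 that show ?thesis by blast
qed

lemma cube_minus_self_M:
  assumes "x \<in> V" "x - of_int d \<in> M"
  shows "x ^ 3 - x \<in> M"
proof -
  have "3 dvd d ^ 3 - d"
  proof -
    have "3 dvd d \<or> 3 dvd d - 1 \<or> 3 dvd d + 1" by presburger
    then have "3 dvd d * (d - 1) * (d + 1)" by auto
    then show ?thesis by (simp add: algebra_simps power3_eq_cube)
  qed
  then have 1: "of_int (d ^ 3 - d) \<in> M" unfolding of_int_M .
  have 2: "x ^ 3 - of_int d ^ 3 \<in> M"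
    using poly_cong_M[of "monom 1 3" x "of_int d"] assms by (simp add: poly_monom V_intros)
  from M_diff[OF M_add[OF 2 1] assms(2)] show ?thesis by simp
qed

text \<open>The residue of \<open>x\<close> is outside the prime field, so it is linearly
  independent of 1 over the field of three elements. Concretely, \<open>a * a\<close> is 1 modulo 3
  when 3 does not divide \<open>a\<close>, and a relation would give \<open>x\<close> the residue of
  \<open>- (a * b)\<close>.\<close>

lemma unit_linear:
  assumes "x \<in> V" "x ^ 3 - x \<notin> M" "\<not> (3 dvd a \<and> 3 dvd b)"
  shows "of_int a * x + of_int b \<notin> M"
proof
  assume ab: "of_int a * x + of_int b \<in> M"
  show False
  proof (cases "3 dvd a")
    case True
    then have "of_int a * x + of_int b - of_int a * x \<in> M"
      using ab assms(1) by (intro M_diff M_mult) (auto simp: of_int_M)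
    then show False using True assms(3) by (simp add: of_int_M)
  next
    case False
    have "3 dvd a * a * b - b"
    proof -
      have "3 dvd a - 1 \<or> 3 dvd a + 1" using False by presburger
      then have "3 dvd (a - 1) * (a + 1)" by auto
      then have "3 dvd a * a - 1" by (simp add: algebra_simps)
      then have "3 dvd (a * a - 1) * b" by simp
      then show ?thesis by (simp add: algebra_simps)
    qed
    then have "of_int (a * a * b - b) \<in> M" unfolding of_int_M .
    then have "of_int (a * a * b - b) + (of_int a * x + of_int b) \<in> M" using ab by (rule M_add)
    then have "of_int a * (x - of_int (- (a * b))) \<in> M" by (simp add: algebra_simps)
    then have "x - of_int (- (a * b)) \<in> M"
      using M_mult_cancel[of "of_int a"] False by (simp add: of_int_M)
    then show False using cube_minus_self_M assms by blast
  qed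
qed

text \<open>Distinct branches have distinct residues of \<open>\<eta>\<close>: those at different \<open>\<zeta>\<close> are told apart by
  \<open>\<theta>\<close>, those at the same \<open>\<zeta>\<close> with ramification \<open>e < e'\<close> by \<open>(\<theta>\<^bsup>2^s\<^esup> - c)\<^bsup>e'\<^esup> / 3\<close>.\<close>

lemma branch_residues:
  assumes irr: "irreducible (map_poly rat_of_int (trinomial n a b))" and n: "n \<ge> 2"
    and \<theta>: "ipoly (trinomial n a b) \<theta> = 0" and mono: "monogenic (rat_adjoin \<theta>)"
    and c: "c = 1 \<or> c = -1"
    and X: "\<And>\<zeta> e. (\<zeta>, e) \<in> X \<Longrightarrow> \<zeta> = 0 \<and> e = 1 \<or> \<zeta> ^ (2 ^ s) = of_int c"
    and br: "\<And>\<zeta> e. (\<zeta>, e) \<in> X \<Longrightarrow> \<exists>x. branch (trinomial n a b) q \<zeta> e x"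
  obtains y where "inj_on y X" "\<And>z. z \<in> X \<Longrightarrow> y z \<in> V" "\<And>z. z \<in> X \<Longrightarrow> y z ^ q - y z \<in> M"
    "\<And>z z'. z \<in> X \<Longrightarrow> z' \<in> X \<Longrightarrow> y z - y z' \<in> M \<Longrightarrow> z = z'"
    "\<And>\<zeta> e d. (\<zeta>, e) \<in> X \<Longrightarrow> y (\<zeta>, e) - of_int d \<in> M \<Longrightarrow> \<zeta> ^ 3 - \<zeta> \<in> M"
proof -
  let ?F = "trinomial n a b"
  obtain g where g: "\<And>x. ipoly ?F x = 0 \<Longrightarrow> rpoly g x \<in> V"
    "\<And>x y. ipoly ?F x = 0 \<Longrightarrow> ipoly ?F y = 0 \<Longrightarrow> rpoly g x - rpoly g y \<in> M \<Longrightarrow> x - y \<in> M"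
    "\<And>x c. ipoly ?F x = 0 \<Longrightarrow> rpoly g x - of_int c \<in> M \<Longrightarrow> \<exists>d. x - of_int d \<in> M"
    "\<And>x y r. ipoly ?F x = 0 \<Longrightarrow> ipoly ?F y = 0 \<Longrightarrow> rpoly g x - rpoly g y \<in> M \<Longrightarrow>
      rpoly r x \<in> M \<Longrightarrow> rpoly r y \<in> M"
    using power_basis_embeddings[OF irr monic_trinomial[OF n] \<theta> mono] by blast
  obtain x where x: "\<And>\<zeta> e. (\<zeta>, e) \<in> X \<Longrightarrow> branch ?F q \<zeta> e (x \<zeta> e)"
    using br by metis
  have root: "ipoly ?F (x \<zeta> e) = 0" if "(\<zeta>, e) \<in> X" for \<zeta> e
    using x[OF that] by (simp add: branch_def)
  have tM: "x \<zeta> e - \<zeta> \<in> M" if "(\<zeta>, e) \<in> X" for \<zeta> e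
  proof -
    have e: "(x \<zeta> e - \<zeta>) ^ e / 3 \<in> V" "e > 0" using x[OF that] by (auto simp: branch_def)
    from M_mult[OF M_3 e(1)] have "(x \<zeta> e - \<zeta>) ^ e \<in> M" by simp
    then show ?thesis using M_root e(2) by blast
  qed
  have unit: "\<zeta> \<in> V \<and> \<zeta> \<notin> M" if "\<zeta> ^ (2 ^ s) = of_int c" for \<zeta>
  proof -
    have "\<zeta> ^ (2 ^ s * 2) = 1" using c unfolding power_mult that by auto
    then have "\<zeta> \<in> V" by (rule root_of_unity_V) simp
    moreover have "of_int c \<notin> M" using c by (auto simp: of_int_M)
    ultimately show ?thesis using M_power[of \<zeta> "2 ^ s"] that by auto
  qed
  note two = not_3_dvd_power_2[of s]
  have \<zeta>V: "\<zeta> \<in> V" if "(\<zeta>, e) \<in> X" for \<zeta> e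
    using X[OF that] unit by (auto intro: V_intros)
  have xV: "x \<zeta> e \<in> V" if "(\<zeta>, e) \<in> X" for \<zeta> e
    using V_intros(6)[OF M_V[OF tM[OF that]] \<zeta>V[OF that]] by simp
  \<comment> \<open>Roots of unity of order prime to 3 stay distinct modulo \<open>M\<close>: by
    \<open>power_diff_factor\<close> their difference times a unit is 0.\<close>
  have same_\<zeta>: "\<zeta> = \<zeta>'" if z: "(\<zeta>, e) \<in> X" "(\<zeta>', e') \<in> X" and d: "\<zeta> - \<zeta>' \<in> M" for \<zeta> e \<zeta>' e'
  proof -
    consider "\<zeta> = 0" "\<zeta>' = 0" | "\<zeta> = 0" "\<zeta>' \<notin> M" | "\<zeta>' = 0" "\<zeta> \<notin> M"
      | "\<zeta> ^ (2 ^ s) = of_int c" "\<zeta>' ^ (2 ^ s) = of_int c"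
      using X[OF z(1)] X[OF z(2)] unit by blast
    then show ?thesis
    proof cases
      case 4
      obtain w where "\<zeta> ^ (2 ^ s) - \<zeta>' ^ (2 ^ s) = (\<zeta> - \<zeta>') * w" "w \<notin> M"
        using power_diff_factor[OF \<zeta>V[OF z(1)] \<zeta>V[OF z(2)] d _ two] unit[OF 4(2)] by blast
      then show ?thesis using 4 unit_nonzero by auto
    qed (use d M_uminus_iff[of \<zeta>'] in auto)
  qed
  have no_less: False if z: "(\<zeta>, e) \<in> X" "(\<zeta>, e') \<in> X" and lt: "e < e'"
    and cong: "rpoly g (x \<zeta> e) - rpoly g (x \<zeta> e') \<in> M" for \<zeta> e e'
  proof -
    have "e > 0" using x[OF z(1)] by (simp add: branch_def)
    then have e': "e' > 1" using lt by simp
    then have \<zeta>: "\<zeta> ^ (2 ^ s) = of_int c" using X[OF z(2)] by auto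
    \<comment> \<open>Rational coefficients, because \<open>\<zeta> ^ (2 ^ s)\<close> is the integer
      \<open>c\<close>. At the branch with index \<open>e'\<close> the value is a unit; at that with
      index \<open>e\<close> a factor \<open>(x \<zeta> e - \<zeta>) ^ (e' - e)\<close> is left
      over, so the value lies in \<open>M\<close>.\<close>
    define r :: "rat poly" where "r = smult (1 / 3) ((monom 1 (2 ^ s) - [:of_int c:]) ^ e')"
    have r: "rpoly r u = (u ^ (2 ^ s) - \<zeta> ^ (2 ^ s)) ^ e' / 3" for u
      unfolding \<zeta> by (simp add: r_def of_rat_hom.map_poly_hom_smult of_rat_poly.hom_power
          of_rat_poly.hom_minus map_poly_monom poly_monom of_rat_hom.map_poly_pCons_hom of_rat_divide)
    have factor: "\<exists>w. w \<in> V \<and> w \<notin> M \<and> rpoly r (x \<zeta> f) = w ^ e' * ((x \<zeta> f - \<zeta>) ^ e' / 3)"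
      if f: "(\<zeta>, f) \<in> X" for f
    proof -
      obtain w where w: "x \<zeta> f ^ (2 ^ s) - \<zeta> ^ (2 ^ s) = (x \<zeta> f - \<zeta>) * w" "w \<in> V" "w \<notin> M"
        using power_diff_factor[OF xV[OF f] \<zeta>V[OF f] tM[OF f] _ two] unit[OF \<zeta>] by blast
      then show ?thesis unfolding r w(1) by (auto simp: power_mult_distrib)
    qed
    obtain w where w: "w \<in> V" "rpoly r (x \<zeta> e) = w ^ e' * ((x \<zeta> e - \<zeta>) ^ e' / 3)"
      using factor[OF z(1)] by blast
    have "(x \<zeta> e - \<zeta>) ^ e' = (x \<zeta> e - \<zeta>) ^ e * (x \<zeta> e - \<zeta>) ^ (e' - e)"
      using lt by (simp flip: power_add)
    then have "(x \<zeta> e - \<zeta>) ^ e' / 3 = (x \<zeta> e - \<zeta>) ^ e / 3 * (x \<zeta> e - \<zeta>) ^ (e' - e)"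
      by simp
    also have "\<dots> \<in> M"
    proof (rule M_mult')
      show "(x \<zeta> e - \<zeta>) ^ e / 3 \<in> V" using x[OF z(1)] by (simp add: branch_def)
      show "(x \<zeta> e - \<zeta>) ^ (e' - e) \<in> M"
        using tM[OF z(1)] M_power[OF M_V[OF tM[OF z(1)]], of "e' - e"] lt by simp
    qed
    finally have "rpoly r (x \<zeta> e) \<in> M" unfolding w(2) using w(1) by (intro M_mult' V_intros)
    then have "rpoly r (x \<zeta> e') \<in> M" using g(4)[OF root[OF z(1)] root[OF z(2)] cong] by blast
    moreover obtain w' where w': "w' \<in> V" "w' \<notin> M"
      "rpoly r (x \<zeta> e') = w' ^ e' * ((x \<zeta> e' - \<zeta>) ^ e' / 3)"
      using factor[OF z(2)] by blast
    moreover have "w' ^ e' \<notin> M" using w' e' by (simp add: M_power)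
    moreover have "(x \<zeta> e' - \<zeta>) ^ e' / 3 \<notin> M" using x[OF z(2)] e' by (simp add: branch_def)
    ultimately show False using unit_mult by metis
  qed
  define y where "y z = rpoly g (x (fst z) (snd z))" for z
  have y_inj: "z = z'" if zz: "z \<in> X" "z' \<in> X" "y z - y z' \<in> M" for z z'
  proof -
    obtain \<zeta> e \<zeta>' e' where z: "z = (\<zeta>, e)" "z' = (\<zeta>', e')" by (metis surj_pair)
    have X': "(\<zeta>, e) \<in> X" "(\<zeta>', e') \<in> X" and yy: "rpoly g (x \<zeta> e) - rpoly g (x \<zeta>' e') \<in> M"
      using zz by (auto simp: z y_def)
    have "x \<zeta> e - x \<zeta>' e' \<in> M" using g(2)[OF root[OF X'(1)] root[OF X'(2)] yy] .
    from M_diff[OF M_add[OF this tM[OF X'(2)]] tM[OF X'(1)]] have "\<zeta> - \<zeta>' \<in> M" by simp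
    then have \<zeta>: "\<zeta> = \<zeta>'" using same_\<zeta> X' by blast
    have "\<not> e < e'" using no_less[of \<zeta> e e'] X' yy \<zeta> by auto
    moreover have "\<not> e' < e"
      using no_less[of \<zeta> e' e] X' yy \<zeta> M_uminus_iff[of "rpoly g (x \<zeta> e) - rpoly g (x \<zeta>' e')"] by auto
    ultimately show ?thesis using z \<zeta> by simp
  qed
  show ?thesis
  proof (rule that[of y])
    show "inj_on y X" using y_inj M_0 by (auto intro!: inj_onI)
    show "y z \<in> V" if "z \<in> X" for z
      using that root[of "fst z" "snd z"] g(1) by (simp add: y_def)
    then show "y z ^ q - y z \<in> M" if "z \<in> X" for z
      using that x[of "fst z" "snd z"] by (simp add: y_def branch_def)
    show "\<zeta> ^ 3 - \<zeta> \<in> M" if z: "(\<zeta>, e) \<in> X" and d: "y (\<zeta>, e) - of_int d \<in> M" for \<zeta> e d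
    proof -
      obtain d' where "x \<zeta> e - of_int d' \<in> M"
        using g(3)[OF root[OF z], of d] d by (auto simp: y_def)
      from M_diff[OF this tM[OF z]] have "\<zeta> - of_int d' \<in> M" by simp
      then show ?thesis using cube_minus_self_M[OF \<zeta>V[OF z]] by blast
    qed
  qed (use y_inj in auto)
qed

text \<open>The three residues are shared with the branch at 0, which always exists here and is not
  in \<open>X\<close> because \<open>c\<close> is not 0.\<close>

lemma card_branches_degree_1:
  assumes "irreducible (map_poly rat_of_int (trinomial n a b))" "n \<ge> 2"
    and "ipoly (trinomial n a b) \<theta> = 0" "monogenic (rat_adjoin \<theta>)"
    and "c = 1 \<or> c = -1" "\<not> 3 dvd a" "3 dvd b"
    and X: "finite X" "\<And>\<zeta> e. (\<zeta>, e) \<in> X \<Longrightarrow> \<zeta> ^ (2 ^ s) = of_int c"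
    and br: "\<And>\<zeta> e. (\<zeta>, e) \<in> X \<Longrightarrow> \<exists>x. branch (trinomial n a b) 3 \<zeta> e x"
  shows "card X \<le> 2"
proof -
  define X' where "X' = insert (0, 1) X"
  have X1: "\<zeta> = 0 \<and> e = 1 \<or> \<zeta> ^ (2 ^ s) = of_int c" if "(\<zeta>, e) \<in> X'" for \<zeta> e
    using that X(2) by (auto simp: X'_def)
  have X2: "\<exists>x. branch (trinomial n a b) 3 \<zeta> e x" if "(\<zeta>, e) \<in> X'" for \<zeta> e
    using that br branch_at_zero[OF assms(6,7,2)] unfolding X'_def by blast
  obtain y where y: "inj_on y X'" "\<And>z. z \<in> X' \<Longrightarrow> y z \<in> V" "\<And>z. z \<in> X' \<Longrightarrow> y z ^ 3 - y z \<in> M"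
    "\<And>z z'. z \<in> X' \<Longrightarrow> z' \<in> X' \<Longrightarrow> y z - y z' \<in> M \<Longrightarrow> z = z'"
    by (rule branch_residues[OF assms(1-5) X1 X2]) blast+
  have "card (y ` X') \<le> 3"
  proof (rule card_roots_of_frobenius)
    show "finite (y ` X')" using X(1) by (simp add: X'_def)
    show "y ` X' \<subseteq> V" using y(2) by blast
    show "u = v" if "u \<in> y ` X'" "v \<in> y ` X'" "u - v \<in> M" for u v
      using that y(4) by blast
    show "u ^ 3 - u \<in> M" if "u \<in> y ` X'" for u
      using that y(3) by blast
  qed simp
  moreover have "(0, 1) \<notin> X"
  proof
    assume "(0, 1) \<in> X"
    from X(2)[OF this] show False using assms(5) by (auto simp: power_0_left)
  qed
  ultimately show ?thesis using X(1) y(1) by (simp add: card_image X'_def)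
qed

text \<open>If the residue of \<open>\<eta>\<close> lay in the prime field, so would that of
  \<open>\<theta>\<close> and then that of \<open>\<zeta>\<close>. Hence the three prime field
  elements among the nine roots of \<open>X ^ 9 - X\<close> are not taken.\<close>

lemma card_branches_degree_2:
  assumes "irreducible (map_poly rat_of_int (trinomial n a b))" "n \<ge> 2"
    and "ipoly (trinomial n a b) \<theta> = 0" "monogenic (rat_adjoin \<theta>)"
    and "c = 1 \<or> c = -1"
    and X: "finite X" "\<And>\<zeta> e. (\<zeta>, e) \<in> X \<Longrightarrow> \<zeta> ^ (2 ^ s) = of_int c"
      "\<And>\<zeta> e. (\<zeta>, e) \<in> X \<Longrightarrow> \<zeta> ^ 3 - \<zeta> \<notin> M"
    and br: "\<And>\<zeta> e. (\<zeta>, e) \<in> X \<Longrightarrow> \<exists>x. branch (trinomial n a b) 9 \<zeta> e x"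
  shows "card X \<le> 6"
proof -
  have X1: "\<zeta> = 0 \<and> e = 1 \<or> \<zeta> ^ (2 ^ s) = of_int c" if "(\<zeta>, e) \<in> X" for \<zeta> e
    using that X(2) by auto
  obtain y where y: "inj_on y X" "\<And>z. z \<in> X \<Longrightarrow> y z \<in> V" "\<And>z. z \<in> X \<Longrightarrow> y z ^ 9 - y z \<in> M"
    "\<And>z z'. z \<in> X \<Longrightarrow> z' \<in> X \<Longrightarrow> y z - y z' \<in> M \<Longrightarrow> z = z'"
    "\<And>\<zeta> e d. (\<zeta>, e) \<in> X \<Longrightarrow> y (\<zeta>, e) - of_int d \<in> M \<Longrightarrow> \<zeta> ^ 3 - \<zeta> \<in> M"
    by (rule branch_residues[OF assms(1-5) X1 br]) blast+
  define P :: "complex set" where "P = of_int ` {0, 1, 2}"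
  have P: "card P = 3" "finite P" unfolding P_def by (subst card_image) (auto simp: inj_on_def)
  have yP: "y z - p \<notin> M" if zp: "z \<in> X" "p \<in> P" for z p
  proof -
    obtain \<zeta> e where z: "z = (\<zeta>, e)" by fastforce
    obtain d where "p = of_int d" using zp(2) by (auto simp: P_def)
    then show ?thesis using zp z y(5)[of \<zeta> e d] X(3)[of \<zeta> e] by blast
  qed
  have PP: "p = p'" if pp: "p \<in> P" "p' \<in> P" "p - p' \<in> M" for p p'
  proof -
    obtain d d' :: int where d: "p = of_int d" "p' = of_int d'" "d \<in> {0, 1, 2}" "d' \<in> {0, 1, 2}"
      using pp by (auto simp: P_def)
    have "of_int (d - d') \<in> M" using pp d by simp
    then have "3 dvd d - d'" unfolding of_int_M .
    then have "d = d'" using d(3,4) by auto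
    then show ?thesis using d by simp
  qed
  have "card (y ` X \<union> P) \<le> 9"
  proof (rule card_roots_of_frobenius)
    show "finite (y ` X \<union> P)" using X(1) P by simp
    show "y ` X \<union> P \<subseteq> V" using y(2) by (auto simp: P_def intro: V_intros)
    show "x ^ 9 - x \<in> M" if xx: "x \<in> y ` X \<union> P" for x
    proof -
      consider "x \<in> y ` X" | "x = of_int 0" | "x = of_int 1" | "x = of_int 2"
        using xx by (auto simp: P_def)
      then show ?thesis
      proof cases
        case 4
        have "(2::complex) ^ 9 - 2 = of_int 510" by simp
        moreover have "of_int 510 \<in> M" unfolding of_int_M by simp
        ultimately show ?thesis using 4 by simp
      qed (use y(3) M_0 in auto)
    qed
    fix u v assume uv: "u \<in> y ` X \<union> P" "v \<in> y ` X \<union> P" "u - v \<in> M"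
    then have vu: "v - u \<in> M" using M_uminus_iff[of "u - v"] by simp
    show "u = v" using uv vu y(4) yP PP by blast
  qed simp
  moreover have "y ` X \<inter> P = {}"
  proof -
    have "y z \<notin> P" if "z \<in> X" for z using yP[OF that, of "y z"] M_0 by auto
    then show ?thesis by auto
  qed
  ultimately show ?thesis
    using X(1) P y(1) by (simp add: card_Un_disjoint card_image)
qed

end

section \<open>The congruence conditions\<close>

text \<open>Replaces \<open>x\<close> and \<open>y\<close> by their residues, so that the finite
  lists of residue pairs can be checked entry by entry.\<close>

lemma dvd_residue_iff:
  fixes m n x y d e c :: int
  assumes "m dvd n"
  shows "m dvd d * x + e * y + c \<longleftrightarrow> m dvd d * (x mod n) + e * (y mod n) + c"
proof -
  define u v r t where "u = x div n" and "v = y div n" and "r = x mod n" and "t = y mod n"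
  have xy: "x = n * u + r" "y = n * v + t" by (simp_all add: u_def v_def r_def t_def)
  have "d * x + e * y + c = n * (d * u + e * v) + (d * r + e * t + c)"
    by (simp add: xy algebra_simps)
  then have "m dvd d * x + e * y + c \<longleftrightarrow> m dvd d * r + e * t + c"
    by (simp only: dvd_add_right_iff[OF dvd_mult2[OF assms]])
  then show ?thesis by (simp only: r_def t_def)
qed

lemma dvd_diff_of_cong: "[x = y] (mod n) \<Longrightarrow> m dvd n \<Longrightarrow> m dvd x - y" for x y m n :: int
  by (metis cong_iff_dvd_diff dvd_trans)

text \<open>For \<open>s = 0\<close> the excluded divisibilities concern the value of F at
  \<open>- \<epsilon>\<close>, which is \<open>b - \<epsilon> a + 1\<close>: it has exponent exactly
  3.\<close>

lemma condition_1_dvd: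
  fixes a b :: int
  assumes "(a mod 81, b mod 81) \<in> {1, 80} \<times> {27, 54} \<union> {26, 28, 53, 55} \<times> {0}"
  shows "27 dvd b \<and> (27 dvd a - 1 \<and> \<not> 81 dvd b - a + 1 \<or> 27 dvd a + 1 \<and> \<not> 81 dvd b + a + 1)"
proof -
  define r t where "r = a mod 81" and "t = b mod 81"
  have rt: "(r, t) \<in> {1, 80} \<times> {27, 54} \<union> {26, 28, 53, 55} \<times> {0}"
    using assms by (simp only: r_def t_def)
  have "27 dvd b \<longleftrightarrow> 27 dvd t"
    using dvd_residue_iff[of 27 81 1 b 0 a 0] by (simp add: r_def t_def)
  moreover have "27 dvd a - 1 \<longleftrightarrow> 27 dvd r - 1"
    using dvd_residue_iff[of 27 81 0 b 1 a "-1"] by (simp add: r_def t_def)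
  moreover have "27 dvd a + 1 \<longleftrightarrow> 27 dvd r + 1"
    using dvd_residue_iff[of 27 81 0 b 1 a 1] by (simp add: r_def t_def)
  moreover have "81 dvd b - a + 1 \<longleftrightarrow> 81 dvd t - r + 1"
    using dvd_residue_iff[of 81 81 1 b "-1" a 1] by (simp add: r_def t_def)
  moreover have "81 dvd b + a + 1 \<longleftrightarrow> 81 dvd t + r + 1"
    using dvd_residue_iff[of 81 81 1 b 1 a 1] by (simp add: r_def t_def)
  ultimately show ?thesis
    using rt by (elim UnE SigmaE insertE emptyE Pair_inject) (simp_all only:, simp_all)
qed

lemma condition_2_dvd:
  fixes a b :: int
  assumes "(a mod 243, b mod 243) \<in> {1, 242} \<times> {81, 162} \<union> {80, 82, 161, 163} \<times> {0}"
  shows "81 dvd b \<and> (81 dvd a - 1 \<or> 81 dvd a + 1)"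
proof -
  define r t where "r = a mod 243" and "t = b mod 243"
  have rt: "(r, t) \<in> {1, 242} \<times> {81, 162} \<union> {80, 82, 161, 163} \<times> {0}"
    using assms by (simp only: r_def t_def)
  have "81 dvd b \<longleftrightarrow> 81 dvd t"
    using dvd_residue_iff[of 81 243 1 b 0 a 0] by (simp add: r_def t_def)
  moreover have "81 dvd a - 1 \<longleftrightarrow> 81 dvd r - 1"
    using dvd_residue_iff[of 81 243 0 b 1 a "-1"] by (simp add: r_def t_def)
  moreover have "81 dvd a + 1 \<longleftrightarrow> 81 dvd r + 1"
    using dvd_residue_iff[of 81 243 0 b 1 a 1] by (simp add: r_def t_def)
  ultimately show ?thesis
    using rt by (elim UnE SigmaE insertE emptyE Pair_inject) (simp_all only:, simp_all)
qed

lemma condition_11_dvd: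
  fixes a b :: int
  assumes "(a mod 27, b mod 27) \<in> {8, 17, 26} \<times> {9, 18} \<union> {8, 17} \<times> {0}"
  shows "9 dvd a + 1 \<and> 9 dvd b \<and> \<not> (27 dvd a + 1 \<and> 27 dvd b)"
proof -
  define r t where "r = a mod 27" and "t = b mod 27"
  have rt: "(r, t) \<in> {8, 17, 26} \<times> {9, 18} \<union> {8, 17} \<times> {0}"
    using assms by (simp only: r_def t_def)
  have "9 dvd b \<longleftrightarrow> 9 dvd t"
    using dvd_residue_iff[of 9 27 1 b 0 a 0] by (simp add: r_def t_def)
  moreover have "27 dvd b \<longleftrightarrow> 27 dvd t"
    using dvd_residue_iff[of 27 27 1 b 0 a 0] by (simp add: r_def t_def)
  moreover have "9 dvd a + 1 \<longleftrightarrow> 9 dvd r + 1"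
    using dvd_residue_iff[of 9 27 0 b 1 a 1] by (simp add: r_def t_def)
  moreover have "27 dvd a + 1 \<longleftrightarrow> 27 dvd r + 1"
    using dvd_residue_iff[of 27 27 0 b 1 a 1] by (simp add: r_def t_def)
  ultimately show ?thesis
    using rt by (elim UnE SigmaE insertE emptyE Pair_inject) (simp_all only:, simp_all)
qed

lemma condition_15_dvd:
  fixes a b :: int
  assumes "(a mod 27, b mod 27) \<in> {1, 10, 19} \<times> {9, 18} \<union> {10, 19} \<times> {0}"
  shows "9 dvd a - 1 \<and> 9 dvd b \<and> \<not> (27 dvd a - 1 \<and> 27 dvd b)"
proof -
  define r t where "r = a mod 27" and "t = b mod 27"
  have rt: "(r, t) \<in> {1, 10, 19} \<times> {9, 18} \<union> {10, 19} \<times> {0}"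
    using assms by (simp only: r_def t_def)
  have "9 dvd b \<longleftrightarrow> 9 dvd t"
    using dvd_residue_iff[of 9 27 1 b 0 a 0] by (simp add: r_def t_def)
  moreover have "27 dvd b \<longleftrightarrow> 27 dvd t"
    using dvd_residue_iff[of 27 27 1 b 0 a 0] by (simp add: r_def t_def)
  moreover have "9 dvd a - 1 \<longleftrightarrow> 9 dvd r - 1"
    using dvd_residue_iff[of 9 27 0 b 1 a "-1"] by (simp add: r_def t_def)
  moreover have "27 dvd a - 1 \<longleftrightarrow> 27 dvd r - 1"
    using dvd_residue_iff[of 27 27 0 b 1 a "-1"] by (simp add: r_def t_def)
  ultimately show ?thesis
    using rt by (elim UnE SigmaE insertE emptyE Pair_inject) (simp_all only:, simp_all)
qed

lemma condition_6_dvd: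
  fixes a b :: int
  assumes "(a mod 81, b mod 81) \<in> {80} \<times> {27, 54} \<union> {26, 53} \<times> {0, 27, 54}"
  shows "27 dvd a + 1 \<and> 27 dvd b"
proof -
  define r t where "r = a mod 81" and "t = b mod 81"
  have rt: "(r, t) \<in> {80} \<times> {27, 54} \<union> {26, 53} \<times> {0, 27, 54}"
    using assms by (simp only: r_def t_def)
  have "27 dvd b \<longleftrightarrow> 27 dvd t"
    using dvd_residue_iff[of 27 81 1 b 0 a 0] by (simp add: r_def t_def)
  moreover have "27 dvd a + 1 \<longleftrightarrow> 27 dvd r + 1"
    using dvd_residue_iff[of 27 81 0 b 1 a 1] by (simp add: r_def t_def)
  ultimately show ?thesis
    using rt by (elim UnE SigmaE insertE emptyE Pair_inject) (simp_all only:, simp_all)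
qed

lemma condition_10_dvd:
  fixes a b :: int
  assumes "(a mod 243, b mod 243) \<in> {80, 161, 242} \<times> {81, 162} \<union> {80, 161} \<times> {0}"
  shows "27 dvd a + 1 \<and> 27 dvd b"
proof -
  define r t where "r = a mod 243" and "t = b mod 243"
  have rt: "(r, t) \<in> {80, 161, 242} \<times> {81, 162} \<union> {80, 161} \<times> {0}"
    using assms by (simp only: r_def t_def)
  have "27 dvd b \<longleftrightarrow> 27 dvd t"
    using dvd_residue_iff[of 27 243 1 b 0 a 0] by (simp add: r_def t_def)
  moreover have "27 dvd a + 1 \<longleftrightarrow> 27 dvd r + 1"
    using dvd_residue_iff[of 27 243 0 b 1 a 1] by (simp add: r_def t_def)
  ultimately show ?thesis
    using rt by (elim UnE SigmaE insertE emptyE Pair_inject) (simp_all only:, simp_all)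
qed

lemma condition_13_dvd:
  fixes a b :: int
  assumes "(a mod 243, b mod 243) \<in> {1, 82, 163} \<times> {81, 162} \<union> {82, 163} \<times> {0}"
  shows "81 dvd a - 1 \<and> 81 dvd b \<and> \<not> (243 dvd a - 1 \<and> 243 dvd b)"
proof -
  define r t where "r = a mod 243" and "t = b mod 243"
  have rt: "(r, t) \<in> {1, 82, 163} \<times> {81, 162} \<union> {82, 163} \<times> {0}"
    using assms by (simp only: r_def t_def)
  have "81 dvd b \<longleftrightarrow> 81 dvd t"
    using dvd_residue_iff[of 81 243 1 b 0 a 0] by (simp add: r_def t_def)
  moreover have "243 dvd b \<longleftrightarrow> 243 dvd t"
    using dvd_residue_iff[of 243 243 1 b 0 a 0] by (simp add: r_def t_def)
  moreover have "81 dvd a - 1 \<longleftrightarrow> 81 dvd r - 1"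
    using dvd_residue_iff[of 81 243 0 b 1 a "-1"] by (simp add: r_def t_def)
  moreover have "243 dvd a - 1 \<longleftrightarrow> 243 dvd r - 1"
    using dvd_residue_iff[of 243 243 0 b 1 a "-1"] by (simp add: r_def t_def)
  ultimately show ?thesis
    using rt by (elim UnE SigmaE insertE emptyE Pair_inject) (simp_all only:, simp_all)
qed

context trinomial_near_root
begin

text \<open>Numbering the sides from the right end of the polygon, \<open>d = k - i\<close>, makes
  the divisibility condition independent of \<open>k\<close>.\<close>

lemma side_from_top:
  assumes "1 \<le> d" "d \<le> k" "3 ^ (d + 1) dvd a - \<epsilon>" "3 ^ (d + 1) dvd b"
  shows "\<exists>x. branch (trinomial (2 ^ s * 3 ^ k + 1) a b) q \<zeta> (2 * 3 ^ (k - d)) x"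
proof -
  have "k - (k - d) + 1 = d + 1" using assms by simp
  then show ?thesis using side_branch[of "k - d"] assms by (simp add: N_def)
qed

lemma first_from_top:
  assumes "2 \<le> d" "d \<le> k" "a - \<epsilon> = 3 ^ d * a'" "b = 3 ^ d * b'" "of_int a' * \<zeta> + of_int b' \<notin> M"
  shows "\<exists>x. branch (trinomial (2 ^ s * 3 ^ k + 1) a b) q \<zeta> (3 ^ (k - d + 1)) x"
proof -
  have "k - (k - d + 1) + 1 = d" using assms by simp
  then show ?thesis using first_branch[of "k - d + 1" a' b'] assms by (simp add: N_def)
qed

lemma simple_root:
  assumes "3 ^ (k + 1) dvd a - \<epsilon>" "3 ^ (k + 1) dvd b"
  shows "\<exists>x. branch (trinomial (2 ^ s * 3 ^ k + 1) a b) q \<zeta> 1 x"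
  using simple_branch[OF assms] by (simp add: N_def)

end

section \<open>Contradictions for the three families of conditions\<close>

context valuation_ring
begin

text \<open>For \<open>s = 0\<close> the only nonzero centre is \<open>- \<epsilon>\<close>, which
  must carry three branches. Divisibility by 27 gives the two rightmost sides. The third branch is
  the leftmost side if 81 does not divide the value of F at \<open>- \<epsilon>\<close>, the next
  regular side if 81 divides \<open>a - \<epsilon>\<close> and \<open>b\<close>, or a simple root if
  \<open>k = 2\<close>.\<close>

lemma not_monogenic_even_degree:
  assumes irr: "irreducible (map_poly rat_of_int (trinomial (3 ^ k + 1) a b))"
    and root: "ipoly (trinomial (3 ^ k + 1) a b) \<theta> = 0" and mono: "monogenic (rat_adjoin \<theta>)"
    and \<epsilon>: "\<epsilon> = 1 \<or> \<epsilon> = -1" and a: "27 dvd a - \<epsilon>" and b: "27 dvd b"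
    and cases: "k \<ge> 3 \<and> \<not> 81 dvd b - \<epsilon> * a + 1 \<or> k \<ge> 3 \<and> 81 dvd a - \<epsilon> \<and> 81 dvd b \<or> k = 2"
  shows False
proof -
  interpret T: trinomial_near_root V 0 k a b \<epsilon> "- of_int \<epsilon>" 3
    by unfold_locales (use \<epsilon> in auto)
  have k: "k \<ge> 2" using cases by auto
  have "\<exists>E. finite E \<and> card E = 3 \<and>
    (\<forall>e\<in>E. \<exists>x. branch (trinomial (3 ^ k + 1) a b) 3 (- of_int \<epsilon>) e x)"
  proof -
    have 9: "3 ^ (1 + 1) dvd a - \<epsilon>" "3 ^ (1 + 1) dvd b"
      using a b dvd_trans[of "9::int" 27] by auto
    have 27: "3 ^ (2 + 1) dvd a - \<epsilon>" "3 ^ (2 + 1) dvd b" using a b by auto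
    note side1 = T.side_from_top[OF _ _ 9, simplified]
    note side2 = T.side_from_top[OF _ _ 27, simplified]
    from cases show ?thesis
    proof (elim disjE conjE)
      assume k: "k \<ge> 3" and *: "\<not> 81 dvd b - \<epsilon> * a + 1"
      obtain a' b' where ab: "a - \<epsilon> = 27 * a'" "b = 27 * b'" using a b by (auto elim!: dvdE)
      have "\<not> 3 dvd b' - \<epsilon> * a'"
      proof
        assume "3 dvd b' - \<epsilon> * a'"
        then have "27 * 3 dvd 27 * (b' - \<epsilon> * a')" by (rule mult_dvd_mono[OF dvd_refl])
        also have "27 * (b' - \<epsilon> * a') = b - \<epsilon> * a + 1"
        proof -
          have "27 * (b' - \<epsilon> * a') = b - \<epsilon> * (a - \<epsilon>)" by (simp add: ab algebra_simps)
          also have "\<dots> = b - \<epsilon> * a + 1" using \<epsilon> by auto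
          finally show ?thesis .
        qed
        finally show False using * by simp
      qed
      then have "of_int (b' - \<epsilon> * a') \<notin> M" unfolding of_int_M .
      then have "of_int a' * (- of_int \<epsilon>) + of_int b' \<notin> M" by (simp add: algebra_simps)
      from T.first_from_top[of 3, OF _ k _ _ this] ab
      have first: "\<exists>x. branch (trinomial (3 ^ k + 1) a b) 3 (- of_int \<epsilon>) (3 ^ (k - 3 + 1)) x" by simp
      obtain k' where k': "k = k' + 3" using k by (metis le_add_diff_inverse2)
      show ?thesis
        by (rule exI[of _ "{3 ^ (k - 3 + 1), 2 * 3 ^ (k - 2), 2 * 3 ^ (k - 1)}"])
          (use first side1 side2 in \<open>auto simp: k'\<close>)
    next
      assume k: "k \<ge> 3" and 81: "81 dvd a - \<epsilon>" "81 dvd b"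
      obtain k' where k': "k = k' + 3" using k by (metis le_add_diff_inverse2)
      have "\<exists>x. branch (trinomial (3 ^ k + 1) a b) 3 (- of_int \<epsilon>) (2 * 3 ^ (k - 3)) x"
        using T.side_from_top[of 3] k 81 by simp
      then show ?thesis
        by (intro exI[of _ "{2 * 3 ^ (k - 3), 2 * 3 ^ (k - 2), 2 * 3 ^ (k - 1)}"])
          (use side1 side2 in \<open>auto simp: k'\<close>)
    next
      assume k: "k = 2"
      have "\<exists>x. branch (trinomial (3 ^ k + 1) a b) 3 (- of_int \<epsilon>) 1 x"
        using T.simple_root k a b by simp
      then show ?thesis
        by (intro exI[of _ "{1, 2 * 3 ^ (k - 2), 2 * 3 ^ (k - 1)}"])
          (use side1 side2 in \<open>auto simp: k\<close>)
    qed
  qed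
  then obtain E where E: "finite E" "card E = 3"
    "\<And>e. e \<in> E \<Longrightarrow> \<exists>x. branch (trinomial (3 ^ k + 1) a b) 3 (- of_int \<epsilon>) e x" by blast
  have "card ({- of_int \<epsilon> :: complex} \<times> E) \<le> 2"
  proof (rule card_branches_degree_1[OF irr _ root mono, where s = 0 and c = "- \<epsilon>"])
    show "3 ^ k + 1 \<ge> (2::nat)" by simp
    show "\<not> 3 dvd a" using a \<epsilon> by presburger
    show "3 dvd b" using b by presburger
  qed (use \<epsilon> E in auto)
  then show False using E by (simp add: card_cartesian_product)
qed

text \<open>For \<open>s \<ge> 1\<close> and \<open>\<epsilon> = -1\<close> both 1 and -1 are
  centres, and divisibility by 9 gives the rightmost side at each. One more branch at either of them
  makes three.\<close>

lemma not_monogenic_split: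
  assumes irr: "irreducible (map_poly rat_of_int (trinomial (2 ^ s * 3 ^ k + 1) a b))"
    and root: "ipoly (trinomial (2 ^ s * 3 ^ k + 1) a b) \<theta> = 0"
    and mono: "monogenic (rat_adjoin \<theta>)"
    and s: "s \<ge> 1" and k: "k \<ge> 1" and a: "9 dvd a + 1" and b: "9 dvd b"
    and cases: "k \<ge> 2 \<and> \<not> (27 dvd a + 1 \<and> 27 dvd b) \<or> k \<ge> 2 \<and> 27 dvd a + 1 \<and> 27 dvd b \<or> k = 1"
  shows False
proof -
  let ?F = "trinomial (2 ^ s * 3 ^ k + 1) a b"
  have T: "trinomial_near_root V s (-1) \<zeta> 3" if "\<zeta> = 1 \<or> \<zeta> = -1" for \<zeta>
    by unfold_locales (use that s in auto)
  have side1: "\<exists>x. branch ?F 3 \<zeta> (2 * 3 ^ (k - 1)) x" if "\<zeta> = 1 \<or> \<zeta> = -1" for \<zeta>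
    using trinomial_near_root.side_from_top[OF T[OF that], of 1] k a b by simp
  have "\<exists>\<zeta> e. (\<zeta> = 1 \<or> \<zeta> = -1) \<and> e \<noteq> 2 * 3 ^ (k - 1) \<and> (\<exists>x. branch ?F 3 \<zeta> e x)"
    using cases
  proof (elim disjE conjE)
    assume k: "k \<ge> 2" and *: "\<not> (27 dvd a + 1 \<and> 27 dvd b)"
    obtain a' b' where ab: "a + 1 = 9 * a'" "b = 9 * b'" using a b by (auto elim!: dvdE)
    have "\<not> (3 dvd a' \<and> 3 dvd b')"
      using * mult_dvd_mono[OF dvd_refl, of 3 a' 9] mult_dvd_mono[OF dvd_refl, of 3 b' 9]
      by (auto simp: ab)
    \<comment> \<open>The two numbers have sum \<open>2 b'\<close> and difference
      \<open>2 a'\<close>, so 3 cannot divide both. This selects the centre at which the constant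
      coefficient has exponent exactly 2.\<close>
    then have "\<not> 3 dvd a' + b' \<or> \<not> 3 dvd b' - a'" by presburger
    then obtain d :: int where d: "d = 1 \<or> d = -1" "\<not> 3 dvd a' * d + b'"
      by (metis diff_conv_add_uminus add.commute mult.right_neutral mult_minus1_right)
    have unit: "of_int a' * of_int d + of_int b' \<notin> M"
      using d(2) of_int_M[of "a' * d + b'"] by simp
    have d': "of_int d = (1::complex) \<or> of_int d = (-1::complex)" using d by auto
    have "\<exists>x. branch ?F 3 (of_int d) (3 ^ (k - 2 + 1)) x"
      using trinomial_near_root.first_from_top[OF T[OF d'], where d = 2 and a' = a' and b' = b'] k ab unit by simp
    moreover have "(3::nat) ^ (k - 2 + 1) \<noteq> 2 * 3 ^ (k - 1)"
    proof -
      have "k - 2 + 1 = k - 1" using k by simp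
      then show ?thesis by simp
    qed
    ultimately show ?thesis using d' by blast
  next
    assume k: "k \<ge> 2" and 27: "27 dvd a + 1" "27 dvd b"
    have "\<exists>x. branch ?F 3 1 (2 * 3 ^ (k - 2)) x"
      using trinomial_near_root.side_from_top[OF T[of 1], of 2] k 27 by simp
    moreover have "(2 * 3 ^ (k - 2) :: nat) \<noteq> 2 * 3 ^ (k - 1)" using k by simp
    ultimately show ?thesis by blast
  next
    assume k: "k = 1"
    have "\<exists>x. branch ?F 3 1 1 x"
      using trinomial_near_root.simple_root[OF T[of 1], where k = k and a = a and b = b] k a b by simp
    then show ?thesis by (intro exI[of _ 1] exI[of _ 1]) simp
  qed
  then obtain \<zeta> e where \<zeta>: "\<zeta> = 1 \<or> \<zeta> = -1" and e: "e \<noteq> 2 * 3 ^ (k - 1)" "\<exists>x. branch ?F 3 \<zeta> e x"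
    by blast
  define X where "X = {(\<zeta>, e), (\<zeta>, 2 * 3 ^ (k - 1)), (- \<zeta>, 2 * 3 ^ (k - 1))}"
  have "card X \<le> 2"
  proof (rule card_branches_degree_1[OF irr _ root mono, where s = s and c = 1])
    show "2 ^ s * 3 ^ k + 1 \<ge> (2::nat)" by simp
    show "\<not> 3 dvd a" using a by presburger
    show "3 dvd b" using b by presburger
    fix \<zeta>' f assume z: "(\<zeta>', f) \<in> X"
    then have "\<zeta>' = 1 \<or> \<zeta>' = -1" using \<zeta> by (auto simp: X_def)
    then show "\<zeta>' ^ 2 ^ s = of_int 1" using s by auto
    show "\<exists>x. branch ?F 3 \<zeta>' f x"
      using z e(2) side1[of \<zeta>] side1[of "- \<zeta>"] \<zeta> by (auto simp: X_def)
  qed (simp_all add: X_def)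
  moreover have "card X = 3" using \<zeta> e by (auto simp: X_def)
  ultimately show False by simp
qed

text \<open>For \<open>\<epsilon> = 1\<close> and \<open>s\<close> equal to 1 or 2 the centres are
  \<open>2 ^ s\<close> eighth roots of unity whose residues have degree two. Four branches at each
  centre for \<open>s = 1\<close>, or two for \<open>s = 2\<close>, make eight, against the bound
  six.\<close>

lemma not_monogenic_inert:
  assumes irr: "irreducible (map_poly rat_of_int (trinomial (2 ^ s * 3 ^ k + 1) a b))"
    and root: "ipoly (trinomial (2 ^ s * 3 ^ k + 1) a b) \<theta> = 0"
    and mono: "monogenic (rat_adjoin \<theta>)"
    and k: "k \<ge> 1" and a: "9 dvd a - 1" and b: "9 dvd b"
    and cases: "s = 1 \<and> k = 3 \<and> 81 dvd a - 1 \<and> 81 dvd b \<or>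
      s = 1 \<and> k \<ge> 4 \<and> 81 dvd a - 1 \<and> 81 dvd b \<and> \<not> (243 dvd a - 1 \<and> 243 dvd b) \<or>
      s = 2 \<and> k = 1 \<or> s = 2 \<and> k \<ge> 2 \<and> \<not> (27 dvd a - 1 \<and> 27 dvd b)"
  shows False
proof -
  let ?F = "trinomial (2 ^ s * 3 ^ k + 1) a b"
  define Z where "Z = {\<zeta>::complex. \<zeta> ^ (2 ^ s) = -1}"
  have s: "s = 1 \<or> s = 2" using cases by auto
  have Z8: "\<zeta> ^ 8 = 1" if "\<zeta> \<in> Z" for \<zeta>
  proof -
    have "\<zeta> ^ 8 = (\<zeta> ^ 2 ^ s) ^ (2 ^ (3 - s))"
      using s by (auto simp flip: power_mult)
    also have "\<dots> = 1" using that s by (auto simp: Z_def)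
    finally show ?thesis .
  qed
  have ZV: "\<zeta> \<in> V" if "\<zeta> \<in> Z" for \<zeta>
    using Z8[OF that] by (rule root_of_unity_V) simp
  have ZM: "\<zeta> \<notin> M" if "\<zeta> \<in> Z" for \<zeta>
    using M_power[OF ZV[OF that], of 8] Z8[OF that] M_1 by simp
  have T: "trinomial_near_root V s 1 \<zeta> 9" if "\<zeta> \<in> Z" for \<zeta>
  proof unfold_locales
    show "\<zeta> ^ 9 = \<zeta>" using power_add[of \<zeta> 8 1] Z8[OF that] by simp
    show "\<zeta> ^ 2 ^ s = - of_int 1" using that by (simp add: Z_def)
  qed simp_all
  have cube: "\<zeta> ^ 3 - \<zeta> \<notin> M" if z: "\<zeta> \<in> Z" for \<zeta>
  proof
    assume M: "\<zeta> ^ 3 - \<zeta> \<in> M"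
    have two: "2 \<notin> M" using of_int_M[of 2] by simp
    from s show False
    proof
      assume "s = 1"
      then have eq: "\<zeta> ^ 3 - \<zeta> = - (2 * \<zeta>)"
        using z by (simp add: Z_def power3_eq_cube power2_eq_square)
      show False using M[unfolded eq M_uminus_iff] unit_mult[OF two ZM[OF z]] by contradiction
    next
      assume "s = 2"
      \<comment> \<open>The extra factor brings in \<open>\<zeta> ^ 4 = -1\<close> and leaves
        \<open>- (2 * \<zeta> ^ 2)\<close>, a unit.\<close>
      have "(\<zeta> ^ 3 - \<zeta>) * (\<zeta> ^ 3 + \<zeta>) = \<zeta> ^ 2 * (\<zeta> ^ 4 - 1)"
        by (simp add: power2_eq_square power3_eq_cube power4_eq_xxxx algebra_simps)
      also have "\<dots> = - (2 * \<zeta> ^ 2)" using z \<open>s = 2\<close> by (simp add: Z_def)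
      finally have "- (2 * \<zeta> ^ 2) \<in> M"
        using M_mult[OF M V_intros(6)[OF V_intros(7)[OF ZV[OF z], of 3] ZV[OF z]]] by simp
      then have "\<zeta> ^ 2 \<in> M" using M_mult_cancel[OF two] by (simp add: M_uminus_iff)
      then show False using M_power[OF ZV[OF z], of 2] ZM[OF z] by simp
    qed
  qed
  have first: "\<exists>x. branch ?F 9 \<zeta> (3 ^ (k - d + 1)) x"
    if d: "2 \<le> d" "d \<le> k" "3 ^ d dvd a - 1" "3 ^ d dvd b"
      "\<not> (3 ^ (d + 1) dvd a - 1 \<and> 3 ^ (d + 1) dvd b)" and z: "\<zeta> \<in> Z" for d \<zeta>
  proof -
    obtain a' b' where ab: "a - 1 = 3 ^ d * a'" "b = 3 ^ d * b'" using d by (auto elim!: dvdE)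
    have "\<not> (3 dvd a' \<and> 3 dvd b')" using d(5) unfolding ab by (auto simp: mult.commute mult_dvd_mono)
    from unit_linear[OF ZV[OF z] cube[OF z] this]
    show ?thesis using trinomial_near_root.first_from_top[OF T[OF z] d(1,2)] ab by blast
  qed
  have side: "\<exists>x. branch ?F 9 \<zeta> (2 * 3 ^ (k - d)) x"
    if d: "1 \<le> d" "d \<le> k" "3 ^ (d + 1) dvd a - 1" "3 ^ (d + 1) dvd b" and z: "\<zeta> \<in> Z" for d \<zeta>
    using trinomial_near_root.side_from_top[OF T[OF z] d] .
  have simple: "\<exists>x. branch ?F 9 \<zeta> 1 x"
    if "3 ^ (k + 1) dvd a - 1" "3 ^ (k + 1) dvd b" and z: "\<zeta> \<in> Z" for \<zeta>
    using trinomial_near_root.simple_root[OF T[OF z]] that by blast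
  have side1: "\<exists>x. branch ?F 9 \<zeta> (2 * 3 ^ (k - 1)) x" if "\<zeta> \<in> Z" for \<zeta>
    using side[of 1 \<zeta>] that k a b by simp
  have "\<exists>E. finite E \<and> 2 ^ s * card E = 8 \<and> (\<forall>\<zeta>\<in>Z. \<forall>e\<in>E. \<exists>x. branch ?F 9 \<zeta> e x)"
    using cases
  proof (elim disjE conjE)
    assume *: "s = 1" "k = 3" "81 dvd a - 1" "81 dvd b"
    have 27: "27 dvd a - 1" "27 dvd b" using *(3,4) dvd_trans[of "27::int" 81] by auto
    have "\<exists>x. branch ?F 9 \<zeta> e x" if z: "\<zeta> \<in> Z" and e: "e \<in> {1, 2, 6, 18}" for \<zeta> e
    proof -
      from e consider "e = 1" | "e = 2 * 3 ^ (k - 3)" | "e = 2 * 3 ^ (k - 2)" | "e = 2 * 3 ^ (k - 1)"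
        using *(2) by auto
      then show ?thesis
        by cases (use *(2-4) 27 side1[OF z] side[of 2 \<zeta>, OF _ _ _ _ z] side[of 3 \<zeta>, OF _ _ _ _ z]
          simple[OF _ _ z] in simp_all)
    qed
    then show ?thesis using *(1) by (intro exI[of _ "{1, 2, 6, 18}"]) simp
  next
    assume *: "s = 1" "k \<ge> 4" "81 dvd a - 1" "81 dvd b" "\<not> (243 dvd a - 1 \<and> 243 dvd b)"
    have 27: "27 dvd a - 1" "27 dvd b" using *(3,4) dvd_trans[of "27::int" 81] by auto
    define E where "E = {3 ^ (k - 4 + 1), 2 * 3 ^ (k - 3), 2 * 3 ^ (k - 2), 2 * 3 ^ (k - 1) :: nat}"
    have "\<exists>x. branch ?F 9 \<zeta> e x" if z: "\<zeta> \<in> Z" and e: "e \<in> E" for \<zeta> e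
    proof -
      from e consider "e = 3 ^ (k - 4 + 1)" | "e = 2 * 3 ^ (k - 3)" | "e = 2 * 3 ^ (k - 2)"
        | "e = 2 * 3 ^ (k - 1)" unfolding E_def by blast
      then show ?thesis
        by cases (use *(2-5) 27 side1[OF z] side[of 2 \<zeta>, OF _ _ _ _ z] side[of 3 \<zeta>, OF _ _ _ _ z]
          first[of 4 \<zeta>, OF _ _ _ _ _ z] in simp_all)
    qed
    moreover have "card E = 4"
    proof -
      obtain k' where "k = k' + 4" using *(2) by (metis le_add_diff_inverse2)
      then show ?thesis by (simp add: E_def power_add)
    qed
    moreover have "finite E" by (simp add: E_def)
    ultimately show ?thesis using *(1) by (intro exI[of _ E]) simp
  next
    assume *: "s = 2" "k = 1"
    have "\<exists>x. branch ?F 9 \<zeta> e x" if z: "\<zeta> \<in> Z" and e: "e \<in> {1, 2}" for \<zeta> e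
    proof -
      from e consider "e = 1" | "e = 2 * 3 ^ (k - 1)" using *(2) by auto
      then show ?thesis
        by cases (use *(2) a b side1[OF z] simple[OF _ _ z] in simp_all)
    qed
    then show ?thesis using *(1) by (intro exI[of _ "{1, 2}"]) simp
  next
    assume *: "s = 2" "k \<ge> 2" "\<not> (27 dvd a - 1 \<and> 27 dvd b)"
    define E where "E = {3 ^ (k - 2 + 1), 2 * 3 ^ (k - 1) :: nat}"
    have "\<exists>x. branch ?F 9 \<zeta> e x" if z: "\<zeta> \<in> Z" and e: "e \<in> E" for \<zeta> e
    proof -
      from e consider "e = 3 ^ (k - 2 + 1)" | "e = 2 * 3 ^ (k - 1)" unfolding E_def by blast
      then show ?thesis
        by cases (use *(2,3) a b side1[OF z] first[of 2 \<zeta>, OF _ _ _ _ _ z] in simp_all)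
    qed
    moreover have "card E = 2"
    proof -
      obtain k' where "k = k' + 2" using *(2) by (metis le_add_diff_inverse2)
      then show ?thesis by (simp add: E_def power_add)
    qed
    moreover have "finite E" by (simp add: E_def)
    ultimately show ?thesis using *(1) by (intro exI[of _ E]) simp
  qed
  then obtain E where E: "finite E" "2 ^ s * card E = 8"
    "\<And>\<zeta> e. \<zeta> \<in> Z \<Longrightarrow> e \<in> E \<Longrightarrow> \<exists>x. branch ?F 9 \<zeta> e x" by blast
  have Z: "finite Z" "card Z = 2 ^ s"
    unfolding Z_def by (simp_all add: card_nth_roots finite_nth_roots)
  have "card (Z \<times> E) \<le> 6"
  proof (rule card_branches_degree_2[OF irr _ root mono, where s = s and c = "-1"])
    show "2 ^ s * 3 ^ k + 1 \<ge> (2::nat)" by simp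
    show "finite (Z \<times> E)" using Z E by simp
    fix \<zeta> e assume ze: "(\<zeta>, e) \<in> Z \<times> E"
    then show "\<zeta> ^ 2 ^ s = of_int (-1)" by (simp add: Z_def)
    show "\<zeta> ^ 3 - \<zeta> \<notin> M" using cube ze by blast
    show "\<exists>x. branch ?F 9 \<zeta> e x" using E(3) ze by blast
  qed simp
  then show False using Z E by (simp add: card_cartesian_product)
qed

end

text \<open>The first four conditions have \<open>s = 0\<close>, the next seven lead to
  \<open>\<epsilon> = -1\<close>, the last four to \<open>\<epsilon> = 1\<close>. Each one enters
  only through what it says about the divisibility of \<open>a\<close>, \<open>b\<close> and their
  combinations by powers of 3.\<close>

theorem corollary2p8:
  fixes s k :: nat and a b :: int and \<theta> :: complex
  assumes "k \<ge> 1"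
    and "irreducible (map_poly rat_of_int (trinomial (2 ^ s * 3 ^ k + 1) a b))"
    and "poly (map_poly of_int (trinomial (2 ^ s * 3 ^ k + 1) a b)) \<theta> = 0"
    and "(s = 0 \<and> k \<ge> 3 \<and>
         (a mod 81, b mod 81) \<in> {1, 80} \<times> {27, 54} \<union> {26, 28, 53, 55} \<times> {0}) \<or>
        (s = 0 \<and> k \<ge> 4 \<and>
         (a mod 243, b mod 243) \<in> {1, 242} \<times> {81, 162} \<union> {80, 82, 161, 163} \<times> {0}) \<or>
        (s = 0 \<and> k = 2 \<and> ([a = 1] (mod 81) \<or> [a = -1] (mod 81)) \<and> [b = 0] (mod 81)) \<or>
        (s = 0 \<and> k = 3 \<and> ([a = 1] (mod 243) \<or> [a = -1] (mod 243)) \<and> [b = 0] (mod 243)) \<or>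
        (s \<ge> 1 \<and> k \<ge> 2 \<and>
         (a mod 27, b mod 27) \<in> {26} \<times> {9, 18} \<union> {8, 17} \<times> {0}) \<or>
        (s \<ge> 1 \<and> k \<ge> 3 \<and>
         (a mod 81, b mod 81) \<in> {80} \<times> {27, 54} \<union> {26, 53} \<times> {0, 27, 54}) \<or>
        (s \<ge> 1 \<and> k = 1 \<and> [a = -1] (mod 27) \<and> [b = 0] (mod 27)) \<or>
        (s \<ge> 1 \<and> k = 2 \<and> [a = -1] (mod 81) \<and> [b = 0] (mod 81)) \<or>
        (s = 2 \<and> k = 3 \<and> [a = -1] (mod 243) \<and> [b = 0] (mod 243)) \<or>
        (s = 2 \<and> k \<ge> 4 \<and>
         (a mod 243, b mod 243) \<in> {80, 161, 242} \<times> {81, 162} \<union> {80, 161} \<times> {0}) \<or>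
        (s \<ge> 3 \<and> k \<ge> 2 \<and>
         (a mod 27, b mod 27) \<in> {8, 17, 26} \<times> {9, 18} \<union> {8, 17} \<times> {0}) \<or>
        (s = 1 \<and> k = 3 \<and> [a = 1] (mod 243) \<and> [b = 0] (mod 243)) \<or>
        (s = 1 \<and> k \<ge> 4 \<and>
         (a mod 243, b mod 243) \<in> {1, 82, 163} \<times> {81, 162} \<union> {82, 163} \<times> {0}) \<or>
        (s = 2 \<and> k = 1 \<and> [a = 1] (mod 27) \<and> [b = 0] (mod 27)) \<or>
        (s = 2 \<and> k \<ge> 2 \<and>
         (a mod 27, b mod 27) \<in> {1, 10, 19} \<times> {9, 18} \<union> {10, 19} \<times> {0})"
  shows "\<not> monogenic (rat_adjoin \<theta>)"
proof
  assume mono: "monogenic (rat_adjoin \<theta>)"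
  have ints: "subring (range of_int :: complex set)"
    by (rule subringI) (auto intro: range_eqI[of _ _ 1] simp flip: of_int_diff of_int_mult)
  have third: "inverse 3 \<notin> (range of_int :: complex set)"
  proof
    assume "inverse 3 \<in> (range of_int :: complex set)"
    then obtain d :: int where "inverse 3 = (of_int d :: complex)" by auto
    then have "of_int (3 * d) = (of_int 1 :: complex)" by (simp add: field_simps)
    then have "3 * d = 1" unfolding of_int_eq_iff .
    then show False by presburger
  qed
  have "(3 :: complex) \<in> range of_int" by (rule range_eqI[of _ _ 3]) simp
  from exists_valuation_ring[OF ints this third] obtain V :: "complex set"
    where V: "subring V" "inverse 3 \<notin> V" "\<And>x. x \<in> V \<or> inverse x \<in> V" by metis
  interpret valuation_ring V by unfold_locales (use V in auto)
  note split = not_monogenic_split[OF assms(2,3) mono]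
  note inert = not_monogenic_inert[OF assms(2,3) mono assms(1)]
  have even: False if "s = 0" "\<epsilon> = 1 \<or> \<epsilon> = -1" "27 dvd a - \<epsilon>" "27 dvd b"
    "k \<ge> 3 \<and> \<not> 81 dvd b - \<epsilon> * a + 1 \<or> k \<ge> 3 \<and> 81 dvd a - \<epsilon> \<and> 81 dvd b \<or> k = 2" for \<epsilon>
    using not_monogenic_even_degree[of k a b \<theta> \<epsilon>] assms(2,3) mono that by simp
  from assms(4) show False
  proof (elim disjE conjE)
    assume "s = 0" "k \<ge> 3"
      "(a mod 81, b mod 81) \<in> {1, 80} \<times> {27, 54} \<union> {26, 28, 53, 55} \<times> {0}"
    from condition_1_dvd[OF this(3)] show False
    proof (elim conjE disjE)
      assume "27 dvd b" "27 dvd a - 1" "\<not> 81 dvd b - a + 1"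
      then show False by (intro even[of 1]) (simp_all add: \<open>s = 0\<close> \<open>k \<ge> 3\<close>)
    next
      assume "27 dvd b" "27 dvd a + 1" "\<not> 81 dvd b + a + 1"
      then show False by (intro even[of "-1"]) (simp_all add: \<open>s = 0\<close> \<open>k \<ge> 3\<close>)
    qed
  next
    assume *: "s = 0" "k \<ge> 4"
      "(a mod 243, b mod 243) \<in> {1, 242} \<times> {81, 162} \<union> {80, 82, 161, 163} \<times> {0}"
    from condition_2_dvd[OF *(3)] show False
    proof (elim conjE disjE)
      assume "81 dvd b" "81 dvd a - 1"
      then show False
        by (intro even[of 1]) (use * dvd_trans[of "27::int" 81] in simp_all)
    next
      assume "81 dvd b" "81 dvd a + 1"
      then show False
        by (intro even[of "-1"]) (use * dvd_trans[of "27::int" 81] in simp_all)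
    qed
  next
    assume *: "s = 0" "k = 2" "[b = 0] (mod 81)" "[a = 1] (mod 81)"
    have "27 dvd b" "27 dvd a - 1"
      using dvd_diff_of_cong[OF *(3), of 27]
        dvd_diff_of_cong[OF *(4), of 27] by simp_all
    then show False by (intro even[of 1]) (use * in simp_all)
  next
    assume *: "s = 0" "k = 2" "[b = 0] (mod 81)" "[a = -1] (mod 81)"
    have "27 dvd b" "27 dvd a + 1"
      using dvd_diff_of_cong[OF *(3), of 27]
        dvd_diff_of_cong[OF *(4), of 27] by simp_all
    then show False by (intro even[of "-1"]) (use * in simp_all)
  next
    assume *: "s = 0" "k = 3" "[b = 0] (mod 243)" "[a = 1] (mod 243)"
    have "27 dvd b" "27 dvd a - 1" "81 dvd b" "81 dvd a - 1"
      using dvd_diff_of_cong[OF *(3), of 27] dvd_diff_of_cong[OF *(3), of 81]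
        dvd_diff_of_cong[OF *(4), of 27]
        dvd_diff_of_cong[OF *(4), of 81] by simp_all
    then show False by (intro even[of 1]) (use * in simp_all)
  next
    assume *: "s = 0" "k = 3" "[b = 0] (mod 243)" "[a = -1] (mod 243)"
    have "27 dvd b" "27 dvd a + 1" "81 dvd b" "81 dvd a + 1"
      using dvd_diff_of_cong[OF *(3), of 27] dvd_diff_of_cong[OF *(3), of 81]
        dvd_diff_of_cong[OF *(4), of 27]
        dvd_diff_of_cong[OF *(4), of 81] by simp_all
    then show False by (intro even[of "-1"]) (use * in simp_all)
  next
    assume *: "s \<ge> 1" "k \<ge> 2" "(a mod 27, b mod 27) \<in> {26} \<times> {9, 18} \<union> {8, 17} \<times> {0}"
    \<comment> \<open>\<open>split\<close> asks only for \<open>s \<ge> 1\<close>, so this shorter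
      list of residues can be treated as part of the longer one.\<close>
    then have "(a mod 27, b mod 27) \<in> {8, 17, 26} \<times> {9, 18} \<union> {8, 17} \<times> {0}" by auto
    from condition_11_dvd[OF this] show False by (intro split) (use * in simp_all)
  next
    assume *: "s \<ge> 1" "k \<ge> 3"
      "(a mod 81, b mod 81) \<in> {80} \<times> {27, 54} \<union> {26, 53} \<times> {0, 27, 54}"
    have 27: "27 dvd a + 1" "27 dvd b" using condition_6_dvd[OF *(3)] by blast+
    then have "9 dvd a + 1" "9 dvd b" using dvd_trans[of "9::int" 27] by auto
    then show False by (intro split) (use * 27 in simp_all)
  next
    assume *: "s \<ge> 1" "k = 1" "[a = -1] (mod 27)" "[b = 0] (mod 27)"
    have "9 dvd a + 1" "9 dvd b"
      using dvd_diff_of_cong[OF *(3), of 9]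
        dvd_diff_of_cong[OF *(4), of 9] by simp_all
    then show False by (intro split) (use * in simp_all)
  next
    assume *: "s \<ge> 1" "k = 2" "[a = -1] (mod 81)" "[b = 0] (mod 81)"
    have "9 dvd a + 1" "9 dvd b" "27 dvd a + 1" "27 dvd b"
      using dvd_diff_of_cong[OF *(3), of 9] dvd_diff_of_cong[OF *(3), of 27]
        dvd_diff_of_cong[OF *(4), of 9]
        dvd_diff_of_cong[OF *(4), of 27] by simp_all
    then show False by (intro split) (use * in simp_all)
  next
    assume *: "s = 2" "k = 3" "[a = -1] (mod 243)" "[b = 0] (mod 243)"
    have "9 dvd a + 1" "9 dvd b" "27 dvd a + 1" "27 dvd b"
      using dvd_diff_of_cong[OF *(3), of 9] dvd_diff_of_cong[OF *(3), of 27]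
        dvd_diff_of_cong[OF *(4), of 9]
        dvd_diff_of_cong[OF *(4), of 27] by simp_all
    then show False by (intro split) (use * in simp_all)
  next
    assume *: "s = 2" "k \<ge> 4"
      "(a mod 243, b mod 243) \<in> {80, 161, 242} \<times> {81, 162} \<union> {80, 161} \<times> {0}"
    have 27: "27 dvd a + 1" "27 dvd b" using condition_10_dvd[OF *(3)] by blast+
    then have "9 dvd a + 1" "9 dvd b" using dvd_trans[of "9::int" 27] by auto
    then show False by (intro split) (use * 27 in simp_all)
  next
    assume *: "s \<ge> 3" "k \<ge> 2"
      "(a mod 27, b mod 27) \<in> {8, 17, 26} \<times> {9, 18} \<union> {8, 17} \<times> {0}"
    from condition_11_dvd[OF *(3)] show False by (intro split) (use * in simp_all)
  next
    assume *: "s = 1" "k = 3" "[a = 1] (mod 243)" "[b = 0] (mod 243)"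
    have "9 dvd a - 1" "9 dvd b" "81 dvd a - 1" "81 dvd b"
      using dvd_diff_of_cong[OF *(3), of 9] dvd_diff_of_cong[OF *(3), of 81]
        dvd_diff_of_cong[OF *(4), of 9]
        dvd_diff_of_cong[OF *(4), of 81] by simp_all
    then show False by (intro inert) (use * in simp_all)
  next
    assume *: "s = 1" "k \<ge> 4"
      "(a mod 243, b mod 243) \<in> {1, 82, 163} \<times> {81, 162} \<union> {82, 163} \<times> {0}"
    have 81: "81 dvd a - 1" "81 dvd b" "\<not> (243 dvd a - 1 \<and> 243 dvd b)"
      using condition_13_dvd[OF *(3)] by blast+
    then have "9 dvd a - 1" "9 dvd b" using dvd_trans[of "9::int" 81] by auto
    then show False by (intro inert) (use * 81 in simp_all)
  next
    assume *: "s = 2" "k = 1" "[a = 1] (mod 27)" "[b = 0] (mod 27)"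
    have "9 dvd a - 1" "9 dvd b"
      using dvd_diff_of_cong[OF *(3), of 9]
        dvd_diff_of_cong[OF *(4), of 9] by simp_all
    then show False by (intro inert) (use * in simp_all)
  next
    assume *: "s = 2" "k \<ge> 2"
      "(a mod 27, b mod 27) \<in> {1, 10, 19} \<times> {9, 18} \<union> {10, 19} \<times> {0}"
    from condition_15_dvd[OF *(3)] show False by (intro inert) (use * in simp_all)
  qed
qed

end
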